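(* Let the random weights, the activation $\sigma$ and the input matrices $X$ satisfy the assumptions listed in the context (Gaussian weights, activation assumptions, asymptotic assumptions), and suppose $\sigma$ is not a linear function. Let $\lambda\ge0$ be the ridge parameter and $\mathbf{y}\in\mathbb{R}^n$ the vector of training labels. Then, for all large $n$, with probability at least $1-4e^{-2n}$, $$\left|E_{\mathrm{train}}^{(RF,\lambda)}-E_{\mathrm{train}}^{(K,\lambda)}\right|\le\frac{C_1}{\sqrt{nd_1}}\left(\sqrt{\frac{n}{d_1}}+C_2\right)\|\mathbf{y}\|^2,$$ where the constants $C_1$ and $C_2$ only depend on $\lambda$, $B$ and $\sigma$.
   Context: Weights. $W\in\mathbb{R}^{d_1\times d_0}$ has i.i.d. $\mathcal{N}(0,1)$ entries with rows $\mathbf{w}_i^\top$; $X=(\mathbf{x}_1,\dots,\mathbf{x}_n)\in\mathbb{R}^{d_0\times n}$ is deterministic. Kernels and predictors. For $\mathbf{x},\mathbf{z}\in\mathbb{R}^{d_0}$, $$K_n(\mathbf{x},\mathbf{z}):=\frac1{d_1}\sum_{i=1}^{d_1}\sigma(\langle\mathbf{w}_i,\mathbf{x}\rangle)\sigma(\langle\mathbf{w}_i,\mathbf{z}\rangle),\qquad K(\mathbf{x},\mathbf{z}):=\mathbb{E}_{\mathbf{w}\sim\mathcal{N}(0,\mathrm{Id})}[\sigma(\langle\mathbf{w},\mathbf{x}\rangle)\sigma(\langle\mathbf{w},\mathbf{z}\rangle)].$$ For a kernel $k\in\{K_n,K\}$, $k(X,X)$ is the $n\times n$ matrix with entries $k(\mathbf{x}_i,\mathbf{x}_j)$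 and $k(\mathbf{x},X)=[k(\mathbf{x},\mathbf{x}_1),\dots,k(\mathbf{x},\mathbf{x}_n)]$. The random feature and kernel ridge predictors are $$\hat f^{(RF)}_\lambda(\mathbf{x}):=K_n(\mathbf{x},X)(K_n(X,X)+\lambda\mathrm{Id})^{-1}\mathbf{y},\qquad \hat f^{(K)}_\lambda(\mathbf{x}):=K(\mathbf{x},X)(K(X,X)+\lambda\mathrm{Id})^{-1}\mathbf{y},$$ and $\hat f(X)=(\hat f(\mathbf{x}_1),\dots,\hat f(\mathbf{x}_n))^\top$. Training errors: $$E_{\mathrm{train}}^{(RF,\lambda)}:=\frac1n\|\hat f^{(RF)}_\lambda(X)-\mathbf{y}\|^2=\frac{\lambda^2}{n}\|(K_n(X,X)+\lambda\mathrm{Id})^{-1}\mathbf{y}\|^2,\quad E_{\mathrm{train}}^{(K,\lambda)}:=\frac1n\|\hat f^{(K)}_\lambda(X)-\mathbf{y}\|^2=\frac{\lambda^2}{n}\|(K(X,X)+\lambda\mathrm{Id})^{-1}\mathbf{y}\|^2.$$ Activation assumptions. $\sigma:\mathbb{R}\to\mathbb{R}$ is Lipschitz with constant $\lambda_\sigma\in(0,\infty)$; for $\xi\sim\mathcal{N}(0,1)$, $\mathbb{E}[\sigma(\xi)]=0$ and $\mathbb{E}[\sigma(\xi)^2]=1$. Moreover, either (1) $\sigma$ is twice differentiable with $\sup_x|\sigma''(x)|\le\lambda_\sigma$, or (2) $\sigma(x)=ax+b$ for $x>0$ and $\sigma(x)=cx+b$ for $x\le0$, with constants $a,b,c\in\mathbb{R}$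 such that the two normalizations hold. $(\varepsilon,B)$-orthonormality. $X$ is $(\varepsilon,B)$-orthonormal if for all distinct columns $\mathbf{x}_\alpha,\mathbf{x}_\beta$: $|\|\mathbf{x}_\alpha\|-1|\le\varepsilon$, $|\|\mathbf{x}_\beta\|-1|\le\varepsilon$, $|\mathbf{x}_\alpha^\top\mathbf{x}_\beta|\le\varepsilon$, and also $\sum_{\alpha=1}^n(\|\mathbf{x}_\alpha\|-1)^2\le B^2$ and $\|X\|\le B$ (spectral norm). Asymptotic assumptions. $n,d_0,d_1\to\infty$ such that (a) $n/d_1\to0$; (b) $X$ is $(\varepsilon_n,B)$-orthonormal with $B$ a constant and $n\varepsilon_n^4\to0$; (c) the empirical spectral distribution of $X^\top X$ converges weakly to a fixed non-degenerate probability distribution $\mu_0\neq\delta_0$ on $[0,\infty)$. *)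

theory Defs
  imports
    "HOL-Probability.Probability"
    "Jordan_Normal_Form.Char_Poly"
    "Jordan_Normal_Form.Gauss_Jordan_Elimination"
begin

unbundle no inner_syntax
unbundle no vec_syntax
hide_const (open) Finite_Cartesian_Product.vec Finite_Cartesian_Product.mat
  Finite_Cartesian_Product.row

text \<open>Vectors and matrices are those of \<^theory>\<open>Jordan_Normal_Form.Matrix\<close>, since the
  dimensions vary along a sequence.\<close>

definition vec_nrm :: "real vec \<Rightarrow> real" where
  "vec_nrm v = sqrt (v \<bullet> v)"

definition spectral_norm :: "real mat \<Rightarrow> real" where
  "spectral_norm A =
     (SUP v \<in> {v \<in> carrier_vec (dim_col A). vec_nrm v \<le> 1}. vec_nrm (A *\<^sub>v v))"

text \<open>The uniform distribution on the eigenvalues, counted with algebraic multiplicity. It is only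
  meant for nonempty square matrices whose eigenvalues are all real (e.g. symmetric ones).\<close>

definition empirical_spectral_distribution :: "real mat \<Rightarrow> real measure" where
  "empirical_spectral_distribution A =
     distr (measure_pmf (pmf_of_multiset (proots (char_poly A)))) borel (\<lambda>x. x)"

definition std_gaussian :: "'i set \<Rightarrow> ('i \<Rightarrow> real) measure" where
  "std_gaussian I = (\<Pi>\<^sub>M i\<in>I. std_normal_distribution)"

definition activation :: "(real \<Rightarrow> real) \<Rightarrow> bool" where
  "activation \<sigma> \<longleftrightarrow>
     (\<exists>L>0. L-lipschitz_on UNIV \<sigma>
        \<and> (\<integral>x. \<sigma> x \<partial>std_normal_distribution) = 0
        \<and> (\<integral>x. (\<sigma> x)\<^sup>2 \<partial>std_normal_distribution) = 1
        \<and> ((\<exists>\<sigma>' \<sigma>''. \<forall>x. (\<sigma> has_real_derivative \<sigma>' x) (at x)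
                        \<and> (\<sigma>' has_real_derivative \<sigma>'' x) (at x)
                        \<and> \<bar>\<sigma>'' x\<bar> \<le> L)
          \<or> (\<exists>a b c. \<forall>x. \<sigma> x = (if x > 0 then a * x + b else c * x + b))))"

definition rf_kernel :: "(real \<Rightarrow> real) \<Rightarrow> real mat \<Rightarrow> real vec \<Rightarrow> real vec \<Rightarrow> real" where
  "rf_kernel \<sigma> W x z =
     (1 / real (dim_row W)) * (\<Sum>i<dim_row W. \<sigma> (row W i \<bullet> x) * \<sigma> (row W i \<bullet> z))"

definition expected_kernel :: "(real \<Rightarrow> real) \<Rightarrow> real vec \<Rightarrow> real vec \<Rightarrow> real" where
  "expected_kernel \<sigma> x z =
     (\<integral>w. \<sigma> (vec (dim_vec x) w \<bullet> x) * \<sigma> (vec (dim_vec x) w \<bullet> z)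
        \<partial>std_gaussian {..<dim_vec x})"

definition kernel_mat :: "(real vec \<Rightarrow> real vec \<Rightarrow> real) \<Rightarrow> real mat \<Rightarrow> real mat" where
  "kernel_mat k X = mat (dim_col X) (dim_col X) (\<lambda>(i, j). k (col X i) (col X j))"

definition kernel_vec :: "(real vec \<Rightarrow> real vec \<Rightarrow> real) \<Rightarrow> real vec \<Rightarrow> real mat \<Rightarrow> real vec" where
  "kernel_vec k x X = vec (dim_col X) (\<lambda>j. k x (col X j))"

definition ridge_mat :: "(real vec \<Rightarrow> real vec \<Rightarrow> real) \<Rightarrow> real \<Rightarrow> real mat \<Rightarrow> real mat" where
  "ridge_mat k lam X = kernel_mat k X + lam \<cdot>\<^sub>m 1\<^sub>m (dim_col X)"

text \<open>The predictor and the training error are meaningful only if the regularized kernel matrix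
  is invertible; for \<open>lam = 0\<close> this is not automatic.\<close>

definition ridge_predictor ::
    "(real vec \<Rightarrow> real vec \<Rightarrow> real) \<Rightarrow> real \<Rightarrow> real mat \<Rightarrow> real vec \<Rightarrow> real vec \<Rightarrow> real" where
  "ridge_predictor k lam X y x =
     kernel_vec k x X \<bullet> (the (mat_inverse (ridge_mat k lam X)) *\<^sub>v y)"

definition train_error ::
    "(real vec \<Rightarrow> real vec \<Rightarrow> real) \<Rightarrow> real \<Rightarrow> real mat \<Rightarrow> real vec \<Rightarrow> real" where
  "train_error k lam X y =
     (1 / real (dim_col X)) *
     (vec_nrm (vec (dim_col X) (\<lambda>i. ridge_predictor k lam X y (col X i)) - y))\<^sup>2"

definition orthonormal_up_to :: "real \<Rightarrow> real \<Rightarrow> real mat \<Rightarrow> bool" where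
  "orthonormal_up_to \<epsilon> B X \<longleftrightarrow>
     (\<forall>\<alpha><dim_col X. \<forall>\<beta><dim_col X. \<alpha> \<noteq> \<beta> \<longrightarrow>
         \<bar>vec_nrm (col X \<alpha>) - 1\<bar> \<le> \<epsilon> \<and> \<bar>vec_nrm (col X \<beta>) - 1\<bar> \<le> \<epsilon>
         \<and> \<bar>col X \<alpha> \<bullet> col X \<beta>\<bar> \<le> \<epsilon>)
     \<and> (\<Sum>\<alpha><dim_col X. (vec_nrm (col X \<alpha>) - 1)\<^sup>2) \<le> B\<^sup>2
     \<and> spectral_norm X \<le> B"

text \<open>The limit is taken along an arbitrary sequence \<open>(n k, d0 k, d1 k)\<close> of dimensions.\<close>

definition asymptotic_regime ::
    "real \<Rightarrow> (nat \<Rightarrow> nat) \<Rightarrow> (nat \<Rightarrow> nat) \<Rightarrow> (nat \<Rightarrow> nat) \<Rightarrow> (nat \<Rightarrow> real mat) \<Rightarrow> bool" where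
  "asymptotic_regime B n d0 d1 X \<longleftrightarrow>
     filterlim n at_top sequentially
     \<and> filterlim d0 at_top sequentially
     \<and> filterlim d1 at_top sequentially
     \<and> (\<forall>k. X k \<in> carrier_mat (d0 k) (n k))
     \<and> (\<lambda>k. real (n k) / real (d1 k)) \<longlonglongrightarrow> 0
     \<and> (\<exists>\<epsilon>. (\<forall>k. orthonormal_up_to (\<epsilon> k) B (X k))
            \<and> (\<lambda>k. real (n k) * \<epsilon> k ^ 4) \<longlonglongrightarrow> 0)
     \<and> (\<exists>\<mu>0. real_distribution \<mu>0 \<and> (AE x in \<mu>0. 0 \<le> x) \<and> \<mu>0 \<noteq> return borel 0
            \<and> weak_conv_m (\<lambda>k. empirical_spectral_distribution (transpose_mat (X k) * X k)) \<mu>0)"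

end

theory Submission
  imports Defs
begin

text \<open>Let \<open>F\<^sub>u w = (\<Sum>\<alpha>. u \<alpha> * \<sigma> \<langle>w, x\<^sub>\<alpha>\<rangle>)\<close>. The quadratic form of the random feature kernel matrix at \<open>u\<close> is the
average of \<open>F\<^sub>u\<^sup>2\<close> over the \<open>d1\<close> independent rows of the weight matrix, and the quadratic form of the
expected kernel matrix is the mean of \<open>F\<^sub>u\<^sup>2\<close>. If \<open>p\<close> solves \<open>(k(X, X) + lam Id) p = y\<close>, then the residual
of the ridge predictor is \<open>- lam p\<close> and the training error is \<open>lam\<^sup>2 |p|\<^sup>2 / n\<close>. For \<open>lam > 0\<close> the resolvent
identity bounds the difference of the two errors by \<open>2 \<parallel>K\<^sub>n - K\<parallel> |y|\<^sup>2 / (n lam)\<close>, and since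
\<open>sqrt (n / d1) / n = 1 / sqrt (n d1)\<close> it is enough to show \<open>\<parallel>K\<^sub>n - K\<parallel> \<le> C sqrt (n / d1)\<close> with high
probability. For \<open>lam = 0\<close> both errors vanish, and the content of the theorem is that both kernel
matrices are invertible; this follows from the same estimate together with a lower bound on the
smallest eigenvalue of \<open>K\<close>.

\<^emph>\<open>Concentration.\<close> For \<open>|u| \<le> 1\<close> the function \<open>F\<^sub>u\<close> of a Gaussian vector is Lipschitz with a constant that
does not depend on the dimensions, so it concentrates around its mean by the rotation argument of Maurey
and Pisier (\<open>exp_square_increment_lipschitz\<close>). Its mean is bounded, because \<open>\<sigma>\<close> has mean zero and the
norms of the columns are square-summably close to one (\<open>feature_mean\<close>). Hence \<open>F\<^sub>u\<^sup>2\<close> has an exponential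
moment (\<open>feature_exp_moment\<close>), the average over the rows obeys a Bernstein inequality
(\<open>rows_bernstein\<close>), and a union bound over a net of the unit ball with \<open>exp (18 n)\<close> points
gives the operator norm (\<open>kernel_concentration\<close>).

\<^emph>\<open>Invertibility.\<close> Testing \<open>F\<^sub>u\<close> against a combination of Hermite polynomials of degree \<open>k\<close> in the variables
\<open>\<langle>w, x\<^sub>\<beta>\<rangle>\<close> bounds the mean of \<open>F\<^sub>u\<^sup>2\<close> from below by a multiple of the quadratic form of the entrywise
\<open>k\<close>-th power of the correlation matrix. For \<open>k \<ge> 4\<close> its off-diagonal entries are at most of order \<open>\<epsilon>\<^sup>4\<close>, and
\<open>n \<epsilon>\<^sup>4 \<rightarrow> 0\<close> makes it close to the identity (\<open>mean_kernel_lower_bound\<close>). Degree two would not do: for two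
mutually unbiased orthonormal bases the entrywise square is singular. A nonzero Hermite
coefficient of degree at least four exists, since otherwise \<open>\<sigma>\<close> would be a cubic polynomial, and a
Lipschitz cubic polynomial of mean zero is linear (\<open>nonlinear_hermite_coefficient\<close>).\<close>

section \<open>Rotations and linear images of the standard Gaussian measure\<close>

abbreviation N :: "real measure" where "N \<equiv> std_normal_distribution"

interpretation N: prob_space N
  using real_dist_normal_dist by (simp add: real_distribution_def)

interpretation PN: product_prob_space "\<lambda>_. N" I for I :: "'i set"
  by (intro product_prob_spaceI N.prob_space_axioms)

interpretation NN: pair_prob_space N N ..

lemma sets_N [measurable_cong, simp]: "sets N = sets borel" by simp
lemma emeasure_N_UNIV [simp]: "emeasure N UNIV = 1" using N.emeasure_space_1 by simp

lemma prob_space_std_gaussian: "prob_space (std_gaussian I)"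
  unfolding std_gaussian_def by (intro prob_space_PiM N.prob_space_axioms)

lemma nn_integral_N:
  assumes [measurable]: "f \<in> borel_measurable borel"
  shows "(\<integral>\<^sup>+x. f x \<partial>N) = (\<integral>\<^sup>+x. ennreal (std_normal_density x) * f x \<partial>lborel)"
  by (simp add: nn_integral_density)

lemma std_normal_density_rot:
  assumes "c\<^sup>2 + s\<^sup>2 = (1::real)"
  shows "std_normal_density (c * u - s * v) * std_normal_density (s * u + c * v)
       = std_normal_density u * std_normal_density v"
proof -
  have "(c * u - s * v)\<^sup>2 + (s * u + c * v)\<^sup>2 = (c\<^sup>2 + s\<^sup>2) * (u\<^sup>2 + v\<^sup>2)" by (simp add: algebra_simps power2_eq_square)
  then have "(c * u - s * v)\<^sup>2 + (s * u + c * v)\<^sup>2 = u\<^sup>2 + v\<^sup>2" using assms by simp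
  then have "exp (- (c * u - s * v)\<^sup>2 / 2) * exp (- (s * u + c * v)\<^sup>2 / 2) = exp (- u\<^sup>2 / 2) * exp (- v\<^sup>2 / 2)"
    by (simp add: exp_add [symmetric] field_simps)
  then show ?thesis by (simp add: std_normal_density_def field_simps)
qed

lemma nn_integral_N_reflect:
  assumes [measurable]: "f \<in> borel_measurable borel"
  shows "(\<integral>\<^sup>+x. f (- x) \<partial>N) = (\<integral>\<^sup>+x. f x \<partial>N)"
  by (subst (1 2) nn_integral_N, simp, simp)
     (subst (2) nn_integral_real_affine[where c="-1" and t=0], simp_all add: std_normal_density_def)

text \<open>Instead of a change of variables in the plane, two affine substitutions on the line are used: first the second
coordinate is replaced by \<open>u = c x + s y\<close>, then, after exchanging the integrals, the first one by
\<open>x = c u - s v\<close>. Their Jacobians cancel, and the density is invariant by \<open>std_normal_density_rot\<close>.\<close>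

lemma gaussian_pair_rotate:
  fixes f :: "real \<times> real \<Rightarrow> ennreal"
  assumes cs: "c\<^sup>2 + s\<^sup>2 = (1::real)" and f[measurable]: "f \<in> borel_measurable (borel \<Otimes>\<^sub>M borel)"
  shows "(\<integral>\<^sup>+x. \<integral>\<^sup>+y. f (c*x + s*y, c*y - s*x) \<partial>N \<partial>N) = (\<integral>\<^sup>+x. \<integral>\<^sup>+y. f (x, y) \<partial>N \<partial>N)"
proof (cases "s = 0")
  case True
  then have "c = 1 \<or> c = -1" using cs by (simp add: power2_eq_1_iff)
  then show ?thesis
  proof
    assume "c = -1"
    have "(\<integral>\<^sup>+x. \<integral>\<^sup>+y. f (-x, -y) \<partial>N \<partial>N) = (\<integral>\<^sup>+x. \<integral>\<^sup>+y. f (-x, y) \<partial>N \<partial>N)"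
      by (subst nn_integral_N_reflect[of "\<lambda>y. f (- _, y)"]) simp_all
    also have "\<dots> = (\<integral>\<^sup>+x. \<integral>\<^sup>+y. f (x, y) \<partial>N \<partial>N)"
      by (subst nn_integral_N_reflect[of "\<lambda>x. \<integral>\<^sup>+y. f (x, y) \<partial>N"]) simp_all
    finally show ?thesis using True \<open>c = -1\<close> by simp
  qed (use True in simp)
next
  case False
  let ?\<phi> = "\<lambda>x. ennreal (std_normal_density x)"
  have "(\<integral>\<^sup>+x. \<integral>\<^sup>+y. f (c*x + s*y, c*y - s*x) \<partial>N \<partial>N)
      = (\<integral>\<^sup>+x. ?\<phi> x * (\<integral>\<^sup>+y. ?\<phi> y * f (c*x + s*y, c*y - s*x) \<partial>lborel) \<partial>lborel)"
    by (subst nn_integral_N, simp, subst nn_integral_N, simp, simp)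
  also have "\<dots> = (\<integral>\<^sup>+x. \<integral>\<^sup>+y. ?\<phi> x * (?\<phi> y * f (c*x + s*y, c*y - s*x)) \<partial>lborel \<partial>lborel)"
    by (simp add: nn_integral_cmult)
  also have "\<dots> = (\<integral>\<^sup>+x. ennreal \<bar>1/s\<bar> * (\<integral>\<^sup>+u. ?\<phi> x * (?\<phi> (- c*x/s + (1/s)* u) *
       f (c*x + s*(- c*x/s + (1/s)* u), c*(- c*x/s + (1/s)* u) - s*x)) \<partial>lborel) \<partial>lborel)"
    using False by (intro nn_integral_cong nn_integral_real_affine) simp_all
  also have "\<dots> = (\<integral>\<^sup>+x. (\<integral>\<^sup>+u. ennreal \<bar>1/s\<bar> * (?\<phi> x * (?\<phi> ((u - c*x)/s) *
       f (u, (c * u - x)/s))) \<partial>lborel) \<partial>lborel)"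
  proof -
    have 1: "c*x + s*(- c*x/s + (1/s)* u) = u" for x u using False by (simp add: field_simps)
    have 2: "- c*x/s + (1/s)* u = (u - c*x)/s" for x u using False by (simp add: field_simps)
    have key: "c * u - x = c*(u - c*x) - s*(s*x)" for x u
    proof -
      have "c*(u - c*x) - s*(s*x) = c * u - (c\<^sup>2+s\<^sup>2)*x" by (simp add: algebra_simps power2_eq_square)
      then show ?thesis using cs by simp
    qed
    have 3: "c*((u - c*x)/s) - s*x = (c * u - x)/s" for x u
      unfolding key[of u x] using False by (simp add: diff_divide_distrib right_diff_distrib)
    show ?thesis unfolding 1 unfolding 2 unfolding 3 
      by (subst nn_integral_cmult) simp_all
  qed
  also have "\<dots> = (\<integral>\<^sup>+u. (\<integral>\<^sup>+x. ennreal \<bar>1/s\<bar> * (?\<phi> x * (?\<phi> ((u - c*x)/s) *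
       f (u, (c * u - x)/s))) \<partial>lborel) \<partial>lborel)"
    by (rule lborel_pair.Fubini') simp
  also have "\<dots> = (\<integral>\<^sup>+u. ennreal \<bar>-s\<bar> * (\<integral>\<^sup>+v. ennreal \<bar>1/s\<bar> * (?\<phi> (c * u + (-s)* v) * (?\<phi> ((u - c*(c * u + (-s)* v))/s) *
       f (u, (c * u - (c * u + (-s)* v))/s))) \<partial>lborel) \<partial>lborel)"
    using False by (intro nn_integral_cong nn_integral_real_affine) simp_all
  also have "\<dots> = (\<integral>\<^sup>+u. ennreal \<bar>-s\<bar> * (\<integral>\<^sup>+v. ennreal \<bar>1/s\<bar> * (?\<phi> u * (?\<phi> v * f (u, v))) \<partial>lborel) \<partial>lborel)"
  proof -
    have 1: "(c * u - (c * u + (-s)* v))/s = v" for u v using False by simp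
    have "u - c*(c * u + (-s)* v) = s * (s * u + c * v)" for u v
    proof -
      have "u - c*(c * u + (-s)* v) = u - c\<^sup>2 * u + s*(c * v)" by (simp add: algebra_simps power2_eq_square)
      also have "c\<^sup>2 = 1 - s\<^sup>2" using cs by simp
      finally show ?thesis by (simp add: algebra_simps power2_eq_square)
    qed
    then have 2: "(u - c*(c * u + (-s)* v))/s = s * u + c * v" for u v using False by simp
    have 3: "?\<phi> (c * u + (-s)* v) * (?\<phi> (s * u + c * v) * z) = ?\<phi> u * (?\<phi> v * z)" for u v z
      using std_normal_density_rot[OF cs, of u v] 
      by (simp add: mult.assoc[symmetric] ennreal_mult[symmetric])
    show ?thesis unfolding 1 unfolding 2 unfolding 3 ..
  qed
  also have "\<dots> = (\<integral>\<^sup>+u. ?\<phi> u * (\<integral>\<^sup>+v. ?\<phi> v * f (u, v) \<partial>lborel) \<partial>lborel)"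
  proof -
    have 1: "ennreal \<bar>-s\<bar> * (ennreal \<bar>1/s\<bar> * z) = z" for z
      using False by (simp add: mult.assoc[symmetric] ennreal_mult[symmetric])
    show ?thesis by (simp add: nn_integral_cmult 1[simplified])
  qed
  also have "\<dots> = (\<integral>\<^sup>+x. \<integral>\<^sup>+y. f (x, y) \<partial>N \<partial>N)"
    by (subst nn_integral_N, simp, subst nn_integral_N, simp, simp)
  finally show ?thesis .
qed

definition rotate_pair :: "real \<Rightarrow> real \<Rightarrow> 'i set \<Rightarrow> ('i \<Rightarrow> real) \<times> ('i \<Rightarrow> real) \<Rightarrow> ('i \<Rightarrow> real) \<times> ('i \<Rightarrow> real)" where
  "rotate_pair c s I = (\<lambda>(x, y). (\<lambda>i\<in>I. c * x i + s * y i, \<lambda>i\<in>I. c * y i - s * x i))"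

lemma measurable_rotate_pair [measurable]:
  "rotate_pair c s I \<in> std_gaussian I \<Otimes>\<^sub>M std_gaussian I \<rightarrow>\<^sub>M std_gaussian I \<Otimes>\<^sub>M std_gaussian I"
  unfolding rotate_pair_def std_gaussian_def split_beta by measurable

text \<open>On products of boxes the indicator of the rotated point is a product over the coordinates, so that the
claim splits into two-dimensional rotations. Such products generate the \<open>\<sigma>\<close>-algebra.\<close>

lemma std_gaussian_rotate:
  assumes cs: "c\<^sup>2 + s\<^sup>2 = (1::real)" and [simp]: "finite I"
  shows "distr (std_gaussian I \<Otimes>\<^sub>M std_gaussian I) (std_gaussian I \<Otimes>\<^sub>M std_gaussian I) (rotate_pair c s I)
       = std_gaussian I \<Otimes>\<^sub>M std_gaussian I"
proof -
  let ?G = "std_gaussian I"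
  interpret G: prob_space ?G by (rule prob_space_std_gaussian)
  interpret GG: pair_prob_space ?G ?G ..
  define box where "box = {Pi\<^sub>E I X |X. \<forall>i. X i \<in> sets N}"
  define E where "E = {a \<times> b | a b. a \<in> box \<and> b \<in> box}"
  have space_G: "space ?G = Pi\<^sub>E I (\<lambda>_. UNIV)" by (simp add: std_gaussian_def space_PiM)
  have box_eq: "box = {Pi\<^sub>E I X |X. (\<forall>i. X i \<in> sets N) \<and> finite {i. X i \<noteq> space N}}"
  proof -
    have "\<exists>Y. Pi\<^sub>E I X = Pi\<^sub>E I Y \<and> (\<forall>i. Y i \<in> sets N) \<and> finite {i. Y i \<noteq> space N}" if "\<forall>i. X i \<in> sets N" for X
      using that by (intro exI[of _ "\<lambda>i. if i \<in> I then X i else UNIV"]) (auto intro!: PiE_cong finite_subset[of _ I])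
    then show ?thesis unfolding box_def by blast
  qed
  have sets_G: "sets ?G = sigma_sets (space ?G) box"
    unfolding box_eq space_G by (simp add: std_gaussian_def sets_PiM_finite)
  have box_G: "box \<subseteq> sets ?G" unfolding sets_G by auto
  have UN: "space ?G \<in> box" unfolding box_def space_G by (auto intro!: exI[of _ "\<lambda>_. UNIV"])
  have sub: "box \<subseteq> Pow (space ?G)" using box_G sets.sets_into_space by auto
  have sets_GG: "sets (?G \<Otimes>\<^sub>M ?G) = sigma_sets (space ?G \<times> space ?G) E"
    unfolding E_def
    by (subst sets_pair_eq[OF sub sets_G _ _ _ sub sets_G, of "{space ?G}" "{space ?G}"])
       (use UN sub in \<open>auto intro!: sets_measure_of\<close>)
  show ?thesis
  proof (rule measure_eqI_generator_eq[symmetric, where E = E and \<Omega> = "space ?G \<times> space ?G" and A = "\<lambda>_::nat. space ?G \<times> space ?G"])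
    show "Int_stable E"
    proof (rule Int_stableI)
      fix u v assume "u \<in> E" "v \<in> E"
      then obtain X Y X' Y' where *: "u = Pi\<^sub>E I X \<times> Pi\<^sub>E I Y" "v = Pi\<^sub>E I X' \<times> Pi\<^sub>E I Y'"
         "\<forall>i. X i \<in> sets N" "\<forall>i. Y i \<in> sets N" "\<forall>i. X' i \<in> sets N" "\<forall>i. Y' i \<in> sets N"
        unfolding E_def box_def by auto
      have "u \<inter> v = Pi\<^sub>E I (\<lambda>i. X i \<inter> X' i) \<times> Pi\<^sub>E I (\<lambda>i. Y i \<inter> Y' i)"
        unfolding * by auto
      moreover have "Pi\<^sub>E I (\<lambda>i. X i \<inter> X' i) \<in> box" "Pi\<^sub>E I (\<lambda>i. Y i \<inter> Y' i) \<in> box"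
        unfolding box_def using * by (blast intro: sets.Int)+
      ultimately show "u \<inter> v \<in> E" unfolding E_def by auto
    qed
    show "E \<subseteq> Pow (space ?G \<times> space ?G)" unfolding E_def using sub by auto
    show "range (\<lambda>_::nat. space ?G \<times> space ?G) \<subseteq> E" using UN by (auto simp: E_def)
    show "emeasure (?G \<Otimes>\<^sub>M ?G) (space ?G \<times> space ?G) \<noteq> \<infinity>" for i :: nat
      using GG.emeasure_space_1 by (simp add: space_pair_measure)
  next
    fix u assume "u \<in> E"
    then obtain A B where u: "u = Pi\<^sub>E I A \<times> Pi\<^sub>E I B" and AB: "\<And>i. A i \<in> sets N" "\<And>i. B i \<in> sets N"
      unfolding E_def box_def by auto
    then have [measurable]: "\<And>i. A i \<in> sets borel" "\<And>i. B i \<in> sets borel" by auto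
    have uG[measurable]: "u \<in> sets (?G \<Otimes>\<^sub>M ?G)" using \<open>u \<in> E\<close> by (auto simp: sets_GG)
    have boxes: "Pi\<^sub>E I A \<in> sets ?G" "Pi\<^sub>E I B \<in> sets ?G"
      using box_G AB unfolding box_def by blast+
    let ?g = "\<lambda>i x y. indicator (A i) (c * x + s * y) * indicator (B i) (c * y - s * x) :: ennreal"
    have ind: "indicator u (rotate_pair c s I (x, y)) = (\<Prod>i\<in>I. ?g i (x i) (y i))" for x y
    proof (cases "\<forall>i\<in>I. c * x i + s * y i \<in> A i \<and> c * y i - s * x i \<in> B i")
      case True
      then show ?thesis by (auto simp: u rotate_pair_def indicator_def)
    next
      case False
      then obtain i where "i \<in> I" "?g i (x i) (y i) = 0" by (auto simp: indicator_def)
      then have "(\<Prod>i\<in>I. ?g i (x i) (y i)) = 0" by (intro prod_zero) (auto intro!: bexI[of _ i])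
      moreover have "rotate_pair c s I (x, y) \<notin> u" using False by (auto simp: u rotate_pair_def PiE_def Pi_def)
      ultimately show ?thesis by simp
    qed
    have "emeasure (distr (?G \<Otimes>\<^sub>M ?G) (?G \<Otimes>\<^sub>M ?G) (rotate_pair c s I)) u
        = (\<integral>\<^sup>+z. indicator u z \<partial>distr (?G \<Otimes>\<^sub>M ?G) (?G \<Otimes>\<^sub>M ?G) (rotate_pair c s I))"
      by simp
    also have "\<dots> = (\<integral>\<^sup>+z. indicator u (rotate_pair c s I z) \<partial>(?G \<Otimes>\<^sub>M ?G))"
      by (subst nn_integral_distr) simp_all
    also have "\<dots> = (\<integral>\<^sup>+x. \<integral>\<^sup>+y. indicator u (rotate_pair c s I (x, y)) \<partial>?G \<partial>?G)"
      by (subst G.nn_integral_fst[symmetric]) simp_all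
    also have "\<dots> = (\<integral>\<^sup>+x. \<integral>\<^sup>+y. (\<Prod>i\<in>I. ?g i (x i) (y i)) \<partial>?G \<partial>?G)"
      unfolding ind ..
    also have "\<dots> = (\<integral>\<^sup>+x. (\<Prod>i\<in>I. \<integral>\<^sup>+y. ?g i (x i) y \<partial>N) \<partial>?G)"
      unfolding std_gaussian_def
      by (intro nn_integral_cong PN.product_nn_integral_prod) simp_all
    also have "\<dots> = (\<Prod>i\<in>I. \<integral>\<^sup>+x. \<integral>\<^sup>+y. ?g i x y \<partial>N \<partial>N)"
      unfolding std_gaussian_def
      by (intro PN.product_nn_integral_prod[where f = "\<lambda>i x. \<integral>\<^sup>+y. ?g i x y \<partial>N"]) simp_all
    also have "\<dots> = (\<Prod>i\<in>I. \<integral>\<^sup>+x. \<integral>\<^sup>+y. indicator (A i \<times> B i) (c * x + s * y, c * y - s * x) \<partial>N \<partial>N)"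
      by (simp add: indicator_times)
    also have "\<dots> = (\<Prod>i\<in>I. \<integral>\<^sup>+x. \<integral>\<^sup>+y. indicator (A i \<times> B i) (x, y) \<partial>N \<partial>N)"
      by (subst gaussian_pair_rotate[OF cs, of "indicator _"]) simp_all
    also have "\<dots> = (\<Prod>i\<in>I. emeasure N (A i) * emeasure N (B i))"
      by (simp add: indicator_times nn_integral_cmult nn_integral_multc)
    also have "\<dots> = emeasure ?G (Pi\<^sub>E I A) * emeasure ?G (Pi\<^sub>E I B)"
      by (simp add: std_gaussian_def PN.emeasure_PiM AB prod.distrib)
    also have "\<dots> = emeasure (?G \<Otimes>\<^sub>M ?G) u"
      unfolding u by (subst G.emeasure_pair_measure_Times) (use boxes in auto)
    finally show "emeasure (?G \<Otimes>\<^sub>M ?G) u = emeasure (distr (?G \<Otimes>\<^sub>M ?G) (?G \<Otimes>\<^sub>M ?G) (rotate_pair c s I)) u" ..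
  qed (use sets_GG UN in \<open>auto\<close>)
qed

lemma polar_decomposition:
  fixes p a :: real
  obtains \<rho> c s where "0 \<le> \<rho>" "c\<^sup>2 + s\<^sup>2 = 1" "p = \<rho> * c" "a = \<rho> * s" "\<rho>\<^sup>2 = p\<^sup>2 + a\<^sup>2"
proof (cases "p\<^sup>2 + a\<^sup>2 = 0")
  case True
  then have "p = 0" "a = 0" by (auto simp: sum_power2_eq_zero_iff)
  then show ?thesis using that[of 0 1 0] by simp
next
  case False
  then have pos: "0 < p\<^sup>2 + a\<^sup>2" by (metis less_eq_real_def sum_power2_ge_zero)
  let ?r = "sqrt (p\<^sup>2 + a\<^sup>2)"
  have r: "?r > 0" "?r\<^sup>2 = p\<^sup>2 + a\<^sup>2" using pos by simp_all
  have "(p / ?r)\<^sup>2 + (a / ?r)\<^sup>2 = 1"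
    unfolding power_divide add_divide_distrib[symmetric] r(2) using False by (rule divide_self)
  then show ?thesis using that[of ?r "p / ?r" "a / ?r"] r by simp
qed

text \<open>Two linear forms in a Gaussian vector are jointly distributed like \<open>(p \<xi>, q \<xi> + r \<eta>)\<close> with independent
standard normal \<open>\<xi>\<close> and \<open>\<eta>\<close>, where \<open>p, q, r\<close> form the Cholesky factor of the Gram matrix. Each new
coordinate is absorbed by two plane rotations: the first makes the first form depend on one variable
only, the second merges the two remaining variables of the second form. Asserting the existence of \<open>p, q, r\<close>
covers degenerate Gram matrices.\<close>

lemma std_gaussian_pair_law:
  fixes a b :: "'i \<Rightarrow> real"
  assumes "finite I"
  shows "\<exists>p q r. 0 \<le> p \<and> p\<^sup>2 = (\<Sum>i\<in>I. (a i)\<^sup>2) \<and> p * q = (\<Sum>i\<in>I. a i * b i) \<and> q\<^sup>2 + r\<^sup>2 = (\<Sum>i\<in>I. (b i)\<^sup>2)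
    \<and> (\<forall>f \<in> borel_measurable (borel \<Otimes>\<^sub>M borel).
        (\<integral>\<^sup>+w. f (\<Sum>i\<in>I. a i * w i, \<Sum>i\<in>I. b i * w i) \<partial>std_gaussian I)
         = (\<integral>\<^sup>+x. \<integral>\<^sup>+y. f (p * x, q * x + r * y) \<partial>N \<partial>N))"
  using assms
proof (induction I rule: finite_induct)
  case empty
  show ?case
    using prob_space.emeasure_space_1[OF prob_space_std_gaussian, of "{} :: 'i set"]
    by (intro exI[of _ 0]) (auto simp: std_gaussian_def)
next
  case (insert j I)
  then obtain p q r where p: "0 \<le> p" "p\<^sup>2 = (\<Sum>i\<in>I. (a i)\<^sup>2)" and pq: "p * q = (\<Sum>i\<in>I. a i * b i)"
    and qr: "q\<^sup>2 + r\<^sup>2 = (\<Sum>i\<in>I. (b i)\<^sup>2)"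
    and IH: "\<And>f. f \<in> borel_measurable (borel \<Otimes>\<^sub>M borel) \<Longrightarrow>
        (\<integral>\<^sup>+w. f (\<Sum>i\<in>I. a i * w i, \<Sum>i\<in>I. b i * w i) \<partial>std_gaussian I)
         = (\<integral>\<^sup>+x. \<integral>\<^sup>+y. f (p * x, q * x + r * y) \<partial>N \<partial>N)" by blast
  obtain p' c s where p': "0 \<le> p'" "c\<^sup>2 + s\<^sup>2 = 1" "p = p' * c" "a j = p' * s" "p'\<^sup>2 = p\<^sup>2 + (a j)\<^sup>2"
    by (rule polar_decomposition)
  define q' where "q' = q * c + b j * s"
  define d where "d = b j * c - q * s"
  obtain r' c' s' where r': "0 \<le> r'" "c'\<^sup>2 + s'\<^sup>2 = 1" "d = r' * c'" "r = r' * s'" "r'\<^sup>2 = d\<^sup>2 + r\<^sup>2"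
    by (rule polar_decomposition)
  have qd: "q'\<^sup>2 + d\<^sup>2 = q\<^sup>2 + (b j)\<^sup>2"
  proof -
    have "q'\<^sup>2 + d\<^sup>2 = (c\<^sup>2 + s\<^sup>2) * (q\<^sup>2 + (b j)\<^sup>2)"
      unfolding q'_def d_def by (simp add: algebra_simps power2_eq_square)
    then show ?thesis using p' by simp
  qed
  have pq': "p' * q' = p * q + a j * b j"
    unfolding q'_def p'(3,4) by (simp add: algebra_simps)
  show ?case
  proof (rule exI[of _ p'], rule exI[of _ q'], rule exI[of _ r'], intro conjI ballI)
    show "0 \<le> p'" by fact
    show "p'\<^sup>2 = (\<Sum>i\<in>insert j I. (a i)\<^sup>2)" using insert p p' by simp
    show "p' * q' = (\<Sum>i\<in>insert j I. a i * b i)" using insert pq pq' by simp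
    show "q'\<^sup>2 + r'\<^sup>2 = (\<Sum>i\<in>insert j I. (b i)\<^sup>2)" using insert qr qd r' by simp
  next
    fix f :: "real \<times> real \<Rightarrow> ennreal" assume f[measurable]: "f \<in> borel_measurable (borel \<Otimes>\<^sub>M borel)"
    have upd: "(\<Sum>i\<in>insert j I. h i * (w(j := z)) i) = (\<Sum>i\<in>I. h i * w i) + h j * z" for h w :: "'i \<Rightarrow> real" and z
    proof -
      have "(\<Sum>i\<in>I. h i * (w(j := z)) i) = (\<Sum>i\<in>I. h i * w i)" using insert by (intro sum.cong) auto
      then show ?thesis using insert by simp
    qed
    have "(\<integral>\<^sup>+w. f (\<Sum>i\<in>insert j I. a i * w i, \<Sum>i\<in>insert j I. b i * w i) \<partial>std_gaussian (insert j I))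
      = (\<integral>\<^sup>+z. \<integral>\<^sup>+w. f (\<Sum>i\<in>insert j I. a i * (w(j := z)) i, \<Sum>i\<in>insert j I. b i * (w(j := z)) i) \<partial>std_gaussian I \<partial>N)"
      unfolding std_gaussian_def using insert
      by (subst PN.product_nn_integral_insert_rev) simp_all
    also have "\<dots> = (\<integral>\<^sup>+z. \<integral>\<^sup>+w. (\<lambda>u. f (fst u + a j * z, snd u + b j * z)) (\<Sum>i\<in>I. a i * w i, \<Sum>i\<in>I. b i * w i) \<partial>std_gaussian I \<partial>N)"
      unfolding upd by simp
    also have "\<dots> = (\<integral>\<^sup>+z. \<integral>\<^sup>+x. \<integral>\<^sup>+y. f (p * x + a j * z, q * x + r * y + b j * z) \<partial>N \<partial>N \<partial>N)"
      by (subst IH) simp_all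
    also have "\<dots> = (\<integral>\<^sup>+x. \<integral>\<^sup>+z. \<integral>\<^sup>+y. f (p * x + a j * z, q * x + r * y + b j * z) \<partial>N \<partial>N \<partial>N)"
      by (rule NN.Fubini') simp
    also have "\<dots> = (\<integral>\<^sup>+x. \<integral>\<^sup>+z. (\<lambda>u. \<integral>\<^sup>+y. f (p' * fst u, q' * fst u + d * snd u + r * y) \<partial>N) (c * x + s * z, c * z - s * x) \<partial>N \<partial>N)"
    proof -
      have 1: "p * x + a j * z = p' * (c * x + s * z)" for x z
        unfolding p'(3,4) by (simp add: algebra_simps)
      have 2: "q * x + r * y + b j * z = q' * (c * x + s * z) + d * (c * z - s * x) + r * y" for x y z
      proof -
        have "q' * (c * x + s * z) + d * (c * z - s * x) = (c\<^sup>2 + s\<^sup>2) * (q * x + b j * z)"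
          unfolding q'_def d_def by (simp add: algebra_simps power2_eq_square)
        then show ?thesis using p'(2) by simp
      qed
      show ?thesis unfolding 1 2 by simp
    qed
    also have "\<dots> = (\<integral>\<^sup>+x. \<integral>\<^sup>+z. \<integral>\<^sup>+y. f (p' * x, q' * x + d * z + r * y) \<partial>N \<partial>N \<partial>N)"
      by (subst gaussian_pair_rotate[OF p'(2)]) simp_all
    also have "\<dots> = (\<integral>\<^sup>+x. \<integral>\<^sup>+z. \<integral>\<^sup>+y. f (p' * x, q' * x + r' * (c' * z + s' * y)) \<partial>N \<partial>N \<partial>N)"
      unfolding r'(3,4) by (simp add: algebra_simps)
    also have "\<dots> = (\<integral>\<^sup>+x. \<integral>\<^sup>+z. \<integral>\<^sup>+y. f (p' * x, q' * x + r' * z) \<partial>N \<partial>N \<partial>N)"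
    proof (rule nn_integral_cong)
      fix x
      show "(\<integral>\<^sup>+z. \<integral>\<^sup>+y. f (p' * x, q' * x + r' * (c' * z + s' * y)) \<partial>N \<partial>N) = (\<integral>\<^sup>+z. \<integral>\<^sup>+y. f (p' * x, q' * x + r' * z) \<partial>N \<partial>N)"
        using gaussian_pair_rotate[OF r'(2), of "\<lambda>u. f (p' * x, q' * x + r' * fst u)"] by simp
    qed
    also have "\<dots> = (\<integral>\<^sup>+x. \<integral>\<^sup>+z. f (p' * x, q' * x + r' * z) \<partial>N \<partial>N)"
      by simp
    finally show "(\<integral>\<^sup>+w. f (\<Sum>i\<in>insert j I. a i * w i, \<Sum>i\<in>insert j I. b i * w i) \<partial>std_gaussian (insert j I))
      = (\<integral>\<^sup>+x. \<integral>\<^sup>+y. f (p' * x, q' * x + r' * y) \<partial>N \<partial>N)" .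
  qed
qed

lemma std_gaussian_pair_distr:
  fixes a b :: "'i \<Rightarrow> real"
  assumes I: "finite I"
  obtains p q r where "0 \<le> p" "p\<^sup>2 = (\<Sum>i\<in>I. (a i)\<^sup>2)" "p * q = (\<Sum>i\<in>I. a i * b i)" "q\<^sup>2 + r\<^sup>2 = (\<Sum>i\<in>I. (b i)\<^sup>2)"
    "distr (std_gaussian I) (borel \<Otimes>\<^sub>M borel) (\<lambda>w. (\<Sum>i\<in>I. a i * w i, \<Sum>i\<in>I. b i * w i))
     = distr (N \<Otimes>\<^sub>M N) (borel \<Otimes>\<^sub>M borel) (\<lambda>(x, y). (p * x, q * x + r * y))"
proof -
  from std_gaussian_pair_law[OF I, of a b] obtain p q r where
    *: "0 \<le> p" "p\<^sup>2 = (\<Sum>i\<in>I. (a i)\<^sup>2)" "p * q = (\<Sum>i\<in>I. a i * b i)" "q\<^sup>2 + r\<^sup>2 = (\<Sum>i\<in>I. (b i)\<^sup>2)"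
    and law: "\<And>f. f \<in> borel_measurable (borel \<Otimes>\<^sub>M borel) \<Longrightarrow>
        (\<integral>\<^sup>+w. f (\<Sum>i\<in>I. a i * w i, \<Sum>i\<in>I. b i * w i) \<partial>std_gaussian I)
         = (\<integral>\<^sup>+x. \<integral>\<^sup>+y. f (p * x, q * x + r * y) \<partial>N \<partial>N)" by blast
  have [measurable]: "(\<lambda>w. \<Sum>i\<in>I. h i * w i) \<in> borel_measurable (std_gaussian I)" for h
    unfolding std_gaussian_def by measurable
  have "distr (std_gaussian I) (borel \<Otimes>\<^sub>M borel) (\<lambda>w. (\<Sum>i\<in>I. a i * w i, \<Sum>i\<in>I. b i * w i))
     = distr (N \<Otimes>\<^sub>M N) (borel \<Otimes>\<^sub>M borel) (\<lambda>(x, y). (p * x, q * x + r * y))" (is "?L = ?R")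
  proof (rule measure_eqI)
    fix A assume "A \<in> sets ?L"
    then have [measurable]: "A \<in> sets (borel \<Otimes>\<^sub>M borel)" by simp
    have "emeasure ?L A = (\<integral>\<^sup>+z. indicator A z \<partial>?L)" by simp
    also have "\<dots> = (\<integral>\<^sup>+w. indicator A (\<Sum>i\<in>I. a i * w i, \<Sum>i\<in>I. b i * w i) \<partial>std_gaussian I)"
      by (subst nn_integral_distr) simp_all
    also have "\<dots> = (\<integral>\<^sup>+x. \<integral>\<^sup>+y. indicator A (p * x, q * x + r * y) \<partial>N \<partial>N)"
      by (rule law) simp
    also have "\<dots> = (\<integral>\<^sup>+z. indicator A z \<partial>?R)"
      by (subst nn_integral_distr, simp_all add: split_beta, subst N.nn_integral_fst[symmetric]) simp_all
    also have "\<dots> = emeasure ?R A" by simp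
    finally show "emeasure ?L A = emeasure ?R A" .
  qed simp
  then show thesis using * that by blast
qed

lemma std_gaussian_linear_distr:
  fixes a :: "'i \<Rightarrow> real"
  assumes I: "finite I"
  shows "distr (std_gaussian I) borel (\<lambda>w. \<Sum>i\<in>I. a i * w i) = distr N borel (\<lambda>x. sqrt (\<Sum>i\<in>I. (a i)\<^sup>2) * x)"
proof -
  have [measurable]: "(\<lambda>w. \<Sum>i\<in>I. h i * w i) \<in> borel_measurable (std_gaussian I)" for h
    unfolding std_gaussian_def by measurable
  obtain p q r where p: "0 \<le> p" "p\<^sup>2 = (\<Sum>i\<in>I. (a i)\<^sup>2)" and
    eq: "distr (std_gaussian I) (borel \<Otimes>\<^sub>M borel) (\<lambda>w. (\<Sum>i\<in>I. a i * w i, \<Sum>i\<in>I. a i * w i))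
     = distr (N \<Otimes>\<^sub>M N) (borel \<Otimes>\<^sub>M borel) (\<lambda>(x, y). (p * x, q * x + r * y))"
    by (rule std_gaussian_pair_distr[OF I])
  have "distr (std_gaussian I) borel (\<lambda>w. \<Sum>i\<in>I. a i * w i)
      = distr (distr (std_gaussian I) (borel \<Otimes>\<^sub>M borel) (\<lambda>w. (\<Sum>i\<in>I. a i * w i, \<Sum>i\<in>I. a i * w i))) borel fst"
    by (subst distr_distr) (simp_all add: comp_def)
  also have "\<dots> = distr (N \<Otimes>\<^sub>M N) borel (\<lambda>z. p * fst z)"
    unfolding eq by (subst distr_distr) (simp_all add: comp_def split_beta)
  also have "\<dots> = distr (distr (N \<Otimes>\<^sub>M N) N fst) borel (\<lambda>x. p * x)"
    by (subst distr_distr) (simp_all add: comp_def)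
  also have "distr (N \<Otimes>\<^sub>M N) N fst = N"
    using N.distr_pair_fst[of N] by simp
  also have "p = sqrt (\<Sum>i\<in>I. (a i)\<^sup>2)" using p by (metis real_sqrt_unique)
  finally show ?thesis .
qed

lemma measurable_linear_std_gaussian [measurable]:
  "(\<lambda>w. \<Sum>i\<in>I. a i * w i) \<in> borel_measurable (std_gaussian I)"
  unfolding std_gaussian_def by measurable

lemma nn_integral_std_gaussian_linear:
  assumes I: "finite I" and [measurable]: "g \<in> borel_measurable borel"
  shows "(\<integral>\<^sup>+w. g (\<Sum>i\<in>I. a i * w i) \<partial>std_gaussian I) = (\<integral>\<^sup>+x. g (sqrt (\<Sum>i\<in>I. (a i)\<^sup>2) * x) \<partial>N)"
proof -
  have "(\<integral>\<^sup>+w. g (\<Sum>i\<in>I. a i * w i) \<partial>std_gaussian I)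
      = (\<integral>\<^sup>+z. g z \<partial>distr (std_gaussian I) borel (\<lambda>w. \<Sum>i\<in>I. a i * w i))"
    by (subst nn_integral_distr) simp_all
  also have "\<dots> = (\<integral>\<^sup>+x. g (sqrt (\<Sum>i\<in>I. (a i)\<^sup>2) * x) \<partial>N)"
    unfolding std_gaussian_linear_distr[OF I] by (subst nn_integral_distr) simp_all
  finally show ?thesis .
qed

lemma integrable_std_gaussian_linear:
  fixes g :: "real \<Rightarrow> real"
  assumes I: "finite I" and [measurable]: "g \<in> borel_measurable borel"
  shows "integrable (std_gaussian I) (\<lambda>w. g (\<Sum>i\<in>I. a i * w i))
     \<longleftrightarrow> integrable N (\<lambda>x. g (sqrt (\<Sum>i\<in>I. (a i)\<^sup>2) * x))"
proof -
  have "integrable (std_gaussian I) (\<lambda>w. g (\<Sum>i\<in>I. a i * w i))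
     \<longleftrightarrow> integrable (distr (std_gaussian I) borel (\<lambda>w. \<Sum>i\<in>I. a i * w i)) g"
    by (subst integrable_distr_eq) simp_all
  also have "\<dots> \<longleftrightarrow> integrable N (\<lambda>x. g (sqrt (\<Sum>i\<in>I. (a i)\<^sup>2) * x))"
    unfolding std_gaussian_linear_distr[OF I] by (subst integrable_distr_eq) simp_all
  finally show ?thesis .
qed

lemma integral_std_gaussian_linear:
  fixes g :: "real \<Rightarrow> real"
  assumes I: "finite I" and [measurable]: "g \<in> borel_measurable borel"
  shows "(\<integral>w. g (\<Sum>i\<in>I. a i * w i) \<partial>std_gaussian I) = (\<integral>x. g (sqrt (\<Sum>i\<in>I. (a i)\<^sup>2) * x) \<partial>N)"
proof -
  have "(\<integral>w. g (\<Sum>i\<in>I. a i * w i) \<partial>std_gaussian I)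
      = (\<integral>z. g z \<partial>distr (std_gaussian I) borel (\<lambda>w. \<Sum>i\<in>I. a i * w i))"
    by (subst integral_distr) simp_all
  also have "\<dots> = (\<integral>x. g (sqrt (\<Sum>i\<in>I. (a i)\<^sup>2) * x) \<partial>N)"
    unfolding std_gaussian_linear_distr[OF I] by (subst integral_distr) simp_all
  finally show ?thesis .
qed

section \<open>Dimension-free concentration of Lipschitz features\<close>

lemma gaussian_exp_square:
  assumes "c \<le> 3/8"
  shows "(\<integral>\<^sup>+x. ennreal (exp (c * x\<^sup>2)) \<partial>N) \<le> 2"
proof -
  have "(\<integral>\<^sup>+x. ennreal (exp (c * x\<^sup>2)) \<partial>N) \<le> (\<integral>\<^sup>+x. ennreal (exp (3/8 * x\<^sup>2)) \<partial>N)"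
    by (intro nn_integral_mono ennreal_leI, subst exp_le_cancel_iff, rule mult_right_mono[OF assms]) simp
  also have "\<dots> = (\<integral>\<^sup>+x. ennreal (2 * normal_density 0 2 x) \<partial>lborel)"
  proof (subst nn_integral_N, simp, intro nn_integral_cong)
    fix x :: real
    have "exp (- x\<^sup>2 / 2) * exp (3/8 * x\<^sup>2) = exp (- x\<^sup>2 / 8)"
      by (simp add: exp_add[symmetric] field_simps)
    moreover have "sqrt (2 * pi * 2\<^sup>2) = 2 * sqrt (2 * pi)"
      by (simp only: real_sqrt_mult[of "2 * pi" "2\<^sup>2"] real_sqrt_abs)
    ultimately show "ennreal (std_normal_density x) * ennreal (exp (3/8 * x\<^sup>2)) = ennreal (2 * normal_density 0 2 x)"
      by (simp add: normal_density_def std_normal_density_def ennreal_mult[symmetric])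
  qed
  also have "\<dots> = ennreal (\<integral>x. 2 * normal_density 0 2 x \<partial>lborel)"
    by (intro nn_integral_eq_integral) simp_all
  also have "\<dots> = 2" by simp
  finally show ?thesis .
qed

text \<open>The tangent inequality of the convex function \<open>exp (\<eta> t\<^sup>2)\<close>; integrating it gives Jensen's inequality
without a separate discussion of integrability.\<close>

lemma exp_square_tangent:
  fixes \<eta> t \<mu> :: real
  assumes "0 \<le> \<eta>"
  shows "exp (\<eta> * \<mu>\<^sup>2) * (1 + 2 * \<eta> * \<mu> * (t - \<mu>)) \<le> exp (\<eta> * t\<^sup>2)"
proof -
  have "0 \<le> \<eta> * (t - \<mu>)\<^sup>2" using assms by simp
  then have "1 + 2 * \<eta> * \<mu> * (t - \<mu>) \<le> 1 + (\<eta> * t\<^sup>2 - \<eta> * \<mu>\<^sup>2)"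
    by (simp add: power2_eq_square algebra_simps)
  also have "\<dots> \<le> exp (\<eta> * t\<^sup>2 - \<eta> * \<mu>\<^sup>2)" by (rule exp_ge_add_one_self)
  finally have "exp (\<eta> * \<mu>\<^sup>2) * (1 + 2 * \<eta> * \<mu> * (t - \<mu>)) \<le> exp (\<eta> * \<mu>\<^sup>2) * exp (\<eta> * t\<^sup>2 - \<eta> * \<mu>\<^sup>2)" by simp
  then show ?thesis by (simp add: exp_add[symmetric])
qed

definition ip :: "'i set \<Rightarrow> ('i \<Rightarrow> real) \<Rightarrow> ('i \<Rightarrow> real) \<Rightarrow> real" where
  "ip I a w = (\<Sum>i\<in>I. a i * w i)"

definition feature :: "(real \<Rightarrow> real) \<Rightarrow> 'i set \<Rightarrow> 'a set \<Rightarrow> ('a \<Rightarrow> 'i \<Rightarrow> real) \<Rightarrow> ('a \<Rightarrow> real) \<Rightarrow> ('i \<Rightarrow> real) \<Rightarrow> real" where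
  "feature \<sigma> I A x u w = (\<Sum>\<alpha>\<in>A. u \<alpha> * \<sigma> (ip I (x \<alpha>) w))"

lemma measurable_ip [measurable]: "ip I a \<in> borel_measurable (std_gaussian I)"
  unfolding ip_def by measurable

lemma measurable_feature [measurable]:
  assumes [measurable]: "\<sigma> \<in> borel_measurable borel"
  shows "feature \<sigma> I A x u \<in> borel_measurable (std_gaussian I)"
  unfolding feature_def by measurable

text \<open>The points \<open>sin \<theta> p + cos \<theta> q\<close> lead from \<open>q\<close> to \<open>p\<close>, and the derivative of the feature along this path at \<open>\<theta>\<close> is,
up to sign, \<open>h\<close> evaluated at the rotated pair. Jensen's inequality for the uniform distribution on
\<open>{0..pi/2}\<close> moves the exponential inside the integral over \<open>\<theta>\<close>.\<close>

lemma exp_interpolation: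
  fixes \<sigma> \<sigma>' :: "real \<Rightarrow> real" and x :: "'a \<Rightarrow> 'i \<Rightarrow> real" and u :: "'a \<Rightarrow> real"
  assumes der: "\<And>t. (\<sigma> has_real_derivative \<sigma>' t) (at t)"
    and cont: "continuous_on UNIV \<sigma>'" and \<eta>: "0 \<le> \<eta>" and [simp]: "finite I" "finite A"
  defines "h \<equiv> \<lambda>p q. \<Sum>\<alpha>\<in>A. u \<alpha> * (\<sigma>' (ip I (x \<alpha>) p) * ip I (x \<alpha>) q)"
  shows "ennreal (exp (\<eta> * (feature \<sigma> I A x u p - feature \<sigma> I A x u q)\<^sup>2))
    \<le> (\<integral>\<^sup>+\<theta>. ennreal (indicator {0..pi/2} \<theta> * (2/pi * exp (\<eta> * (pi/2)\<^sup>2 * 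
          (case rotate_pair (sin \<theta>) (cos \<theta>) I (p, q) of (p', q') \<Rightarrow> h p' q')\<^sup>2))) \<partial>lborel)"
proof -
  define P where "P \<theta> i = sin \<theta> * p i + cos \<theta> * q i" for \<theta> i
  define Q where "Q \<theta> i = sin \<theta> * q i - cos \<theta> * p i" for \<theta> i
  define D where "D \<theta> = (\<Sum>\<alpha>\<in>A. u \<alpha> * (\<sigma>' (ip I (x \<alpha>) (P \<theta>)) * ip I (x \<alpha>) (\<lambda>i. - Q \<theta> i)))" for \<theta>
  let ?F = "feature \<sigma> I A x u"
  have D_rot: "(case rotate_pair (sin \<theta>) (cos \<theta>) I (p, q) of (p', q') \<Rightarrow> h p' q')\<^sup>2 = (D \<theta>)\<^sup>2" for \<theta>
  proof -
    have "(case rotate_pair (sin \<theta>) (cos \<theta>) I (p, q) of (p', q') \<Rightarrow> h p' q') = - D \<theta>"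
    proof -
      have "ip I a (\<lambda>i\<in>I. b i) = ip I a b" for a b :: "'i \<Rightarrow> real"
        unfolding ip_def by (intro sum.cong) auto
      moreover have "ip I a (\<lambda>i. - b i) = - ip I a b" for a b :: "'i \<Rightarrow> real"
        by (simp add: ip_def sum_negf)
      ultimately show ?thesis
        by (simp add: rotate_pair_def h_def D_def P_def[abs_def] Q_def[abs_def] sum_negf del: minus_diff_eq)
    qed
    then show ?thesis by simp
  qed
  have ip_P: "((\<lambda>\<theta>. ip I a (P \<theta>)) has_real_derivative ip I a (\<lambda>i. - Q \<theta> i)) (at \<theta>)" for a \<theta>
    unfolding ip_def P_def Q_def by (auto intro!: derivative_eq_intros simp: algebra_simps)
  have F_P: "((\<lambda>\<theta>. ?F (P \<theta>)) has_real_derivative D \<theta>) (at \<theta>)" for \<theta>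
    unfolding feature_def D_def
    by (intro DERIV_sum DERIV_cmult DERIV_chain2[OF der ip_P])
  have "(D has_integral (?F (P (pi/2)) - ?F (P 0))) {0..pi/2}"
    by (intro fundamental_theorem_of_calculus)
       (auto intro!: has_field_derivative_at_within[OF F_P] simp: has_real_derivative_iff_has_vector_derivative[symmetric])
  moreover have "P (pi/2) = p" "P 0 = q" by (auto simp: P_def)
  ultimately have int_D: "(D has_integral (?F p - ?F q)) {0..pi/2}" by simp
  have cont_ip: "continuous_on UNIV (\<lambda>\<theta>. ip I a (P \<theta>))" for a
    using ip_P by (meson DERIV_continuous_on has_field_derivative_at_within)
  have cont_D: "continuous_on UNIV D"
    unfolding D_def
    by (intro continuous_intros continuous_on_compose2[OF cont cont_ip])
       (auto simp: ip_def Q_def intro!: continuous_intros)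
  \<comment> \<open>The mean of \<open>D\<close> over \<open>{0..pi/2}\<close>, at which the tangent is taken.\<close>
  define \<mu> where "\<mu> = 2/pi * (?F p - ?F q)"
  define \<zeta> where "\<zeta> = \<eta> * (pi/2)\<^sup>2"
  define g where "g \<theta> = 2/pi * exp (\<zeta> * (D \<theta>)\<^sup>2)" for \<theta>
  have cont_g: "continuous_on UNIV g" unfolding g_def by (intro continuous_intros cont_D)
  have g_int: "(g has_integral integral {0..pi/2} g) {0..pi/2}"
    using cont_g by (intro integrable_integral integrable_continuous_interval continuous_on_subset[OF cont_g]) auto
  have low: "((\<lambda>\<theta>. (2/pi * exp (\<zeta> * \<mu>\<^sup>2)) * (1 + 2 * \<zeta> * \<mu> * (D \<theta> - \<mu>))) has_integral 
       (2/pi * exp (\<zeta> * \<mu>\<^sup>2)) * (pi/2 + 2 * \<zeta> * \<mu> * ((?F p - ?F q) - pi/2 * \<mu>))) {0..pi/2}"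
  proof -
    have c: "((\<lambda>_. z) has_integral (pi/2 * z)) {0..pi/2}" for z :: real
      using has_integral_const_real[of z 0 "pi/2"] by simp
    show ?thesis
      by (rule has_integral_mult_right, rule has_integral_add, use c[of 1] in simp,
          rule has_integral_mult_right, rule has_integral_diff[OF int_D c])
  qed
  have "exp (\<zeta> * \<mu>\<^sup>2) = (2/pi * exp (\<zeta> * \<mu>\<^sup>2)) * (pi/2 + 2 * \<zeta> * \<mu> * ((?F p - ?F q) - pi/2 * \<mu>))"
    unfolding \<mu>_def by (simp add: field_simps)
  also have "\<dots> \<le> integral {0..pi/2} g"
  proof (rule has_integral_le[OF low g_int])
    fix \<theta> 
    have "0 \<le> \<zeta>" unfolding \<zeta>_def using \<eta> by simp
    from exp_square_tangent[OF this, of \<mu> "D \<theta>"]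
    show "(2/pi * exp (\<zeta> * \<mu>\<^sup>2)) * (1 + 2 * \<zeta> * \<mu> * (D \<theta> - \<mu>)) \<le> g \<theta>"
      unfolding g_def by (simp add: mult.assoc divide_right_mono)
  qed
  finally have main: "exp (\<zeta> * \<mu>\<^sup>2) \<le> integral {0..pi/2} g" .
  have "\<zeta> * \<mu>\<^sup>2 = \<eta> * (?F p - ?F q)\<^sup>2"
  proof -
    have "\<zeta> * \<mu>\<^sup>2 = \<eta> * (pi/2 * \<mu>)\<^sup>2" unfolding \<zeta>_def by (simp only: power_mult_distrib mult.assoc)
    also have "pi/2 * \<mu> = ?F p - ?F q" unfolding \<mu>_def by simp
    finally show ?thesis .
  qed
  then have "ennreal (exp (\<eta> * (?F p - ?F q)\<^sup>2)) \<le> ennreal (integral {0..pi/2} g)"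
    using main by (simp add: ennreal_leI)
  also have "\<dots> = (\<integral>\<^sup>+\<theta>. ennreal (indicator {0..pi/2} \<theta> * g \<theta>) \<partial>lborel)"
  proof (rule nn_integral_has_integral_lborel[symmetric])
    have [measurable]: "g \<in> borel_measurable borel" using cont_g by (rule borel_measurable_continuous_onI)
    show "(\<lambda>\<theta>. indicator {0..pi/2} \<theta> * g \<theta>) \<in> borel_measurable borel" by measurable
    show "0 \<le> indicator {0..pi/2} \<theta> * g \<theta>" for \<theta> unfolding g_def by simp
    have "(\<lambda>\<theta>. indicator {0..pi/2} \<theta> * g \<theta>) = (\<lambda>\<theta>. if \<theta> \<in> {0..pi/2} then g \<theta> else 0)"
      by (auto simp: indicator_def)
    then show "((\<lambda>\<theta>. indicator {0..pi/2} \<theta> * g \<theta>) has_integral integral {0..pi/2} g) UNIV"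
      using g_int by (simp only: has_integral_restrict_UNIV)
  qed
  finally show ?thesis unfolding D_rot g_def \<zeta>_def .
qed

text \<open>The matrix with columns \<open>x \<alpha>\<close> has operator norm at most \<open>V\<close>.\<close>

definition op_bound :: "'i set \<Rightarrow> 'a set \<Rightarrow> ('a \<Rightarrow> 'i \<Rightarrow> real) \<Rightarrow> real \<Rightarrow> bool" where
  "op_bound I A x V \<longleftrightarrow> (\<forall>v. (\<Sum>i\<in>I. (\<Sum>\<alpha>\<in>A. v \<alpha> * x \<alpha> i)\<^sup>2) \<le> V\<^sup>2 * (\<Sum>\<alpha>\<in>A. (v \<alpha>)\<^sup>2))"

text \<open>After \<open>exp_interpolation\<close> the integrals over \<open>\<theta>\<close> and over the pair are exchanged, and for each \<open>\<theta>\<close> the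
rotated pair may be replaced by the original pair \<open>(p, q)\<close>. For fixed \<open>p\<close> the derivative is linear in the
Gaussian vector \<open>q\<close>, with coefficient vector of norm at most \<open>L * V\<close>. The bound \<open>2\<close> is the value of
\<open>E exp (c \<xi>\<^sup>2) = (1 - 2 c)\<^bsup>-1/2\<^esup>\<close> at \<open>c = 3/8\<close>, for a standard normal \<open>\<xi>\<close>.\<close>

lemma exp_square_increment_C1:
  fixes \<sigma> \<sigma>' :: "real \<Rightarrow> real" and x :: "'a \<Rightarrow> 'i \<Rightarrow> real" and u :: "'a \<Rightarrow> real"
  assumes der: "\<And>t. (\<sigma> has_real_derivative \<sigma>' t) (at t)"
    and cont: "continuous_on UNIV \<sigma>'" and L: "\<And>t. \<bar>\<sigma>' t\<bar> \<le> L"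
    and \<eta>: "0 \<le> \<eta>" "\<eta> * (pi/2)\<^sup>2 * (L * V)\<^sup>2 \<le> 3/8" and I[simp]: "finite I" "finite A"
    and V: "op_bound I A x V" and u: "(\<Sum>\<alpha>\<in>A. (u \<alpha>)\<^sup>2) \<le> 1"
  shows "(\<integral>\<^sup>+p. \<integral>\<^sup>+q. ennreal (exp (\<eta> * (feature \<sigma> I A x u p - feature \<sigma> I A x u q)\<^sup>2)) \<partial>std_gaussian I \<partial>std_gaussian I) \<le> 2"
proof -
  let ?G = "std_gaussian I" and ?F = "feature \<sigma> I A x u"
  interpret G: prob_space ?G by (rule prob_space_std_gaussian)
  interpret GG: pair_prob_space ?G ?G ..
  interpret GL: pair_sigma_finite "?G \<Otimes>\<^sub>M ?G" lborel ..
  define h where "h p q = (\<Sum>\<alpha>\<in>A. u \<alpha> * (\<sigma>' (ip I (x \<alpha>) p) * ip I (x \<alpha>) q))" for p q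
  define \<zeta> where "\<zeta> = \<eta> * (pi/2)\<^sup>2"
  have \<zeta>: "0 \<le> \<zeta>" "\<zeta> * (L * V)\<^sup>2 \<le> 3/8" using \<eta> by (simp_all add: \<zeta>_def)
  have [measurable]: "\<sigma>' \<in> borel_measurable borel" by (rule borel_measurable_continuous_onI[OF cont])
  have "continuous_on UNIV \<sigma>" using der by (meson DERIV_continuous_on has_field_derivative_at_within)
  then have [measurable]: "\<sigma> \<in> borel_measurable borel" by (rule borel_measurable_continuous_onI)
  have [measurable]: "(\<lambda>z. h (fst z) (snd z)) \<in> borel_measurable (?G \<Otimes>\<^sub>M ?G)"
    unfolding h_def by measurable
  have rot_meas[measurable]: "(\<lambda>(z, \<theta>). rotate_pair (sin \<theta>) (cos \<theta>) I z) \<in> (?G \<Otimes>\<^sub>M ?G) \<Otimes>\<^sub>M lborel \<rightarrow>\<^sub>M ?G \<Otimes>\<^sub>M ?G"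
    unfolding rotate_pair_def std_gaussian_def split_beta by measurable
  let ?k = "\<lambda>z. ennreal (exp (\<zeta> * (h (fst z) (snd z))\<^sup>2))"
  have inner: "(\<integral>\<^sup>+q. ?k (p, q) \<partial>?G) \<le> 2" for p
  proof -
    define g where "g i = (\<Sum>\<alpha>\<in>A. (u \<alpha> * \<sigma>' (ip I (x \<alpha>) p)) * x \<alpha> i)" for i
    have hg: "h p q = (\<Sum>i\<in>I. g i * q i)" for q
      unfolding h_def g_def ip_def sum_distrib_left sum_distrib_right
      by (subst sum.swap) (simp add: mult_ac)
    have "(\<Sum>i\<in>I. (g i)\<^sup>2) \<le> V\<^sup>2 * (\<Sum>\<alpha>\<in>A. (u \<alpha> * \<sigma>' (ip I (x \<alpha>) p))\<^sup>2)"
      using V[unfolded op_bound_def, THEN spec, of "\<lambda>\<alpha>. u \<alpha> * \<sigma>' (ip I (x \<alpha>) p)"] by (simp add: g_def)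
    also have "\<dots> \<le> V\<^sup>2 * (\<Sum>\<alpha>\<in>A. L\<^sup>2 * (u \<alpha>)\<^sup>2)"
    proof (intro mult_left_mono sum_mono)
      fix \<alpha> show "(u \<alpha> * \<sigma>' (ip I (x \<alpha>) p))\<^sup>2 \<le> L\<^sup>2 * (u \<alpha>)\<^sup>2"
        using mult_left_mono[OF power_mono[OF L abs_ge_zero, of "ip I (x \<alpha>) p" 2], of "(u \<alpha>)\<^sup>2"]
        by (simp add: power_mult_distrib mult.commute)
    qed simp
    also have "\<dots> \<le> V\<^sup>2 * (L\<^sup>2 * 1)"
      unfolding sum_distrib_left[symmetric] using u by (intro mult_left_mono) simp_all
    finally have g: "(\<Sum>i\<in>I. (g i)\<^sup>2) \<le> (L * V)\<^sup>2" by (simp add: power_mult_distrib mult.commute)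
    have "(\<integral>\<^sup>+q. ?k (p, q) \<partial>?G) = (\<integral>\<^sup>+t. ennreal (exp (\<zeta> * (sqrt (\<Sum>i\<in>I. (g i)\<^sup>2) * t)\<^sup>2)) \<partial>N)"
      unfolding fst_conv snd_conv hg by (subst nn_integral_std_gaussian_linear[where g = "\<lambda>t. ennreal (exp (\<zeta> * t\<^sup>2))"]) simp_all
    also have "\<dots> = (\<integral>\<^sup>+t. ennreal (exp ((\<zeta> * (\<Sum>i\<in>I. (g i)\<^sup>2)) * t\<^sup>2)) \<partial>N)"
      by (simp add: power_mult_distrib sum_nonneg mult.assoc)
    also have "\<dots> \<le> 2"
      using mult_left_mono[OF g \<zeta>(1)] \<zeta>(2) by (intro gaussian_exp_square) linarith
    finally show ?thesis .
  qed
  have rot: "(\<integral>\<^sup>+z. ?k (rotate_pair (sin \<theta>) (cos \<theta>) I z) \<partial>(?G \<Otimes>\<^sub>M ?G)) \<le> 2" for \<theta>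
  proof -
    have "(\<integral>\<^sup>+z. ?k (rotate_pair (sin \<theta>) (cos \<theta>) I z) \<partial>(?G \<Otimes>\<^sub>M ?G))
        = (\<integral>\<^sup>+z. ?k z \<partial>distr (?G \<Otimes>\<^sub>M ?G) (?G \<Otimes>\<^sub>M ?G) (rotate_pair (sin \<theta>) (cos \<theta>) I))"
      by (subst nn_integral_distr) simp_all
    also have "\<dots> = (\<integral>\<^sup>+z. ?k z \<partial>(?G \<Otimes>\<^sub>M ?G))"
      by (subst std_gaussian_rotate) simp_all
    also have "\<dots> = (\<integral>\<^sup>+p. \<integral>\<^sup>+q. ?k (p, q) \<partial>?G \<partial>?G)"
      by (subst G.nn_integral_fst[symmetric]) simp_all
    also have "\<dots> \<le> (\<integral>\<^sup>+p. 2 \<partial>?G)" by (intro nn_integral_mono inner)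
    also have "\<dots> = 2" using G.emeasure_space_1 by simp
    finally show ?thesis .
  qed
  let ?w = "\<lambda>\<theta>. ennreal (indicator {0..pi/2} \<theta> * (2/pi))"
  have "(\<integral>\<^sup>+p. \<integral>\<^sup>+q. ennreal (exp (\<eta> * (?F p - ?F q)\<^sup>2)) \<partial>?G \<partial>?G)
      \<le> (\<integral>\<^sup>+p. \<integral>\<^sup>+q. \<integral>\<^sup>+\<theta>. ?w \<theta> * ?k (rotate_pair (sin \<theta>) (cos \<theta>) I (p, q)) \<partial>lborel \<partial>?G \<partial>?G)"
  proof (intro nn_integral_mono)
    fix p q
    show "ennreal (exp (\<eta> * (?F p - ?F q)\<^sup>2)) \<le> (\<integral>\<^sup>+\<theta>. ?w \<theta> * ?k (rotate_pair (sin \<theta>) (cos \<theta>) I (p, q)) \<partial>lborel)"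
      using exp_interpolation[OF der cont \<eta>(1) I, where p = p and q = q and x = x and u = u]
      unfolding h_def[symmetric] \<zeta>_def[symmetric]
      by (simp add: split_beta ennreal_mult[symmetric] mult.assoc)
  qed
  also have "\<dots> = (\<integral>\<^sup>+z. \<integral>\<^sup>+\<theta>. ?w \<theta> * ?k (rotate_pair (sin \<theta>) (cos \<theta>) I z) \<partial>lborel \<partial>(?G \<Otimes>\<^sub>M ?G))"
    by (subst G.nn_integral_fst[symmetric]) simp_all
  also have "\<dots> = (\<integral>\<^sup>+\<theta>. \<integral>\<^sup>+z. ?w \<theta> * ?k (rotate_pair (sin \<theta>) (cos \<theta>) I z) \<partial>(?G \<Otimes>\<^sub>M ?G) \<partial>lborel)"
    by (rule GL.Fubini'[symmetric]) simp
  also have "\<dots> = (\<integral>\<^sup>+\<theta>. ?w \<theta> * (\<integral>\<^sup>+z. ?k (rotate_pair (sin \<theta>) (cos \<theta>) I z) \<partial>(?G \<Otimes>\<^sub>M ?G)) \<partial>lborel)"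
    by (intro nn_integral_cong nn_integral_cmult) simp
  also have "\<dots> \<le> (\<integral>\<^sup>+\<theta>. ?w \<theta> * 2 \<partial>lborel)"
    by (intro nn_integral_mono mult_left_mono rot) simp
  also have "\<dots> = (\<integral>\<^sup>+\<theta>. ennreal (4/pi) * indicator {0..pi/2} \<theta> \<partial>lborel)"
    by (intro nn_integral_cong) (auto simp: indicator_def ennreal_mult[symmetric] simp flip: ennreal_numeral)
  also have "\<dots> = 2"
    by (subst nn_integral_cmult_indicator) (auto simp: ennreal_mult[symmetric] simp flip: ennreal_numeral)
  finally show ?thesis .
qed

text \<open>With an antiderivative \<open>\<Phi>\<close> of \<open>\<sigma>\<close>, the difference quotients of \<open>\<Phi>\<close> are continuously differentiable with derivative bounded
by \<open>L\<close>, and by the mean value theorem they converge to \<open>\<sigma>\<close>.\<close>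

lemma lipschitz_C1_approximation:
  fixes \<sigma> :: "real \<Rightarrow> real"
  assumes L: "L-lipschitz_on UNIV \<sigma>"
  obtains s s' :: "nat \<Rightarrow> real \<Rightarrow> real" where
    "\<And>m t. (s m has_real_derivative s' m t) (at t)" "\<And>m. continuous_on UNIV (s' m)"
    "\<And>m t. \<bar>s' m t\<bar> \<le> L" "\<And>t. (\<lambda>m. s m t) \<longlonglongrightarrow> \<sigma> t"
proof -
  have cont: "continuous_on UNIV \<sigma>" using L by (rule lipschitz_on_continuous_on)
  then have "\<exists>F. \<forall>t. -\<infinity> < ereal t \<longrightarrow> ereal t < \<infinity> \<longrightarrow> (F has_vector_derivative \<sigma> t) (at t)"
    by (intro einterval_antiderivative) (auto simp: continuous_on_eq_continuous_at)
  then obtain \<Phi> where \<Phi>: "\<And>t. (\<Phi> has_real_derivative \<sigma> t) (at t)"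
    by (auto simp: has_real_derivative_iff_has_vector_derivative)
  have lip: "\<bar>\<sigma> a - \<sigma> b\<bar> \<le> L * \<bar>a - b\<bar>" for a b
    using lipschitz_onD[OF L, of a b] by (simp add: dist_real_def)
  have L0: "0 \<le> L" using L by (rule lipschitz_on_nonneg)
  define k where "k m = real (Suc m)" for m
  have k: "0 < k m" for m by (simp add: k_def)
  define s where "s m t = k m * (\<Phi> (t + 1 / k m) - \<Phi> t)" for m t
  define s' where "s' m t = k m * (\<sigma> (t + 1 / k m) - \<sigma> t)" for m t
  show thesis
  proof
    show "(s m has_real_derivative s' m t) (at t)" for m t
      unfolding s_def s'_def
      by (intro DERIV_cmult DERIV_diff \<Phi> DERIV_shift[THEN iffD1, OF \<Phi>])
    show "continuous_on UNIV (s' m)" for m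
      unfolding s'_def by (intro continuous_intros continuous_on_compose2[OF cont]) auto
    show "\<bar>s' m t\<bar> \<le> L" for m t
    proof -
      have "\<bar>s' m t\<bar> = k m * \<bar>\<sigma> (t + 1 / k m) - \<sigma> t\<bar>"
        unfolding s'_def abs_mult using k[of m] by simp
      also have "\<dots> \<le> k m * (L * (1 / k m))"
        using lip[of "t + 1 / k m" t] k[of m] by (intro mult_left_mono) simp_all
      also have "\<dots> = L" using k[of m] by simp
      finally show ?thesis .
    qed
    show "(\<lambda>m. s m t) \<longlonglongrightarrow> \<sigma> t" for t
    proof (rule Lim_null_comparison[THEN LIM_zero_cancel])
      show "\<forall>\<^sub>F m in sequentially. norm (s m t - \<sigma> t) \<le> L * (1 / k m)"
      proof (intro always_eventually allI)
        fix m
        obtain z where z: "t < z" "z < t + 1 / k m" "\<Phi> (t + 1 / k m) - \<Phi> t = (t + 1 / k m - t) * \<sigma> z"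
          using MVT2[of t "t + 1 / k m" \<Phi> \<sigma>] \<Phi> k[of m] by auto
        then have "s m t = \<sigma> z" using k[of m] by (simp add: s_def)
        moreover have "L * \<bar>z - t\<bar> \<le> L * (1 / k m)" using z L0 by (intro mult_left_mono) auto
        ultimately show "norm (s m t - \<sigma> t) \<le> L * (1 / k m)" using lip[of z t] by simp
      qed
      show "(\<lambda>m. L * (1 / k m)) \<longlonglongrightarrow> 0"
        unfolding k_def using tendsto_mult_right_zero[OF LIMSEQ_inverse_real_of_nat]
        by (simp add: inverse_eq_divide)
    qed
  qed
qed

lemma exp_square_increment_lipschitz:
  fixes \<sigma> :: "real \<Rightarrow> real" and x :: "'a \<Rightarrow> 'i \<Rightarrow> real" and u :: "'a \<Rightarrow> real"
  assumes L: "L-lipschitz_on UNIV \<sigma>"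
    and \<eta>: "0 \<le> \<eta>" "\<eta> * (pi/2)\<^sup>2 * (L * V)\<^sup>2 \<le> 3/8" and I: "finite I" "finite A"
    and V: "op_bound I A x V" and u: "(\<Sum>\<alpha>\<in>A. (u \<alpha>)\<^sup>2) \<le> 1"
  shows "(\<integral>\<^sup>+p. \<integral>\<^sup>+q. ennreal (exp (\<eta> * (feature \<sigma> I A x u p - feature \<sigma> I A x u q)\<^sup>2)) \<partial>std_gaussian I \<partial>std_gaussian I) \<le> 2"
proof -
  let ?G = "std_gaussian I"
  interpret G: prob_space ?G by (rule prob_space_std_gaussian)
  interpret GG: pair_prob_space ?G ?G ..
  obtain s s' :: "nat \<Rightarrow> real \<Rightarrow> real" where s:
    "\<And>m t. (s m has_real_derivative s' m t) (at t)" "\<And>m. continuous_on UNIV (s' m)"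
    "\<And>m t. \<bar>s' m t\<bar> \<le> L" "\<And>t. (\<lambda>m. s m t) \<longlonglongrightarrow> \<sigma> t"
    using lipschitz_C1_approximation[OF L] by blast
  have "continuous_on UNIV (s m)" for m using s(1) by (meson DERIV_continuous_on has_field_derivative_at_within)
  then have [measurable]: "s m \<in> borel_measurable borel" for m by (rule borel_measurable_continuous_onI)
  have [measurable]: "\<sigma> \<in> borel_measurable borel"
    by (intro borel_measurable_continuous_onI lipschitz_on_continuous_on[OF L])
  let ?e = "\<lambda>\<sigma> z. ennreal (exp (\<eta> * (feature \<sigma> I A x u (fst z) - feature \<sigma> I A x u (snd z))\<^sup>2))"
  have lim: "?e \<sigma> z = liminf (\<lambda>m. ?e (s m) z)" for z
  proof (rule lim_imp_Liminf[symmetric])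
    show "(\<lambda>m. ?e (s m) z) \<longlonglongrightarrow> ?e \<sigma> z"
      unfolding feature_def by (intro tendsto_intros s(4))
  qed simp
  have "(\<integral>\<^sup>+p. \<integral>\<^sup>+q. ?e \<sigma> (p, q) \<partial>?G \<partial>?G) = (\<integral>\<^sup>+z. ?e \<sigma> z \<partial>(?G \<Otimes>\<^sub>M ?G))"
    by (subst G.nn_integral_fst[symmetric]) simp_all
  also have "\<dots> = (\<integral>\<^sup>+z. liminf (\<lambda>m. ?e (s m) z) \<partial>(?G \<Otimes>\<^sub>M ?G))" by (simp only: lim)
  also have "\<dots> \<le> liminf (\<lambda>m. (\<integral>\<^sup>+z. ?e (s m) z \<partial>(?G \<Otimes>\<^sub>M ?G)))"
    by (intro nn_integral_liminf) simp
  also have "\<dots> \<le> liminf (\<lambda>m. 2)"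
  proof (intro Liminf_mono always_eventually allI)
    fix m
    have "(\<integral>\<^sup>+z. ?e (s m) z \<partial>(?G \<Otimes>\<^sub>M ?G)) = (\<integral>\<^sup>+p. \<integral>\<^sup>+q. ?e (s m) (p, q) \<partial>?G \<partial>?G)"
      by (subst G.nn_integral_fst[symmetric]) simp_all
    also have "\<dots> \<le> 2"
      using exp_square_increment_C1[OF s(1,2,3) \<eta> I V u] by simp
    finally show "(\<integral>\<^sup>+z. ?e (s m) z \<partial>(?G \<Otimes>\<^sub>M ?G)) \<le> 2" .
  qed
  also have "\<dots> = 2" by (simp add: Liminf_const)
  finally show ?thesis by simp
qed

lemma ennreal_integral_le_nn_integral:
  fixes k :: "'a \<Rightarrow> real"
  assumes "integrable M k"
  shows "ennreal (integral\<^sup>L M k) \<le> (\<integral>\<^sup>+x. ennreal (k x) \<partial>M)"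
proof -
  have "ennreal (integral\<^sup>L M k) \<le> ennreal (\<integral>x. max 0 (k x) \<partial>M)"
    using assms by (intro ennreal_leI integral_mono) auto
  also have "\<dots> = (\<integral>\<^sup>+x. ennreal (max 0 (k x)) \<partial>M)"
    using assms by (intro nn_integral_eq_integral[symmetric]) auto
  also have "\<dots> = (\<integral>\<^sup>+x. ennreal (k x) \<partial>M)" by simp
  finally show ?thesis .
qed

lemma lipschitz_abs_le:
  fixes \<sigma> :: "real \<Rightarrow> real"
  assumes "L-lipschitz_on UNIV \<sigma>"
  shows "\<bar>\<sigma> a - \<sigma> b\<bar> \<le> L * \<bar>a - b\<bar>"
  using lipschitz_onD[OF assms, of a b] by (simp add: dist_real_def)

lemma lipschitz_measurable:
  fixes \<sigma> :: "real \<Rightarrow> real"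
  assumes "L-lipschitz_on UNIV \<sigma>"
  shows "\<sigma> \<in> borel_measurable borel"
  by (intro borel_measurable_continuous_onI lipschitz_on_continuous_on[OF assms])

lemma integrable_N_power [simp]: "integrable N (\<lambda>x. x ^ k)"
  by (rule integrable_std_normal_distribution_moment)

lemma lipschitz_square_integrable_N:
  fixes \<sigma> :: "real \<Rightarrow> real"
  assumes L: "L-lipschitz_on UNIV \<sigma>"
  shows "integrable N (\<lambda>x. (\<sigma> (r * x))\<^sup>2)"
proof (rule Bochner_Integration.integrable_bound)
  note [measurable] = lipschitz_measurable[OF L]
  show "(\<lambda>x. (\<sigma> (r * x))\<^sup>2) \<in> borel_measurable N" by simp
  show "integrable N (\<lambda>x. 2 * (\<sigma> 0)\<^sup>2 + 2 * (L * r)\<^sup>2 * x\<^sup>2)" by simp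
  show "AE x in N. norm ((\<sigma> (r * x))\<^sup>2) \<le> norm (2 * (\<sigma> 0)\<^sup>2 + 2 * (L * r)\<^sup>2 * x\<^sup>2)"
  proof (intro always_eventually allI)
    fix x
    have "(\<sigma> (r * x) - \<sigma> 0)\<^sup>2 \<le> (L * (r * x))\<^sup>2"
      using power_mono[OF lipschitz_abs_le[OF L, of "r * x" 0] abs_ge_zero, of 2]
      by (simp add: power_mult_distrib)
    moreover have "(\<sigma> (r * x))\<^sup>2 \<le> 2 * (\<sigma> 0)\<^sup>2 + 2 * (\<sigma> (r * x) - \<sigma> 0)\<^sup>2"
      using zero_le_power2[of "\<sigma> (r * x) - 2 * \<sigma> 0"] by (simp add: power2_eq_square algebra_simps)
    ultimately have "(\<sigma> (r * x))\<^sup>2 \<le> 2 * (\<sigma> 0)\<^sup>2 + 2 * (L * r)\<^sup>2 * x\<^sup>2"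
      by (simp add: power_mult_distrib)
    then show "norm ((\<sigma> (r * x))\<^sup>2) \<le> norm (2 * (\<sigma> 0)\<^sup>2 + 2 * (L * r)\<^sup>2 * x\<^sup>2)" by simp
  qed
qed

lemma (in prob_space) integrable_of_square:
  fixes f :: "'a \<Rightarrow> real"
  assumes [measurable]: "f \<in> borel_measurable M" and "integrable M (\<lambda>x. (f x)\<^sup>2)"
  shows "integrable M f"
proof (rule Bochner_Integration.integrable_bound)
  show "integrable M (\<lambda>x. 1 + (f x)\<^sup>2)" using assms(2) by simp
  show "AE x in M. norm (f x) \<le> norm (1 + (f x)\<^sup>2)"
  proof (intro always_eventually allI)
    fix x
    have "0 \<le> (\<bar>f x\<bar> - 1)\<^sup>2" by simp
    then have "2 * \<bar>f x\<bar> \<le> 1 + (f x)\<^sup>2" by (simp add: power2_eq_square algebra_simps)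
    then show "norm (f x) \<le> norm (1 + (f x)\<^sup>2)" by simp
  qed
qed simp

lemma lipschitz_integrable_N:
  fixes \<sigma> :: "real \<Rightarrow> real"
  assumes L: "L-lipschitz_on UNIV \<sigma>"
  shows "integrable N (\<lambda>x. \<sigma> (r * x))"
proof (rule N.integrable_of_square)
  note [measurable] = lipschitz_measurable[OF L]
  show "(\<lambda>x. \<sigma> (r * x)) \<in> borel_measurable N" by simp
qed (rule lipschitz_square_integrable_N[OF L])

text \<open>This is where \<open>\<sigma>\<close> having mean zero enters: on a column of norm \<open>r\<close> the mean of the activation is only of
order \<open>\<bar>r - 1\<bar>\<close>.\<close>

lemma lipschitz_mean_dilation:
  fixes \<sigma> :: "real \<Rightarrow> real"
  assumes L: "L-lipschitz_on UNIV \<sigma>" and mean: "(\<integral>x. \<sigma> x \<partial>N) = 0"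
  shows "\<bar>\<integral>x. \<sigma> (r * x) \<partial>N\<bar> \<le> L * \<bar>r - 1\<bar>"
proof -
  have L0: "0 \<le> L" using L by (rule lipschitz_on_nonneg)
  have int: "integrable N (\<lambda>x. \<sigma> (r * x))" for r by (rule lipschitz_integrable_N[OF L])
  have "(\<integral>x. \<sigma> (r * x) \<partial>N) = (\<integral>x. \<sigma> (r * x) - \<sigma> x \<partial>N)"
    using int[of r] int[of 1] mean by simp
  also have "\<bar>\<dots>\<bar> \<le> (\<integral>x. \<bar>\<sigma> (r * x) - \<sigma> x\<bar> \<partial>N)" by (rule integral_abs_bound)
  also have "\<dots> \<le> (\<integral>x. L * \<bar>r - 1\<bar> * ((1 + x\<^sup>2) / 2) \<partial>N)"
  proof (rule integral_mono)
    show "integrable N (\<lambda>x. \<bar>\<sigma> (r * x) - \<sigma> x\<bar>)" using int[of r] int[of 1] by simp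
    show "integrable N (\<lambda>x. L * \<bar>r - 1\<bar> * ((1 + x\<^sup>2) / 2))" by simp
    fix x :: real
    have "0 \<le> (\<bar>x\<bar> - 1)\<^sup>2" by simp
    then have *: "\<bar>x\<bar> \<le> (1 + x\<^sup>2) / 2" by (simp add: power2_eq_square algebra_simps)
    have "\<bar>\<sigma> (r * x) - \<sigma> x\<bar> \<le> L * \<bar>r * x - x\<bar>" by (rule lipschitz_abs_le[OF L])
    also have "\<bar>r * x - x\<bar> = \<bar>r - 1\<bar> * \<bar>x\<bar>" by (simp add: abs_mult[symmetric] algebra_simps)
    also have "L * (\<bar>r - 1\<bar> * \<bar>x\<bar>) \<le> L * (\<bar>r - 1\<bar> * ((1 + x\<^sup>2) / 2))"
      using L0 * by (intro mult_left_mono) auto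
    finally show "\<bar>\<sigma> (r * x) - \<sigma> x\<bar> \<le> L * \<bar>r - 1\<bar> * ((1 + x\<^sup>2) / 2)" by (simp only: mult.assoc)
  qed
  also have "\<dots> = L * \<bar>r - 1\<bar>"
    using std_normal_distribution_even_moments(1)[of 1] N.prob_space by (simp add: fact_numeral)
  finally show ?thesis .
qed

lemma feature_integrable:
  assumes L: "L-lipschitz_on UNIV \<sigma>" and I: "finite I"
  shows "integrable (std_gaussian I) (\<lambda>w. (\<sigma> (ip I a w))\<^sup>2)" "integrable (std_gaussian I) (\<lambda>w. \<sigma> (ip I a w))"
    "integrable (std_gaussian I) (feature \<sigma> I A x u)"
proof -
  interpret G: prob_space "std_gaussian I" by (rule prob_space_std_gaussian)
  note [measurable] = lipschitz_measurable[OF L]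
  show 1: "integrable (std_gaussian I) (\<lambda>w. (\<sigma> (ip I a w))\<^sup>2)" for a
    unfolding ip_def
    by (subst integrable_std_gaussian_linear[where g = "\<lambda>t. (\<sigma> t)\<^sup>2", OF I], simp)
       (rule lipschitz_square_integrable_N[OF L])
  show 2: "integrable (std_gaussian I) (\<lambda>w. \<sigma> (ip I a w))" for a
    by (rule G.integrable_of_square[OF _ 1]) simp
  show "integrable (std_gaussian I) (feature \<sigma> I A x u)"
    unfolding feature_def by (intro Bochner_Integration.integrable_sum) (auto intro!: integrable_mult_right 2)
qed

lemma feature_mean:
  assumes L: "L-lipschitz_on UNIV \<sigma>" and mean: "(\<integral>x. \<sigma> x \<partial>N) = 0" and I: "finite I"
    and nrm: "(\<Sum>\<alpha>\<in>A. (sqrt (\<Sum>i\<in>I. (x \<alpha> i)\<^sup>2) - 1)\<^sup>2) \<le> V\<^sup>2" and u: "(\<Sum>\<alpha>\<in>A. (u \<alpha>)\<^sup>2) \<le> 1"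
  shows "(\<integral>w. feature \<sigma> I A x u w \<partial>std_gaussian I)\<^sup>2 \<le> (L * V)\<^sup>2"
proof -
  note [measurable] = lipschitz_measurable[OF L]
  define e where "e \<alpha> = (\<integral>w. \<sigma> (ip I (x \<alpha>) w) \<partial>std_gaussian I)" for \<alpha>
  have e: "\<bar>e \<alpha>\<bar> \<le> L * \<bar>sqrt (\<Sum>i\<in>I. (x \<alpha> i)\<^sup>2) - 1\<bar>" for \<alpha>
    unfolding e_def ip_def
    by (subst integral_std_gaussian_linear[OF I], simp) (rule lipschitz_mean_dilation[OF L mean])
  have "(\<integral>w. feature \<sigma> I A x u w \<partial>std_gaussian I) = (\<Sum>\<alpha>\<in>A. u \<alpha> * e \<alpha>)"
    unfolding feature_def e_def
    by (subst Bochner_Integration.integral_sum) (auto intro!: integrable_mult_right feature_integrable(2)[OF L I])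
  also have "(\<Sum>\<alpha>\<in>A. u \<alpha> * e \<alpha>)\<^sup>2 \<le> (\<Sum>\<alpha>\<in>A. (u \<alpha>)\<^sup>2) * (\<Sum>\<alpha>\<in>A. (e \<alpha>)\<^sup>2)"
    by (rule Cauchy_Schwarz_ineq_sum)
  also have "\<dots> \<le> 1 * (\<Sum>\<alpha>\<in>A. L\<^sup>2 * (sqrt (\<Sum>i\<in>I. (x \<alpha> i)\<^sup>2) - 1)\<^sup>2)"
  proof (intro mult_mono u sum_mono)
    fix \<alpha> show "(e \<alpha>)\<^sup>2 \<le> L\<^sup>2 * (sqrt (\<Sum>i\<in>I. (x \<alpha> i)\<^sup>2) - 1)\<^sup>2"
      using power_mono[OF e abs_ge_zero, of \<alpha> 2] by (simp add: power_mult_distrib)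
  qed (auto intro: sum_nonneg)
  also have "\<dots> \<le> (L * V)\<^sup>2"
    using nrm by (simp add: sum_distrib_left[symmetric] power_mult_distrib mult_left_mono)
  finally show ?thesis .
qed

text \<open>Half of the largest \<open>\<eta>\<close> allowed in \<open>exp_square_increment_lipschitz\<close>; the other half pays for the mean
in \<open>F\<^sup>2 \<le> 2 (F - m)\<^sup>2 + 2 m\<^sup>2\<close>.\<close>

definition moment_rate :: "real \<Rightarrow> real \<Rightarrow> real" where
  "moment_rate L V = 3 / (4 * pi\<^sup>2 * (L * V)\<^sup>2)"

lemma feature_exp_moment:
  fixes \<sigma> :: "real \<Rightarrow> real" and x :: "'a \<Rightarrow> 'i \<Rightarrow> real" and u :: "'a \<Rightarrow> real"
  assumes L: "L-lipschitz_on UNIV \<sigma>" and pos: "0 < L" "0 < V"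
    and mean: "(\<integral>x. \<sigma> x \<partial>N) = 0" and I: "finite I" "finite A"
    and V: "op_bound I A x V" and u: "(\<Sum>\<alpha>\<in>A. (u \<alpha>)\<^sup>2) \<le> 1"
    and nrm: "(\<Sum>\<alpha>\<in>A. (sqrt (\<Sum>i\<in>I. (x \<alpha> i)\<^sup>2) - 1)\<^sup>2) \<le> V\<^sup>2"
  shows "(\<integral>\<^sup>+w. ennreal (exp (moment_rate L V * (feature \<sigma> I A x u w)\<^sup>2)) \<partial>std_gaussian I) \<le> 6"
proof -
  let ?G = "std_gaussian I" and ?F = "feature \<sigma> I A x u"
  interpret G: prob_space ?G by (rule prob_space_std_gaussian)
  note [measurable] = lipschitz_measurable[OF L]
  define \<kappa> where "\<kappa> = moment_rate L V"
  define \<eta> where "\<eta> = 2 * \<kappa>"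
  define m where "m = (\<integral>w. ?F w \<partial>?G)"
  have \<kappa>: "0 < \<kappa>" using pos by (simp add: \<kappa>_def moment_rate_def)
  then have \<eta>: "0 \<le> \<eta>" by (simp add: \<eta>_def)
  have \<eta>': "\<eta> * (pi/2)\<^sup>2 * (L * V)\<^sup>2 \<le> 3/8"
    using pos by (simp add: \<eta>_def \<kappa>_def moment_rate_def power_divide)
  have "\<kappa> * (L * V)\<^sup>2 = 3 / (4 * pi\<^sup>2)" using pos by (simp add: \<kappa>_def moment_rate_def)
  also have "\<dots> \<le> 3 / (4 * 3\<^sup>2)"
    using pi_gt3 by (intro divide_left_mono mult_left_mono power_mono) auto
  also have "\<dots> = 1/12" by simp
  finally have \<kappa>m: "\<eta> * m\<^sup>2 \<le> 1"
    using mult_left_mono[OF feature_mean[OF L mean I(1) nrm u] \<eta>] by (simp add: m_def \<eta>_def)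
  have centred: "(\<integral>\<^sup>+p. ennreal (exp (\<eta> * (?F p - m)\<^sup>2)) \<partial>?G) \<le> 2"
  proof -
    have "(\<integral>\<^sup>+p. ennreal (exp (\<eta> * (?F p - m)\<^sup>2)) \<partial>?G)
      \<le> (\<integral>\<^sup>+p. \<integral>\<^sup>+q. ennreal (exp (\<eta> * (?F p - ?F q)\<^sup>2)) \<partial>?G \<partial>?G)"
    proof (rule nn_integral_mono)
      fix p
      let ?t = "\<lambda>q. exp (\<eta> * (?F p - m)\<^sup>2) * (1 + 2 * \<eta> * (?F p - m) * (m - ?F q))"
      have int: "integrable ?G ?t" using feature_integrable(3)[OF L I(1), of A x u] by simp
      have "(\<integral>q. ?t q \<partial>?G) = exp (\<eta> * (?F p - m)\<^sup>2)"
        using feature_integrable(3)[OF L I(1), of A x u] G.prob_space by (simp add: m_def[symmetric])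
      then have "ennreal (exp (\<eta> * (?F p - m)\<^sup>2)) \<le> (\<integral>\<^sup>+q. ennreal (?t q) \<partial>?G)"
        using ennreal_integral_le_nn_integral[OF int] by simp
      also have "\<dots> \<le> (\<integral>\<^sup>+q. ennreal (exp (\<eta> * (?F p - ?F q)\<^sup>2)) \<partial>?G)"
      proof (intro nn_integral_mono ennreal_leI)
        fix q show "?t q \<le> exp (\<eta> * (?F p - ?F q)\<^sup>2)"
          using exp_square_tangent[OF \<eta>, of "?F p - m" "?F p - ?F q"] by simp
      qed
      finally show "ennreal (exp (\<eta> * (?F p - m)\<^sup>2)) \<le> (\<integral>\<^sup>+q. ennreal (exp (\<eta> * (?F p - ?F q)\<^sup>2)) \<partial>?G)" .
    qed
    also have "\<dots> \<le> 2" by (rule exp_square_increment_lipschitz[OF L \<eta> \<eta>' I V u])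
    finally show ?thesis .
  qed
  have "(\<integral>\<^sup>+w. ennreal (exp (\<kappa> * (?F w)\<^sup>2)) \<partial>?G) \<le> (\<integral>\<^sup>+w. ennreal (exp 1) * ennreal (exp (\<eta> * (?F w - m)\<^sup>2)) \<partial>?G)"
  proof (rule nn_integral_mono)
    fix w
    have "0 \<le> (?F w - 2 * m)\<^sup>2" by simp
    then have "(?F w)\<^sup>2 \<le> 2 * (?F w - m)\<^sup>2 + 2 * m\<^sup>2" by (simp add: power2_eq_square algebra_simps)
    from mult_left_mono[OF this, of \<kappa>] have "\<kappa> * (?F w)\<^sup>2 \<le> 1 + \<eta> * (?F w - m)\<^sup>2"
      using \<kappa> \<kappa>m by (simp add: \<eta>_def algebra_simps)
    then have "exp (\<kappa> * (?F w)\<^sup>2) \<le> exp 1 * exp (\<eta> * (?F w - m)\<^sup>2)" by (simp add: exp_add[symmetric])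
    then show "ennreal (exp (\<kappa> * (?F w)\<^sup>2)) \<le> ennreal (exp 1) * ennreal (exp (\<eta> * (?F w - m)\<^sup>2))"
      by (simp add: ennreal_mult[symmetric] ennreal_leI)
  qed
  also have "\<dots> = ennreal (exp 1) * (\<integral>\<^sup>+w. ennreal (exp (\<eta> * (?F w - m)\<^sup>2)) \<partial>?G)"
    by (rule nn_integral_cmult) simp
  also have "\<dots> \<le> ennreal 3 * 2"
    by (intro mult_mono centred ennreal_leI exp_le) auto
  also have "\<dots> = 6" by (simp flip: ennreal_numeral add: ennreal_mult[symmetric])
  finally show ?thesis by (simp add: \<kappa>_def)
qed

section \<open>Bernstein's inequality for independent rows\<close>

lemma exp_le_quadratic:
  fixes q t :: real
  assumes q: "0 \<le> q" and t: "\<bar>t\<bar> \<le> 1/2"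
  shows "exp (t * q) \<le> 1 + t * q + 4 * t\<^sup>2 * exp q"
proof -
  obtain z where z: "\<bar>z\<bar> \<le> \<bar>t * q\<bar>" "exp (t * q) = (\<Sum>m<2. (t * q) ^ m / fact m) + exp z / fact 2 * (t * q)\<^sup>2"
    using Maclaurin_exp_le[of "t * q" 2] by blast
  have "z \<le> q / 2" using z(1) q mult_right_mono[OF t, of q] by (simp add: abs_mult)
  then have ez: "exp z \<le> exp (q / 2)" by simp
  have "(q / 2)\<^sup>2 / 2 \<le> exp (q / 2)" using exp_lower_Taylor_quadratic[of "q / 2"] q by simp
  then have q2: "q\<^sup>2 \<le> 8 * exp (q / 2)" by (simp add: power_divide)
  have "exp z / fact 2 * (t * q)\<^sup>2 = t\<^sup>2 / 2 * (exp z * q\<^sup>2)" by (simp add: power_mult_distrib)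
  also have "\<dots> \<le> t\<^sup>2 / 2 * (exp (q / 2) * (8 * exp (q / 2)))"
    using ez q2 by (intro mult_left_mono mult_mono) auto
  also have "\<dots> = 4 * t\<^sup>2 * exp q" by (simp add: exp_add[symmetric])
  finally show ?thesis using z(2) by (simp add: numeral_2_eq_2)
qed

text \<open>Integrating \<open>exp_le_quadratic\<close> bounds the moment generating function of \<open>Q\<close> by
\<open>1 + t E Q + 4 t\<^sup>2 * 6\<close>, which is at most \<open>exp (t E Q + 24 t\<^sup>2)\<close>.\<close>

lemma (in prob_space) sub_exponential_mgf:
  fixes Q :: "'a \<Rightarrow> real"
  assumes [measurable]: "Q \<in> borel_measurable M" and Q0: "\<And>x. 0 \<le> Q x"
    and E: "(\<integral>\<^sup>+x. ennreal (exp (Q x)) \<partial>M) \<le> 6"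
  shows "integrable M Q"
    and "\<bar>t\<bar> \<le> 1/2 \<Longrightarrow> (\<integral>\<^sup>+x. ennreal (exp (t * (Q x - expectation Q))) \<partial>M) \<le> ennreal (exp (24 * t\<^sup>2))"
proof -
  have fin: "(\<integral>\<^sup>+x. ennreal (exp (Q x)) \<partial>M) < \<infinity>" by (rule le_less_trans[OF E]) simp
  have iexp: "integrable M (\<lambda>x. exp (Q x))" using fin by (intro integrableI_nonneg) simp_all
  show iQ: "integrable M Q"
  proof (rule Bochner_Integration.integrable_bound[OF iexp])
    show "AE x in M. norm (Q x) \<le> norm (exp (Q x))"
    proof (intro always_eventually allI)
      fix x
      have "Q x \<le> exp (Q x)" using exp_ge_add_one_self[of "Q x"] by linarith
      then show "norm (Q x) \<le> norm (exp (Q x))" using Q0[of x] by simp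
    qed
  qed simp
  assume t: "\<bar>t\<bar> \<le> 1/2"
  have "ennreal (\<integral>x. exp (Q x) \<partial>M) \<le> ennreal 6"
    using E nn_integral_eq_integral[OF iexp] by simp
  then have E': "(\<integral>x. exp (Q x) \<partial>M) \<le> 6" by (simp only: ennreal_le_iff)
  let ?c = "exp (- t * expectation Q)"
  have int: "integrable M (\<lambda>x. ?c * (1 + t * Q x + 4 * t\<^sup>2 * exp (Q x)))"
    using iQ iexp by simp
  have "(\<integral>\<^sup>+x. ennreal (exp (t * (Q x - expectation Q))) \<partial>M)
     \<le> (\<integral>\<^sup>+x. ennreal (?c * (1 + t * Q x + 4 * t\<^sup>2 * exp (Q x))) \<partial>M)"
  proof (intro nn_integral_mono ennreal_leI)
    fix x
    have "exp (t * (Q x - expectation Q)) = ?c * exp (t * Q x)" by (simp add: exp_add[symmetric] algebra_simps)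
    also have "\<dots> \<le> ?c * (1 + t * Q x + 4 * t\<^sup>2 * exp (Q x))"
      by (intro mult_left_mono exp_le_quadratic Q0 t) simp
    finally show "exp (t * (Q x - expectation Q)) \<le> ?c * (1 + t * Q x + 4 * t\<^sup>2 * exp (Q x))" .
  qed
  also have "\<dots> = ennreal (\<integral>x. ?c * (1 + t * Q x + 4 * t\<^sup>2 * exp (Q x)) \<partial>M)"
  proof (rule nn_integral_eq_integral[OF int], intro always_eventually allI)
    fix x
    have "0 \<le> exp (t * Q x)" by simp
    also have "\<dots> \<le> 1 + t * Q x + 4 * t\<^sup>2 * exp (Q x)" by (intro exp_le_quadratic Q0 t)
    finally show "0 \<le> ?c * (1 + t * Q x + 4 * t\<^sup>2 * exp (Q x))" by simp
  qed
  also have "\<dots> = ennreal (?c * (1 + t * expectation Q + 4 * t\<^sup>2 * (\<integral>x. exp (Q x) \<partial>M)))"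
    using iQ iexp prob_space by simp
  also have "\<dots> \<le> ennreal (?c * exp (t * expectation Q + 24 * t\<^sup>2))"
  proof (intro ennreal_leI mult_left_mono)
    have "1 + t * expectation Q + 4 * t\<^sup>2 * (\<integral>x. exp (Q x) \<partial>M) \<le> 1 + (t * expectation Q + 24 * t\<^sup>2)"
      using mult_left_mono[OF E', of "4 * t\<^sup>2"] by simp
    also have "\<dots> \<le> exp (t * expectation Q + 24 * t\<^sup>2)" by (rule exp_ge_add_one_self)
    finally show "1 + t * expectation Q + 4 * t\<^sup>2 * (\<integral>x. exp (Q x) \<partial>M) \<le> exp (t * expectation Q + 24 * t\<^sup>2)" .
  qed simp
  also have "\<dots> = ennreal (exp (24 * t\<^sup>2))" by (simp add: exp_add[symmetric])
  finally show "(\<integral>\<^sup>+x. ennreal (exp (t * (Q x - expectation Q))) \<partial>M) \<le> ennreal (exp (24 * t\<^sup>2))" .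
qed

text \<open>Restricted to \<open>J\<close>, because the points of a product space over \<open>J\<close> are extensional functions.\<close>

definition row_of :: "'j set \<Rightarrow> (nat \<times> 'j \<Rightarrow> real) \<Rightarrow> nat \<Rightarrow> 'j \<Rightarrow> real" where
  "row_of J w i = (\<lambda>j\<in>J. w (i, j))"

lemma measurable_row_of [measurable]:
  assumes "i < m"
  shows "(\<lambda>w. row_of J w i) \<in> std_gaussian ({..<m} \<times> J) \<rightarrow>\<^sub>M std_gaussian J"
  unfolding row_of_def std_gaussian_def using assms
  by (intro measurable_restrict measurable_component_singleton) auto

text \<open>The rows of a Gaussian matrix are independent Gaussian vectors; this is the form of independence that the
Chernoff bound uses.\<close>

lemma nn_integral_rows:
  fixes g :: "('j \<Rightarrow> real) \<Rightarrow> ennreal"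
  assumes J[simp]: "finite J" and g[measurable]: "g \<in> borel_measurable (std_gaussian J)"
  shows "(\<integral>\<^sup>+w. (\<Prod>i<m. g (row_of J w i)) \<partial>std_gaussian ({..<m} \<times> J)) = (\<integral>\<^sup>+w. g w \<partial>std_gaussian J) ^ m"
proof (induction m)
  case 0
  show ?case using prob_space.emeasure_space_1[OF prob_space_std_gaussian] by simp
next
  case (Suc m)
  let ?I = "{..<m} \<times> J" and ?K = "{m} \<times> J"
  have split: "{..<Suc m} \<times> J = ?I \<union> ?K" by auto
  have disj: "?I \<inter> ?K = {}" by auto
  have last: "(\<integral>\<^sup>+w. g (row_of J w m) \<partial>std_gaussian ?K) = (\<integral>\<^sup>+w. g w \<partial>std_gaussian J)"
  proof -
    have "distr (std_gaussian ?K) (std_gaussian J) (\<lambda>w. row_of J w m) = std_gaussian J"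
      unfolding std_gaussian_def row_of_def
      by (rule distr_PiM_reindex[where f = "\<lambda>j. (m, j)" and M = "\<lambda>_. N"])
         (auto intro: inj_onI N.prob_space_axioms)
    then have "(\<integral>\<^sup>+w. g w \<partial>std_gaussian J) = (\<integral>\<^sup>+w. g w \<partial>distr (std_gaussian ?K) (std_gaussian J) (\<lambda>w. row_of J w m))"
      by simp
    also have "\<dots> = (\<integral>\<^sup>+w. g (row_of J w m) \<partial>std_gaussian ?K)"
    proof (rule nn_integral_distr)
      show "g \<in> borel_measurable (distr (std_gaussian ?K) (std_gaussian J) (\<lambda>w. row_of J w m))" by simp
      show "(\<lambda>w. row_of J w m) \<in> std_gaussian ?K \<rightarrow>\<^sub>M std_gaussian J"
        unfolding row_of_def std_gaussian_def
        by (intro measurable_restrict measurable_component_singleton) auto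
    qed
    finally show ?thesis ..
  qed
  have gm[measurable]: "(\<lambda>w. g (row_of J w m)) \<in> borel_measurable (std_gaussian ?K)"
  proof (rule measurable_compose[OF _ g])
    show "(\<lambda>w. row_of J w m) \<in> std_gaussian ?K \<rightarrow>\<^sub>M std_gaussian J"
      unfolding row_of_def std_gaussian_def
      by (intro measurable_restrict measurable_component_singleton) auto
  qed
  have gi[measurable]: "(\<lambda>w. g (row_of J w i)) \<in> borel_measurable (std_gaussian ?I)" if "i < m" for i
    by (rule measurable_compose[OF measurable_row_of[OF that] g])
  have pm: "(\<lambda>w. \<Prod>i<m. g (row_of J w i)) \<in> borel_measurable (std_gaussian ?I)"
    by (intro borel_measurable_prod_ennreal gi) auto
  have all: "(\<lambda>w. \<Prod>i<Suc m. g (row_of J w i)) \<in> borel_measurable (std_gaussian (?I \<union> ?K))"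
    unfolding split[symmetric]
    by (intro borel_measurable_prod_ennreal measurable_compose[OF measurable_row_of g]) auto
  have rI: "row_of J (merge ?I ?K (x, y)) i = row_of J x i" if "i < m" for x y i
    unfolding row_of_def using that by (intro restrict_ext) (auto simp: merge_def)
  have rK: "row_of J (merge ?I ?K (x, y)) m = row_of J y m" for x y
    unfolding row_of_def by (intro restrict_ext) (auto simp: merge_def)
  have "(\<integral>\<^sup>+w. (\<Prod>i<Suc m. g (row_of J w i)) \<partial>std_gaussian ({..<Suc m} \<times> J))
      = (\<integral>\<^sup>+x. \<integral>\<^sup>+y. (\<Prod>i<Suc m. g (row_of J (merge ?I ?K (x, y)) i)) \<partial>std_gaussian ?K \<partial>std_gaussian ?I)"
    unfolding split std_gaussian_def
    by (rule PN.product_nn_integral_fold[OF disj]) (use all[unfolded std_gaussian_def] in auto)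
  also have "\<dots> = (\<integral>\<^sup>+x. \<integral>\<^sup>+y. (\<Prod>i<m. g (row_of J x i)) * g (row_of J y m) \<partial>std_gaussian ?K \<partial>std_gaussian ?I)"
    by (simp add: rI rK)
  also have "\<dots> = (\<integral>\<^sup>+x. (\<Prod>i<m. g (row_of J x i)) * (\<integral>\<^sup>+w. g w \<partial>std_gaussian J) \<partial>std_gaussian ?I)"
    by (subst nn_integral_cmult[OF gm], subst last) simp
  also have "\<dots> = (\<integral>\<^sup>+w. g w \<partial>std_gaussian J) ^ m * (\<integral>\<^sup>+w. g w \<partial>std_gaussian J)"
    by (subst nn_integral_multc[OF pm], subst Suc) simp
  finally show ?case by (simp add: mult.commute)
qed

lemma rows_chernoff:
  fixes Q :: "('j \<Rightarrow> real) \<Rightarrow> real"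
  assumes J: "finite J" and [measurable]: "Q \<in> borel_measurable (std_gaussian J)"
    and mgf: "(\<integral>\<^sup>+x. ennreal (exp (t * (Q x - e))) \<partial>std_gaussian J) \<le> ennreal (exp c)"
  shows "measure (std_gaussian ({..<m} \<times> J)) 
     {w \<in> space (std_gaussian ({..<m} \<times> J)). b \<le> t * (\<Sum>i<m. Q (row_of J w i) - e)} \<le> exp (real m * c - b)"
proof -
  let ?W = "std_gaussian ({..<m} \<times> J)"
  interpret W: prob_space ?W by (rule prob_space_std_gaussian)
  let ?S = "\<lambda>w. \<Sum>i<m. Q (row_of J w i) - e"
  have Qi[measurable]: "(\<lambda>w. Q (row_of J w i)) \<in> borel_measurable ?W" if "i < m" for i
    by (rule measurable_compose[OF measurable_row_of[OF that]]) simp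
  have S[measurable]: "?S \<in> borel_measurable ?W"
    by (intro borel_measurable_sum borel_measurable_diff Qi) auto
  let ?B = "{w \<in> space ?W. b \<le> t * ?S w}"
  have "emeasure ?W ?B = (\<integral>\<^sup>+w. indicator ?B w \<partial>?W)" by simp
  also have "\<dots> \<le> (\<integral>\<^sup>+w. ennreal (exp (- b)) * (\<Prod>i<m. ennreal (exp (t * (Q (row_of J w i) - e)))) \<partial>?W)"
  proof (rule nn_integral_mono)
    fix w
    have "(\<Prod>i<m. exp (t * (Q (row_of J w i) - e))) = exp (t * ?S w)"
      by (simp add: exp_sum[symmetric] sum_distrib_left)
    then have "ennreal (exp (- b)) * (\<Prod>i<m. ennreal (exp (t * (Q (row_of J w i) - e)))) = ennreal (exp (t * ?S w - b))"
      by (simp add: prod_ennreal ennreal_mult[symmetric] exp_add[symmetric])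
    moreover have "indicator ?B w \<le> ennreal (exp (t * ?S w - b))"
      by (auto simp: indicator_def)
    ultimately show "indicator ?B w \<le> ennreal (exp (- b)) * (\<Prod>i<m. ennreal (exp (t * (Q (row_of J w i) - e))))"
      by simp
  qed
  also have "\<dots> = ennreal (exp (- b)) * (\<integral>\<^sup>+w. (\<Prod>i<m. ennreal (exp (t * (Q (row_of J w i) - e)))) \<partial>?W)"
    by (intro nn_integral_cmult borel_measurable_prod measurable_compose[OF Qi]) auto
  also have "\<dots> = ennreal (exp (- b)) * (\<integral>\<^sup>+x. ennreal (exp (t * (Q x - e))) \<partial>std_gaussian J) ^ m"
    by (subst nn_integral_rows[where g = "\<lambda>x. ennreal (exp (t * (Q x - e)))", OF J]) simp_all
  also have "\<dots> \<le> ennreal (exp (- b)) * ennreal (exp c) ^ m"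
    by (intro mult_left_mono power_mono mgf) auto
  also have "\<dots> = ennreal (exp (real m * c - b))"
    by (simp add: ennreal_power ennreal_mult[symmetric] exp_of_nat_mult[symmetric] exp_add[symmetric])
  finally show ?thesis by (simp add: W.emeasure_eq_measure)
qed

text \<open>Chernoff's bound at \<open>t = \<plusminus> s / 48\<close>, which minimizes \<open>24 t\<^sup>2 - \<bar>t\<bar> s\<close>. The condition \<open>s \<le> 24\<close> keeps \<open>t\<close> in the
range of \<open>sub_exponential_mgf\<close>.\<close>

lemma rows_bernstein:
  fixes Q :: "('j \<Rightarrow> real) \<Rightarrow> real"
  assumes J: "finite J" and [measurable]: "Q \<in> borel_measurable (std_gaussian J)" and Q0: "\<And>x. 0 \<le> Q x"
    and E: "(\<integral>\<^sup>+x. ennreal (exp (Q x)) \<partial>std_gaussian J) \<le> 6" and s: "0 < s" "s \<le> 24"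
  defines "e \<equiv> (\<integral>x. Q x \<partial>std_gaussian J)"
  shows "measure (std_gaussian ({..<m} \<times> J)) 
     {w \<in> space (std_gaussian ({..<m} \<times> J)). real m * s \<le> \<bar>\<Sum>i<m. Q (row_of J w i) - e\<bar>} \<le> 2 * exp (- real m * s\<^sup>2 / 96)"
proof -
  let ?W = "std_gaussian ({..<m} \<times> J)"
  interpret W: prob_space ?W by (rule prob_space_std_gaussian)
  interpret G: prob_space "std_gaussian J" by (rule prob_space_std_gaussian)
  let ?S = "\<lambda>w. \<Sum>i<m. Q (row_of J w i) - e"
  let ?B = "\<lambda>t. {w \<in> space ?W. real m * s\<^sup>2 / 48 \<le> t * ?S w}"
  have Qi[measurable]: "(\<lambda>w. Q (row_of J w i)) \<in> borel_measurable ?W" if "i < m" for i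
    by (rule measurable_compose[OF measurable_row_of[OF that]]) simp
  have S[measurable]: "?S \<in> borel_measurable ?W"
    by (intro borel_measurable_sum borel_measurable_diff Qi) auto
  have one: "measure ?W (?B t) \<le> exp (- real m * s\<^sup>2 / 96)" if "\<bar>t\<bar> = s / 48" for t
  proof -
    have t2: "24 * t\<^sup>2 = s\<^sup>2 / 96" using power2_abs[of t] unfolding that by (simp add: power_divide)
    have "\<bar>t\<bar> \<le> 1/2" using that s by simp
    from G.sub_exponential_mgf(2)[OF _ Q0 E this]
    have "(\<integral>\<^sup>+x. ennreal (exp (t * (Q x - e))) \<partial>std_gaussian J) \<le> ennreal (exp (s\<^sup>2 / 96))"
      unfolding t2 e_def by simp
    from rows_chernoff[OF J _ this, of m "real m * s\<^sup>2 / 48"]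
    have "measure ?W (?B t) \<le> exp (real m * (s\<^sup>2 / 96) - real m * s\<^sup>2 / 48)" by simp
    also have "real m * (s\<^sup>2 / 96) - real m * s\<^sup>2 / 48 = - real m * s\<^sup>2 / 96" by (simp add: field_simps)
    finally show ?thesis .
  qed
  have "{w \<in> space ?W. real m * s \<le> \<bar>?S w\<bar>} \<subseteq> ?B (s / 48) \<union> ?B (- (s / 48))"
  proof
    fix w assume w: "w \<in> {w \<in> space ?W. real m * s \<le> \<bar>?S w\<bar>}"
    then have "s / 48 * (real m * s) \<le> s / 48 * \<bar>?S w\<bar>" using s by (intro mult_left_mono) auto
    then have "real m * s\<^sup>2 / 48 \<le> s / 48 * \<bar>?S w\<bar>" by (simp add: power2_eq_square mult_ac)
    then show "w \<in> ?B (s / 48) \<union> ?B (- (s / 48))" using w by (cases "0 \<le> ?S w") auto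
  qed
  then have "measure ?W {w \<in> space ?W. real m * s \<le> \<bar>?S w\<bar>} \<le> measure ?W (?B (s / 48) \<union> ?B (- (s / 48)))"
    by (intro W.finite_measure_mono) auto
  also have "\<dots> \<le> measure ?W (?B (s / 48)) + measure ?W (?B (- (s / 48)))"
    by (intro measure_Un_le) auto
  also have "\<dots> \<le> 2 * exp (- real m * s\<^sup>2 / 96)"
    using one[of "s / 48"] one[of "- (s / 48)"] s by simp
  finally show ?thesis .
qed

section \<open>Nets and quadratic forms\<close>

lemma sum_half_power_abs:
  "(\<Sum>k\<in>{- int b..int b}. (1/2 :: real) ^ nat \<bar>k\<bar>) \<le> 3"
proof -
  have "(\<Sum>k\<in>{- int b..int b}. (1/2 :: real) ^ nat \<bar>k\<bar>) = 3 - 2 * (1/2) ^ b"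
  proof (induction b)
    case (Suc b)
    have "{- int (Suc b)..int (Suc b)} = insert (int (Suc b)) (insert (- int (Suc b)) {- int b..int b})" by auto
    moreover have "nat \<bar>int (Suc b)\<bar> = Suc b" "nat \<bar>- int (Suc b)\<bar> = Suc b" by simp_all
    ultimately show ?case using Suc by simp
  qed simp
  then show ?thesis by simp
qed

text \<open>Instead of comparing volumes, each lattice point of the ball is weighted with \<open>exp (16 n - |z|\<^sup>2) \<ge> 1\<close>. The sum of
the weights factorizes over the coordinates, and each factor is at most \<open>3 exp 16 \<le> exp 18\<close>.\<close>

lemma card_lattice_points_ball:
  fixes n :: nat
  defines "Z \<equiv> {z \<in> {..<n} \<rightarrow>\<^sub>E UNIV. (\<Sum>\<alpha><n. (z \<alpha>)\<^sup>2) \<le> 16 * int n}"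
  shows "finite Z" "real (card Z) \<le> exp (18 * real n)"
proof -
  let ?B = "{- int (16 * n)..int (16 * n)}"
  have sub: "Z \<subseteq> {..<n} \<rightarrow>\<^sub>E ?B"
  proof
    fix z assume z: "z \<in> Z"
    have "z \<alpha> \<in> ?B" if "\<alpha> < n" for \<alpha>
    proof -
      have "int (nat \<bar>z \<alpha>\<bar>) \<le> int (nat \<bar>z \<alpha>\<bar> * nat \<bar>z \<alpha>\<bar>)" by (simp only: of_nat_le_iff le_square)
      then have "\<bar>z \<alpha>\<bar> \<le> (z \<alpha>)\<^sup>2" by (simp add: power2_eq_square)
      also have "\<dots> \<le> (\<Sum>\<alpha><n. (z \<alpha>)\<^sup>2)" using that by (intro member_le_sum) auto
      also have "\<dots> \<le> 16 * int n" using z by (simp add: Z_def)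
      finally show ?thesis by auto
    qed
    then show "z \<in> {..<n} \<rightarrow>\<^sub>E ?B" using z by (auto simp: Z_def PiE_iff)
  qed
  have fin: "finite ({..<n} \<rightarrow>\<^sub>E ?B)" by (intro finite_PiE) auto
  show "finite Z" using sub fin by (rule finite_subset)
  have "real (card Z) = (\<Sum>z\<in>Z. 1)" by simp
  also have "\<dots> \<le> (\<Sum>z\<in>Z. \<Prod>\<alpha><n. exp 16 * exp (- (real_of_int (z \<alpha>))\<^sup>2))"
  proof (rule sum_mono)
    fix z assume "z \<in> Z"
    then have "real_of_int (\<Sum>\<alpha><n. (z \<alpha>)\<^sup>2) \<le> real_of_int (16 * int n)" unfolding Z_def by (subst of_int_le_iff) simp
    then have "0 \<le> (\<Sum>\<alpha><n. 16 - (real_of_int (z \<alpha>))\<^sup>2)" by (simp add: sum_subtractf)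
    then have "1 \<le> exp (\<Sum>\<alpha><n. 16 - (real_of_int (z \<alpha>))\<^sup>2)" by simp
    also have "\<dots> = (\<Prod>\<alpha><n. exp 16 * exp (- (real_of_int (z \<alpha>))\<^sup>2))"
      by (simp add: exp_sum exp_add[symmetric])
    finally show "1 \<le> (\<Prod>\<alpha><n. exp 16 * exp (- (real_of_int (z \<alpha>))\<^sup>2))" .
  qed
  also have "\<dots> \<le> (\<Sum>z\<in>{..<n} \<rightarrow>\<^sub>E ?B. \<Prod>\<alpha><n. exp 16 * exp (- (real_of_int (z \<alpha>))\<^sup>2))"
    using sub fin by (intro sum_mono2) (auto intro: prod_nonneg)
  also have "\<dots> = (\<Prod>\<alpha><n. \<Sum>k\<in>?B. exp 16 * exp (- (real_of_int k)\<^sup>2))"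
    by (rule prod_sum_PiE[symmetric]) auto
  also have "\<dots> = (exp 16 * (\<Sum>k\<in>?B. exp (- (real_of_int k)\<^sup>2))) ^ n"
    by (simp add: sum_distrib_left)
  also have "\<dots> \<le> (exp 16 * exp 2) ^ n"
  proof (intro power_mono mult_left_mono)
    have "(\<Sum>k\<in>?B. exp (- (real_of_int k)\<^sup>2)) \<le> (\<Sum>k\<in>?B. (1/2) ^ nat \<bar>k\<bar>)"
    proof (rule sum_mono)
      fix k :: int
      have "nat \<bar>k\<bar> \<le> (nat \<bar>k\<bar>)\<^sup>2" unfolding power2_eq_square by (rule le_square)
      then have "real (nat \<bar>k\<bar>) \<le> real ((nat \<bar>k\<bar>)\<^sup>2)" by (simp only: of_nat_le_iff)
      then have *: "real (nat \<bar>k\<bar>) \<le> (real_of_int k)\<^sup>2" by simp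
      have "exp (-1 :: real) \<le> 1/2" using exp_ge_add_one_self[of "1::real"] by (simp add: exp_minus field_simps)
      then have "exp (-1) ^ nat \<bar>k\<bar> \<le> (1/2 :: real) ^ nat \<bar>k\<bar>" by (intro power_mono) auto
      moreover have "exp (- (real_of_int k)\<^sup>2) \<le> exp (-1) ^ nat \<bar>k\<bar>"
        using * by (simp add: exp_of_nat_mult[symmetric])
      ultimately show "exp (- (real_of_int k)\<^sup>2) \<le> (1/2) ^ nat \<bar>k\<bar>" by simp
    qed
    also have "\<dots> \<le> 3" by (rule sum_half_power_abs)
    also have "\<dots> \<le> exp 2" using exp_ge_add_one_self[of "2::real"] by simp
    finally show "(\<Sum>k\<in>?B. exp (- (real_of_int k)\<^sup>2)) \<le> exp 2" .
  qed (auto intro!: sum_nonneg mult_nonneg_nonneg)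
  also have "\<dots> = exp (18 * real n)" by (simp only: exp_add[symmetric] exp_of_nat_mult[symmetric]) (simp add: mult.commute)
  finally show "real (card Z) \<le> exp (18 * real n)" .
qed

text \<open>The net consists of the points with coordinates in the lattice of mesh \<open>1 / (4 sqrt n)\<close>. Rounding the
coordinates towards zero keeps a point in the unit ball and moves it by at most \<open>1/4\<close>.\<close>

lemma ball_net:
  obtains T :: "(nat \<Rightarrow> real) set" where "finite T" "real (card T) \<le> exp (18 * real n)"
    "\<And>v. v \<in> T \<Longrightarrow> (\<Sum>\<alpha><n. (v \<alpha>)\<^sup>2) \<le> 1"
    "\<And>u. (\<Sum>\<alpha><n. (u \<alpha>)\<^sup>2) \<le> 1 \<Longrightarrow> \<exists>v\<in>T. (\<Sum>\<alpha><n. (u \<alpha> - v \<alpha>)\<^sup>2) \<le> 1/16"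
proof -
  define Z where "Z = {z \<in> {..<n} \<rightarrow>\<^sub>E UNIV. (\<Sum>\<alpha><n. (z \<alpha>)\<^sup>2) \<le> 16 * int n}"
  define c where "c = 4 * sqrt (real n)"
  have c2: "c\<^sup>2 = 16 * real n" by (simp add: c_def power_mult_distrib)
  define f where "f z \<alpha> = real_of_int (z \<alpha>) / c" for z :: "nat \<Rightarrow> int" and \<alpha> :: nat
  have Z: "finite Z" "real (card Z) \<le> exp (18 * real n)"
    unfolding Z_def by (rule card_lattice_points_ball)+
  show thesis
  proof (rule that[of "f ` Z"])
    show "finite (f ` Z)" using Z by simp
    show "real (card (f ` Z)) \<le> exp (18 * real n)" using Z card_image_le[OF Z(1), of f] by linarith
  next
    fix v assume "v \<in> f ` Z"
    then obtain z where z: "z \<in> Z" "v = f z" by auto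
    have "real_of_int (\<Sum>\<alpha><n. (z \<alpha>)\<^sup>2) \<le> real_of_int (16 * int n)" using z unfolding Z_def by (subst of_int_le_iff) simp
    then have "(\<Sum>\<alpha><n. (real_of_int (z \<alpha>))\<^sup>2) \<le> 16 * real n" by simp
    then show "(\<Sum>\<alpha><n. (v \<alpha>)\<^sup>2) \<le> 1"
      unfolding z f_def by (cases "n = 0") (simp_all add: power_divide c2 sum_divide_distrib[symmetric])
  next
    fix u :: "nat \<Rightarrow> real" assume u: "(\<Sum>\<alpha><n. (u \<alpha>)\<^sup>2) \<le> 1"
    define t :: "real \<Rightarrow> int" where "t x = (if 0 \<le> x then \<lfloor>x\<rfloor> else \<lceil>x\<rceil>)" for x
    have t1: "\<bar>real_of_int (t x)\<bar> \<le> \<bar>x\<bar>" and t2: "\<bar>x - real_of_int (t x)\<bar> \<le> 1" for x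
      unfolding t_def by (auto; linarith)+
    define z where "z = (\<lambda>\<alpha>\<in>{..<n}. t (c * u \<alpha>))"
    have "real_of_int (\<Sum>\<alpha><n. (z \<alpha>)\<^sup>2) = (\<Sum>\<alpha><n. \<bar>real_of_int (t (c * u \<alpha>))\<bar>\<^sup>2)" by (simp add: z_def)
    also have "\<dots> \<le> (\<Sum>\<alpha><n. \<bar>c * u \<alpha>\<bar>\<^sup>2)" by (intro sum_mono power_mono t1) auto
    also have "\<dots> = c\<^sup>2 * (\<Sum>\<alpha><n. (u \<alpha>)\<^sup>2)" by (simp add: power_mult_distrib sum_distrib_left)
    also have "\<dots> \<le> 16 * real n * 1" unfolding c2 by (intro mult_left_mono u) simp
    also have "\<dots> = real_of_int (16 * int n)" by simp
    finally have "z \<in> Z" unfolding Z_def of_int_le_iff by (simp add: z_def)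
    moreover have "(\<Sum>\<alpha><n. (u \<alpha> - f z \<alpha>)\<^sup>2) \<le> 1/16"
    proof (cases "n = 0")
      case False
      then have c: "c > 0" by (simp add: c_def)
      have "(\<Sum>\<alpha><n. (u \<alpha> - f z \<alpha>)\<^sup>2) \<le> (\<Sum>\<alpha><n. 1 / c\<^sup>2)"
      proof (rule sum_mono)
        fix \<alpha> assume "\<alpha> \<in> {..<n}"
        then have "(u \<alpha> - f z \<alpha>)\<^sup>2 = \<bar>c * u \<alpha> - real_of_int (t (c * u \<alpha>))\<bar>\<^sup>2 / c\<^sup>2"
          using c by (simp add: f_def z_def power_divide[symmetric] diff_divide_distrib)
        also have "\<dots> \<le> 1\<^sup>2 / c\<^sup>2" by (intro divide_right_mono power_mono t2) auto
        finally show "(u \<alpha> - f z \<alpha>)\<^sup>2 \<le> 1 / c\<^sup>2" by simp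
      qed
      also have "\<dots> = 1/16" using False by (simp add: c2)
      finally show ?thesis .
    qed simp
    ultimately show "\<exists>v\<in>f ` Z. (\<Sum>\<alpha><n. (u \<alpha> - v \<alpha>)\<^sup>2) \<le> 1/16" by blast
  qed
qed

definition bil :: "nat \<Rightarrow> (nat \<Rightarrow> nat \<Rightarrow> real) \<Rightarrow> (nat \<Rightarrow> real) \<Rightarrow> (nat \<Rightarrow> real) \<Rightarrow> real" where
  "bil n A u v = (\<Sum>\<alpha><n. \<Sum>\<beta><n. u \<alpha> * A \<alpha> \<beta> * v \<beta>)"

lemma bil_add: "bil n A (\<lambda>\<alpha>. u \<alpha> + u' \<alpha>) v = bil n A u v + bil n A u' v"
    "bil n A u (\<lambda>\<alpha>. v \<alpha> + v' \<alpha>) = bil n A u v + bil n A u v'"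
  and bil_diff: "bil n A (\<lambda>\<alpha>. u \<alpha> - u' \<alpha>) v = bil n A u v - bil n A u' v"
    "bil n A u (\<lambda>\<alpha>. v \<alpha> - v' \<alpha>) = bil n A u v - bil n A u v'"
  and bil_scale: "bil n A (\<lambda>\<alpha>. c * u \<alpha>) v = c * bil n A u v" "bil n A u (\<lambda>\<alpha>. c * v \<alpha>) = c * bil n A u v"
  unfolding bil_def by (simp_all add: algebra_simps sum.distrib sum_subtractf sum_distrib_left)

lemma bil_sym:
  assumes "\<And>\<alpha> \<beta>. \<alpha> < n \<Longrightarrow> \<beta> < n \<Longrightarrow> A \<alpha> \<beta> = A \<beta> \<alpha>"
  shows "bil n A u v = bil n A v u"
  unfolding bil_def using assms by (subst sum.swap) (auto intro!: sum.cong simp: mult_ac)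

text \<open>Polarization, applied to \<open>b u \<plusminus> a v\<close> where \<open>a\<close> and \<open>b\<close> are the norms of \<open>u\<close> and \<open>v\<close>, so that no vector has to be
normalized.\<close>

lemma bil_le_of_quadratic_form:
  assumes sym: "\<And>\<alpha> \<beta>. \<alpha> < n \<Longrightarrow> \<beta> < n \<Longrightarrow> A \<alpha> \<beta> = A \<beta> \<alpha>"
    and q: "\<And>u. \<bar>bil n A u u\<bar> \<le> q * (\<Sum>\<alpha><n. (u \<alpha>)\<^sup>2)"
  shows "\<bar>bil n A u v\<bar> \<le> q * (sqrt (\<Sum>\<alpha><n. (u \<alpha>)\<^sup>2) * sqrt (\<Sum>\<alpha><n. (v \<alpha>)\<^sup>2))"
proof -
  define a b where "a = sqrt (\<Sum>\<alpha><n. (u \<alpha>)\<^sup>2)" and "b = sqrt (\<Sum>\<alpha><n. (v \<alpha>)\<^sup>2)"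
  have a2: "(\<Sum>\<alpha><n. (u \<alpha>)\<^sup>2) = a\<^sup>2" "0 \<le> a" and b2: "(\<Sum>\<alpha><n. (v \<alpha>)\<^sup>2) = b\<^sup>2" "0 \<le> b"
    unfolding a_def b_def by (simp_all add: sum_nonneg)
  have zero: "bil n A u v = 0" if "a = 0 \<or> b = 0"
  proof -
    have "(\<Sum>\<alpha><n. (u \<alpha>)\<^sup>2) = 0 \<or> (\<Sum>\<alpha><n. (v \<alpha>)\<^sup>2) = 0"
      unfolding a2(1) b2(1) using that by auto
    then have "(\<forall>\<alpha><n. u \<alpha> = 0) \<or> (\<forall>\<alpha><n. v \<alpha> = 0)"
      by (subst (asm) (1 2) sum_nonneg_eq_0_iff) auto
    then show ?thesis by (auto simp: bil_def)
  qed
  have vu: "bil n A v u = bil n A u v" by (rule bil_sym) (rule sym)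
  have polar: "4 * (a * b) * bil n A u v = bil n A (\<lambda>\<alpha>. b * u \<alpha> + a * v \<alpha>) (\<lambda>\<alpha>. b * u \<alpha> + a * v \<alpha>)
      - bil n A (\<lambda>\<alpha>. b * u \<alpha> - a * v \<alpha>) (\<lambda>\<alpha>. b * u \<alpha> - a * v \<alpha>)"
    unfolding bil_add bil_diff bil_scale vu by (simp add: algebra_simps)
  have "(\<Sum>\<alpha><n. (b * u \<alpha> + a * v \<alpha>)\<^sup>2) + (\<Sum>\<alpha><n. (b * u \<alpha> - a * v \<alpha>)\<^sup>2)
      = (\<Sum>\<alpha><n. 2 * b\<^sup>2 * (u \<alpha>)\<^sup>2 + 2 * a\<^sup>2 * (v \<alpha>)\<^sup>2)"
    unfolding sum.distrib[symmetric] by (intro sum.cong refl) (simp add: power2_eq_square algebra_simps)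
  then have par: "(\<Sum>\<alpha><n. (b * u \<alpha> + a * v \<alpha>)\<^sup>2) + (\<Sum>\<alpha><n. (b * u \<alpha> - a * v \<alpha>)\<^sup>2) = 4 * ((a * b) * (a * b))"
    unfolding sum.distrib sum_distrib_left[symmetric] a2(1) b2(1) by (simp add: power2_eq_square)
  have "\<bar>4 * (a * b) * bil n A u v\<bar> \<le> q * (\<Sum>\<alpha><n. (b * u \<alpha> + a * v \<alpha>)\<^sup>2) + q * (\<Sum>\<alpha><n. (b * u \<alpha> - a * v \<alpha>)\<^sup>2)"
    unfolding polar using q[of "\<lambda>\<alpha>. b * u \<alpha> + a * v \<alpha>"] q[of "\<lambda>\<alpha>. b * u \<alpha> - a * v \<alpha>"] by linarith
  then have "\<bar>4 * (a * b) * bil n A u v\<bar> \<le> q * (4 * ((a * b) * (a * b)))"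
    unfolding distrib_left[symmetric] par .
  then have ab: "(a * b) * \<bar>bil n A u v\<bar> \<le> (a * b) * (q * (a * b))"
    using a2(2) b2(2) by (simp add: abs_mult mult_ac)
  have "\<bar>bil n A u v\<bar> \<le> q * (a * b)"
  proof (cases "a = 0 \<or> b = 0")
    case True then show ?thesis using zero by auto
  next
    case False
    then have "0 < a * b" using a2 b2 by simp
    then show ?thesis using mult_le_cancel_left_pos ab by blast
  qed
  then show ?thesis by (simp add: a_def b_def)
qed

text \<open>Let \<open>q\<close> be the supremum of the quadratic form on the unit ball. For \<open>u\<close> in the ball and a point \<open>v\<close> of the
net near it, \<open>A(u, u) - A(v, v) = A(u - v, u + v)\<close> is at most \<open>q * 1/4 * 2\<close>, hence \<open>q \<le> m + q/2\<close>.\<close>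

lemma bil_le_of_net:
  assumes sym: "\<And>\<alpha> \<beta>. \<alpha> < n \<Longrightarrow> \<beta> < n \<Longrightarrow> A \<alpha> \<beta> = A \<beta> \<alpha>"
    and T1: "\<And>v. v \<in> T \<Longrightarrow> (\<Sum>\<alpha><n. (v \<alpha>)\<^sup>2) \<le> 1"
    and T2: "\<And>u. (\<Sum>\<alpha><n. (u \<alpha>)\<^sup>2) \<le> 1 \<Longrightarrow> \<exists>v\<in>T. (\<Sum>\<alpha><n. (u \<alpha> - v \<alpha>)\<^sup>2) \<le> 1/16"
    and m: "\<And>v. v \<in> T \<Longrightarrow> \<bar>bil n A v v\<bar> \<le> m"
  shows "\<bar>bil n A u v\<bar> \<le> 2 * m * (sqrt (\<Sum>\<alpha><n. (u \<alpha>)\<^sup>2) * sqrt (\<Sum>\<alpha><n. (v \<alpha>)\<^sup>2))"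
proof -
  let ?n2 = "\<lambda>u. \<Sum>\<alpha><n. (u \<alpha> :: real)\<^sup>2"
  define S where "S = (\<lambda>u. \<bar>bil n A u u\<bar>) ` {u. ?n2 u \<le> 1}"
  define q where "q = Sup S"
  have ne: "S \<noteq> {}" unfolding S_def by (auto intro!: exI[of _ "\<lambda>_. 0"])
  have "\<bar>bil n A u u\<bar> \<le> (\<Sum>\<alpha><n. \<Sum>\<beta><n. \<bar>A \<alpha> \<beta>\<bar>)" if u: "?n2 u \<le> 1" for u
  proof -
    have u1: "\<bar>u \<alpha>\<bar> \<le> 1" if "\<alpha> < n" for \<alpha>
    proof -
      have "(u \<alpha>)\<^sup>2 \<le> ?n2 u" using that by (intro member_le_sum) auto
      then show ?thesis using u abs_square_le_1 by force
    qed
    have "\<bar>bil n A u u\<bar> \<le> (\<Sum>\<alpha><n. \<Sum>\<beta><n. \<bar>u \<alpha> * A \<alpha> \<beta> * u \<beta>\<bar>)"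
      unfolding bil_def by (rule order_trans[OF sum_abs]) (intro sum_mono sum_abs)
    also have "\<dots> \<le> (\<Sum>\<alpha><n. \<Sum>\<beta><n. \<bar>A \<alpha> \<beta>\<bar>)"
    proof (intro sum_mono)
      fix \<alpha> \<beta> assume "\<alpha> \<in> {..<n}" "\<beta> \<in> {..<n}"
      then have "\<bar>u \<alpha>\<bar> * \<bar>A \<alpha> \<beta>\<bar> * \<bar>u \<beta>\<bar> \<le> 1 * \<bar>A \<alpha> \<beta>\<bar> * 1" using u1 by (intro mult_mono) auto
      then show "\<bar>u \<alpha> * A \<alpha> \<beta> * u \<beta>\<bar> \<le> \<bar>A \<alpha> \<beta>\<bar>" by (simp add: abs_mult)
    qed
    finally show ?thesis .
  qed
  then have bdd: "bdd_above S" unfolding S_def by (auto intro!: bdd_aboveI2)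
  have q1: "\<bar>bil n A u u\<bar> \<le> q" if "?n2 u \<le> 1" for u
    unfolding q_def using that by (intro cSup_upper bdd) (auto simp: S_def)
  have qq: "\<bar>bil n A u u\<bar> \<le> q * ?n2 u" for u
  proof (cases "?n2 u = 0")
    case True
    then have "\<forall>\<alpha><n. u \<alpha> = 0" by (auto simp: sum_nonneg_eq_0_iff)
    then have "bil n A u u = 0" by (simp add: bil_def)
    then show ?thesis using True by simp
  next
    case False
    define c where "c = sqrt (?n2 u)"
    have c: "c\<^sup>2 = ?n2 u" "0 < c" using False unfolding c_def by (simp_all add: sum_nonneg order.not_eq_order_implies_strict)
    have "?n2 (\<lambda>\<alpha>. (1/c) * u \<alpha>) = (1/c)\<^sup>2 * ?n2 u" by (simp only: power_mult_distrib sum_distrib_left)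
    also have "\<dots> = 1" using c by (simp add: power_divide c(1)[symmetric])
    finally have "\<bar>bil n A (\<lambda>\<alpha>. (1/c) * u \<alpha>) (\<lambda>\<alpha>. (1/c) * u \<alpha>)\<bar> \<le> q" by (intro q1) simp
    then have "\<bar>bil n A u u\<bar> / c\<^sup>2 \<le> q" unfolding bil_scale by (simp add: abs_mult power2_eq_square)
    then show ?thesis unfolding c(1)[symmetric] using c(2) by (simp add: pos_divide_le_eq)
  qed
  note B = bil_le_of_quadratic_form[OF sym qq]
  have q0: "0 \<le> q" using q1[of "\<lambda>_. 0"] by simp
  have "Sup S \<le> m + q / 2"
  proof (rule cSup_least[OF ne])
    fix t assume "t \<in> S"
    then obtain u where u: "?n2 u \<le> 1" "t = \<bar>bil n A u u\<bar>" by (auto simp: S_def)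
    obtain v where v: "v \<in> T" "?n2 (\<lambda>\<alpha>. u \<alpha> - v \<alpha>) \<le> 1/16" using T2[OF u(1)] by auto
    have "?n2 (\<lambda>\<alpha>. u \<alpha> + v \<alpha>) \<le> (\<Sum>\<alpha><n. 2 * (u \<alpha>)\<^sup>2 + 2 * (v \<alpha>)\<^sup>2)"
    proof (rule sum_mono)
      fix \<alpha> have "0 \<le> (u \<alpha> - v \<alpha>)\<^sup>2" by simp
      then show "(u \<alpha> + v \<alpha>)\<^sup>2 \<le> 2 * (u \<alpha>)\<^sup>2 + 2 * (v \<alpha>)\<^sup>2" by (simp add: power2_eq_square algebra_simps)
    qed
    also have "\<dots> \<le> 4" using u(1) T1[OF v(1)] by (simp add: sum.distrib sum_distrib_left[symmetric])
    finally have w: "sqrt (?n2 (\<lambda>\<alpha>. u \<alpha> + v \<alpha>)) \<le> 2" by (intro real_le_lsqrt) (auto intro: sum_nonneg)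
    have d: "sqrt (?n2 (\<lambda>\<alpha>. u \<alpha> - v \<alpha>)) \<le> 1/4" using v(2) by (intro real_le_lsqrt) (auto intro: sum_nonneg simp: power_divide)
    have vu: "bil n A v u = bil n A u v" by (rule bil_sym) (rule sym)
    have diff: "bil n A u u - bil n A v v = bil n A (\<lambda>\<alpha>. u \<alpha> - v \<alpha>) (\<lambda>\<alpha>. u \<alpha> + v \<alpha>)"
      unfolding bil_add bil_diff vu by simp
    have "\<bar>bil n A u u - bil n A v v\<bar> \<le> q * (1/4 * 2)"
    proof -
      have "sqrt (?n2 (\<lambda>\<alpha>. u \<alpha> - v \<alpha>)) * sqrt (?n2 (\<lambda>\<alpha>. u \<alpha> + v \<alpha>)) \<le> 1/4 * 2"
        by (rule mult_mono[OF d w]) (simp_all add: sum_nonneg)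
      from mult_left_mono[OF this q0] show ?thesis
        unfolding diff using B[of "\<lambda>\<alpha>. u \<alpha> - v \<alpha>" "\<lambda>\<alpha>. u \<alpha> + v \<alpha>"] by linarith
    qed
    then show "t \<le> m + q / 2" using m[OF v(1)] u(2) by linarith
  qed
  then have qm: "q \<le> 2 * m" by (simp add: q_def)
  have "0 \<le> sqrt (?n2 u) * sqrt (?n2 v)" by (simp add: sum_nonneg)
  from mult_right_mono[OF qm this] show ?thesis using B[of u v] by linarith
qed

section \<open>Concentration of the sample kernel matrix\<close>

lemma integrable_mult_of_squares:
  fixes f g :: "'a \<Rightarrow> real"
  assumes [measurable]: "f \<in> borel_measurable M" "g \<in> borel_measurable M"
    and "integrable M (\<lambda>x. (f x)\<^sup>2)" "integrable M (\<lambda>x. (g x)\<^sup>2)"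
  shows "integrable M (\<lambda>x. f x * g x)"
proof (rule Bochner_Integration.integrable_bound)
  show "integrable M (\<lambda>x. (f x)\<^sup>2 + (g x)\<^sup>2)" using assms by simp
  show "AE x in M. norm (f x * g x) \<le> norm ((f x)\<^sup>2 + (g x)\<^sup>2)"
  proof (intro always_eventually allI)
    fix x
    have "0 \<le> (\<bar>f x\<bar> - \<bar>g x\<bar>)\<^sup>2" by simp
    then have "2 * (\<bar>f x\<bar> * \<bar>g x\<bar>) \<le> (f x)\<^sup>2 + (g x)\<^sup>2" by (simp add: power2_eq_square algebra_simps)
    moreover have "0 \<le> \<bar>f x\<bar> * \<bar>g x\<bar>" by simp
    ultimately have "\<bar>f x\<bar> * \<bar>g x\<bar> \<le> (f x)\<^sup>2 + (g x)\<^sup>2" by linarith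
    then show "norm (f x * g x) \<le> norm ((f x)\<^sup>2 + (g x)\<^sup>2)" by (simp add: abs_mult)
  qed
qed simp

definition mean_kernel :: "(real \<Rightarrow> real) \<Rightarrow> 'j set \<Rightarrow> (nat \<Rightarrow> 'j \<Rightarrow> real) \<Rightarrow> nat \<Rightarrow> nat \<Rightarrow> real" where
  "mean_kernel \<sigma> J x \<alpha> \<beta> = (\<integral>w. \<sigma> (ip J (x \<alpha>) w) * \<sigma> (ip J (x \<beta>) w) \<partial>std_gaussian J)"

definition sample_kernel :: "(real \<Rightarrow> real) \<Rightarrow> 'j set \<Rightarrow> (nat \<Rightarrow> 'j \<Rightarrow> real) \<Rightarrow> nat \<Rightarrow> (nat \<times> 'j \<Rightarrow> real) \<Rightarrow> nat \<Rightarrow> nat \<Rightarrow> real" where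
  "sample_kernel \<sigma> J x m w \<alpha> \<beta> = (1 / real m) * (\<Sum>i<m. \<sigma> (ip J (x \<alpha>) (row_of J w i)) * \<sigma> (ip J (x \<beta>) (row_of J w i)))"

lemma feature_square: "(feature \<sigma> J {..<n} x v w)\<^sup>2 = bil n (\<lambda>\<alpha> \<beta>. \<sigma> (ip J (x \<alpha>) w) * \<sigma> (ip J (x \<beta>) w)) v v"
  unfolding feature_def bil_def power2_eq_square sum_product by (intro sum.cong refl) (simp add: mult_ac)

lemma mean_kernel_bil:
  assumes L: "L-lipschitz_on UNIV \<sigma>" and J: "finite J"
  shows "bil n (mean_kernel \<sigma> J x) v v = (\<integral>w. (feature \<sigma> J {..<n} x v w)\<^sup>2 \<partial>std_gaussian J)"
proof -
  note [measurable] = lipschitz_measurable[OF L]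
  have int: "integrable (std_gaussian J) (\<lambda>w. \<sigma> (ip J (x \<alpha>) w) * \<sigma> (ip J (x \<beta>) w))" for \<alpha> \<beta>
    by (intro integrable_mult_of_squares feature_integrable(1)[OF L J]) simp_all
  show ?thesis
    unfolding feature_square bil_def mean_kernel_def
    by (subst Bochner_Integration.integral_sum, intro Bochner_Integration.integrable_sum integrable_mult_left integrable_mult_right int)
       (subst Bochner_Integration.integral_sum, auto intro!: integrable_mult_left integrable_mult_right int)
qed

lemma sample_kernel_bil:
  "bil n (sample_kernel \<sigma> J x m w) v v = (1 / real m) * (\<Sum>i<m. (feature \<sigma> J {..<n} x v (row_of J w i))\<^sup>2)"
proof -
  have "(\<Sum>i<m. (feature \<sigma> J {..<n} x v (row_of J w i))\<^sup>2) =
      (\<Sum>\<alpha><n. \<Sum>i<m. \<Sum>\<beta><n. v \<alpha> * (\<sigma> (ip J (x \<alpha>) (row_of J w i)) * \<sigma> (ip J (x \<beta>) (row_of J w i))) * v \<beta>)"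
    unfolding feature_square bil_def by (rule sum.swap)
  also have "\<dots> = (\<Sum>\<alpha><n. \<Sum>\<beta><n. \<Sum>i<m. v \<alpha> * (\<sigma> (ip J (x \<alpha>) (row_of J w i)) * \<sigma> (ip J (x \<beta>) (row_of J w i))) * v \<beta>)"
    by (intro sum.cong refl sum.swap)
  finally show ?thesis
    unfolding bil_def sample_kernel_def by (simp add: sum_distrib_left sum_distrib_right mult_ac)
qed

text \<open>The deviation \<open>s\<close> with \<open>s\<^sup>2 = 1920 n / m\<close> makes the tail of \<open>rows_bernstein\<close> equal to \<open>2 exp (- 20 n)\<close>; against the
\<open>exp (18 n)\<close> points of the net this leaves \<open>2 exp (- 2 n)\<close>. The bound on \<open>n / m\<close> ensures \<open>s \<le> 24\<close>.\<close>

lemma kernel_concentration: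
  fixes x :: "nat \<Rightarrow> 'j \<Rightarrow> real"
  assumes L: "L-lipschitz_on UNIV \<sigma>" and pos: "0 < L" "0 < V"
    and mean: "(\<integral>t. \<sigma> t \<partial>N) = 0" and J: "finite J"
    and V: "op_bound J {..<n} x V"
    and nrm: "(\<Sum>\<alpha><n. (sqrt (\<Sum>i\<in>J. (x \<alpha> i)\<^sup>2) - 1)\<^sup>2) \<le> V\<^sup>2"
    and n: "0 < n" and m: "0 < m" "real n / real m \<le> 3/10"
  defines "W \<equiv> std_gaussian ({..<m} \<times> J)"
  obtains G where "G \<in> sets W" "measure W G \<ge> 1 - 2 * exp (- 2 * real n)"
    "\<And>w u v. w \<in> G \<Longrightarrow> \<bar>bil n (\<lambda>\<alpha> \<beta>. sample_kernel \<sigma> J x m w \<alpha> \<beta> - mean_kernel \<sigma> J x \<alpha> \<beta>) u v\<bar>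
       \<le> 2 * (sqrt 1920 / moment_rate L V * sqrt (real n / real m)) * (sqrt (\<Sum>\<alpha><n. (u \<alpha>)\<^sup>2) * sqrt (\<Sum>\<alpha><n. (v \<alpha>)\<^sup>2))"
proof -
  interpret W: prob_space W unfolding W_def by (rule prob_space_std_gaussian)
  interpret GJ: prob_space "std_gaussian J" by (rule prob_space_std_gaussian)
  note [measurable] = lipschitz_measurable[OF L]
  define \<kappa> where "\<kappa> = moment_rate L V"
  have \<kappa>: "0 < \<kappa>" using pos by (simp add: \<kappa>_def moment_rate_def)
  define s where "s = sqrt (1920 * (real n / real m))"
  have s2: "s\<^sup>2 = 1920 * (real n / real m)" by (simp add: s_def)
  have s0: "0 < s" using n m by (simp add: s_def)
  have "s \<le> sqrt (24\<^sup>2)" unfolding s_def using m(2) by (intro real_sqrt_le_mono) simp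
  then have s24: "s \<le> 24" by simp
  obtain T :: "(nat \<Rightarrow> real) set" where T: "finite T" "real (card T) \<le> exp (18 * real n)"
    "\<And>v. v \<in> T \<Longrightarrow> (\<Sum>\<alpha><n. (v \<alpha>)\<^sup>2) \<le> 1"
    "\<And>u. (\<Sum>\<alpha><n. (u \<alpha>)\<^sup>2) \<le> 1 \<Longrightarrow> \<exists>v\<in>T. (\<Sum>\<alpha><n. (u \<alpha> - v \<alpha>)\<^sup>2) \<le> 1/16"
    using ball_net[of n] by blast
  define F where "F = feature \<sigma> J {..<n} x"
  have [measurable]: "F v \<in> borel_measurable (std_gaussian J)" for v unfolding F_def by measurable
  define Q where "Q v w = \<kappa> * (F v w)\<^sup>2" for v w
  have [measurable]: "Q v \<in> borel_measurable (std_gaussian J)" for v unfolding Q_def by measurable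
  define e where "e v = (\<integral>w. Q v w \<partial>std_gaussian J)" for v
  define Bad where "Bad v = {w \<in> space W. real m * s \<le> \<bar>\<Sum>i<m. Q v (row_of J w i) - e v\<bar>}" for v
  have bad: "measure W (Bad v) \<le> 2 * exp (- 20 * real n)" if "v \<in> T" for v
  proof -
    have E: "(\<integral>\<^sup>+w. ennreal (exp (Q v w)) \<partial>std_gaussian J) \<le> 6"
      unfolding Q_def F_def \<kappa>_def by (rule feature_exp_moment[OF L pos mean J _ V T(3)[OF that] nrm]) simp
    have "measure W (Bad v) \<le> 2 * exp (- real m * s\<^sup>2 / 96)"
      unfolding Bad_def W_def e_def by (rule rows_bernstein[OF J _ _ E s0 s24]) (simp_all add: Q_def \<kappa> less_imp_le)
    also have "- real m * s\<^sup>2 / 96 = - 20 * real n" using m by (simp add: s2)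
    finally show ?thesis .
  qed
  have Bad_sets: "Bad v \<in> sets W" for v
  proof -
    have [measurable]: "(\<lambda>w. Q v (row_of J w i)) \<in> borel_measurable W" if "i < m" for i
      unfolding W_def by (rule measurable_compose[OF measurable_row_of[OF that]]) simp
    have [measurable]: "(\<lambda>w. \<Sum>i<m. Q v (row_of J w i) - e v) \<in> borel_measurable W"
      by (intro borel_measurable_sum borel_measurable_diff) auto
    show ?thesis unfolding Bad_def by measurable
  qed
  define G where "G = space W - (\<Union>v\<in>T. Bad v)"
  show thesis
  proof (rule that[of G])
    show "G \<in> sets W" unfolding G_def using T(1) Bad_sets by (intro sets.Diff sets.finite_UN) auto
    have "measure W (\<Union>v\<in>T. Bad v) \<le> (\<Sum>v\<in>T. measure W (Bad v))"
      using T(1) Bad_sets by (intro W.finite_measure_subadditive_finite) auto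
    also have "\<dots> \<le> (\<Sum>v\<in>T. 2 * exp (- 20 * real n))" by (intro sum_mono bad)
    also have "\<dots> = real (card T) * (2 * exp (- 20 * real n))" by simp
    also have "\<dots> \<le> exp (18 * real n) * (2 * exp (- 20 * real n))" by (intro mult_right_mono T(2)) simp
    also have "\<dots> = 2 * exp (- 2 * real n)" by (simp add: exp_add[symmetric])
    finally have U: "measure W (\<Union>v\<in>T. Bad v) \<le> 2 * exp (- 2 * real n)" .
    have "measure W G = 1 - measure W (\<Union>v\<in>T. Bad v)"
      unfolding G_def using T(1) Bad_sets by (intro W.prob_compl sets.finite_UN) auto
    then show "measure W G \<ge> 1 - 2 * exp (- 2 * real n)" using U by linarith
  next
    fix w u v assume w: "w \<in> G"
    let ?A = "\<lambda>\<alpha> \<beta>. sample_kernel \<sigma> J x m w \<alpha> \<beta> - mean_kernel \<sigma> J x \<alpha> \<beta>"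
    have net: "\<bar>bil n ?A z z\<bar> \<le> s / \<kappa>" if "z \<in> T" for z
    proof -
      have "w \<notin> Bad z" "w \<in> space W" using w that by (auto simp: G_def)
      then have lt: "\<bar>\<Sum>i<m. Q z (row_of J w i) - e z\<bar> \<le> real m * s" by (simp add: Bad_def)
      have "bil n ?A z z = bil n (sample_kernel \<sigma> J x m w) z z - bil n (mean_kernel \<sigma> J x) z z"
        unfolding bil_def by (simp add: algebra_simps sum_subtractf)
      also have "\<dots> = (1 / real m) * (\<Sum>i<m. (F z (row_of J w i))\<^sup>2) - (\<integral>w. (F z w)\<^sup>2 \<partial>std_gaussian J)"
        unfolding sample_kernel_bil mean_kernel_bil[OF L J] F_def ..
      also have "\<dots> = (\<Sum>i<m. Q z (row_of J w i) - e z) / (\<kappa> * real m)"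
        using \<kappa> m by (simp add: Q_def e_def sum_subtractf sum_distrib_left[symmetric] diff_divide_distrib)
      finally have "\<bar>bil n ?A z z\<bar> = \<bar>\<Sum>i<m. Q z (row_of J w i) - e z\<bar> / (\<kappa> * real m)"
        using \<kappa> by (simp add: abs_mult)
      also have "\<dots> \<le> (real m * s) / (\<kappa> * real m)" using \<kappa> by (intro divide_right_mono lt) simp
      also have "\<dots> = s / \<kappa>" using m by simp
      finally show ?thesis .
    qed
    have "\<bar>bil n ?A u v\<bar> \<le> 2 * (s / \<kappa>) * (sqrt (\<Sum>\<alpha><n. (u \<alpha>)\<^sup>2) * sqrt (\<Sum>\<alpha><n. (v \<alpha>)\<^sup>2))"
      by (rule bil_le_of_net[OF _ T(3,4) net]) (simp_all add: sample_kernel_def mean_kernel_def mult.commute)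
    moreover have "s / \<kappa> = sqrt 1920 / moment_rate L V * sqrt (real n / real m)"
      unfolding s_def \<kappa>_def real_sqrt_mult by simp
    ultimately show "\<bar>bil n ?A u v\<bar> \<le> 2 * (sqrt 1920 / moment_rate L V * sqrt (real n / real m)) * (sqrt (\<Sum>\<alpha><n. (u \<alpha>)\<^sup>2) * sqrt (\<Sum>\<alpha><n. (v \<alpha>)\<^sup>2))"
      by simp
  qed
qed

section \<open>Hermite polynomials\<close>

fun hermite :: "nat \<Rightarrow> real poly" where
  "hermite 0 = 1"
| "hermite (Suc 0) = [:0, 1:]"
| "hermite (Suc (Suc k)) = [:0, 1:] * hermite (Suc k) - Polynomial.smult (real (Suc k)) (hermite k)"

lemma hermite_Suc: "hermite (Suc k) = [:0, 1:] * hermite k - Polynomial.smult (real k) (hermite (k - 1))"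
  by (cases k) simp_all

lemma pderiv_hermite: "pderiv (hermite (Suc k)) = Polynomial.smult (real (Suc k)) (hermite k)"
proof (induction k rule: less_induct)
  case (less k)
  show ?case
  proof (cases k)
    case 0
    then show ?thesis by (simp add: pderiv_pCons)
  next
    case (Suc j)
    have 1: "pderiv (hermite (Suc j)) = Polynomial.smult (real (Suc j)) (hermite j)" using less[of j] Suc by simp
    have 2: "pderiv (hermite j) = Polynomial.smult (real j) (hermite (j - 1))"
      using less[of "j - 1"] Suc by (cases j) simp_all
    have "pderiv (hermite (Suc k)) = hermite (Suc j) + [:0, 1:] * Polynomial.smult (real (Suc j)) (hermite j)
        - Polynomial.smult (real (Suc j)) (Polynomial.smult (real j) (hermite (j - 1)))"
      unfolding Suc hermite.simps(3) pderiv_diff pderiv_mult pderiv_smult 1 2 by (simp add: pderiv_pCons)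
    also have "\<dots> = hermite (Suc j) + Polynomial.smult (real (Suc j)) (hermite (Suc j))"
      unfolding hermite_Suc[of j] by (simp add: smult_diff_right mult_smult_right)
    also have "\<dots> = Polynomial.smult (1 + real (Suc j)) (hermite (Suc j))"
      unfolding smult_add_left by simp
    also have "\<dots> = Polynomial.smult (real (Suc k)) (hermite k)" by (simp add: Suc)
    finally show ?thesis .
  qed
qed

lemma degree_hermite: "degree (hermite k) = k \<and> lead_coeff (hermite k) = 1"
proof (induction k rule: hermite.induct)
  case (3 k)
  let ?q = "Polynomial.smult (real (Suc k)) (hermite k)"
  have d: "degree (hermite (Suc k)) = Suc k" "degree (hermite k) = k" using 3 by blast+
  have l: "coeff (hermite (Suc k)) (Suc k) = 1" using 3 by metis
  have h: "hermite (Suc (Suc k)) = pCons 0 (hermite (Suc k)) - ?q" by simp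
  have q0: "coeff ?q (Suc (Suc k)) = 0" using d by (intro coeff_eq_0) (simp add: less_Suc_eq_le)
  have c: "coeff (hermite (Suc (Suc k))) (Suc (Suc k)) = 1" unfolding h coeff_diff q0 using l by simp
  have "degree (hermite (Suc (Suc k))) \<le> Suc (Suc k)"
    unfolding h using d by (intro degree_diff_le) (auto intro: order_trans[OF degree_pCons_le])
  then have "degree (hermite (Suc (Suc k))) = Suc (Suc k)" using c by (metis antisym le_degree zero_neq_one)
  with c show ?case by metis
qed simp_all

lemma integrable_poly_N: "integrable N (poly p)"
proof -
  have "poly p = (\<lambda>x. \<Sum>i\<le>degree p. coeff p i * x ^ i)" by (auto simp: poly_altdef)
  then show ?thesis by (simp del: integrable_density)
qed

lemma integrable_N_if_poly:
  assumes "\<And>x. f x = poly p x"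
  shows "integrable N f"
proof -
  have "f = poly p" using assms by auto
  then show ?thesis by (simp add: integrable_poly_N)
qed

lemma gaussian_moment_step: "(\<integral>x. x ^ Suc (Suc k) \<partial>N) = real (Suc k) * (\<integral>x. x ^ k \<partial>N)"
proof (cases "even k")
  case True
  then obtain j where k: "k = 2 * j" by (elim evenE)
  then have k': "Suc (Suc k) = 2 * Suc j" by simp
  have "fact (2 * Suc j) = (2 * real (Suc j)) * (real (Suc (2 * j)) * fact (2 * j))" by (simp add: algebra_simps)
  then have "fact (2 * Suc j) / (2 ^ Suc j * fact (Suc j)) = real (Suc (2 * j)) * (fact (2 * j) / (2 ^ j * fact j))"
    by (simp add: divide_simps)
  then show ?thesis
    unfolding k' unfolding k std_normal_distribution_even_moments(1) .
next
  case False
  then show ?thesis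
    using integral_std_normal_distribution_moment_odd[of k] integral_std_normal_distribution_moment_odd[of "Suc (Suc k)"]
    by (simp del: power_Suc)
qed

text \<open>Gaussian integration by parts. On monomials it is the recursion of the moments.\<close>

lemma gaussian_stein: "(\<integral>x. x * poly p x \<partial>N) = (\<integral>x. poly (pderiv p) x \<partial>N)"
proof -
  have mono: "(\<integral>x. x * poly (monom a i) x \<partial>N) = (\<integral>x. poly (pderiv (monom a i)) x \<partial>N)" for a i
  proof (cases i)
    case 0
    then show ?thesis using integral_std_normal_distribution_moment_odd[of 1] by (simp add: poly_monom pderiv_monom)
  next
    case (Suc j)
    have "(\<integral>x. x * poly (monom a i) x \<partial>N) = (\<integral>x. a * x ^ Suc (Suc j) \<partial>N)"
      by (simp add: poly_monom Suc mult_ac)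
    also have "\<dots> = a * (real (Suc j) * (\<integral>x. x ^ j \<partial>N))" by (simp only: gaussian_moment_step integral_mult_right_zero)
    also have "\<dots> = (\<integral>x. poly (pderiv (monom a i)) x \<partial>N)" by (simp add: Suc pderiv_monom poly_monom)
    finally show ?thesis .
  qed
  have int: "integrable N (\<lambda>x. x * poly q x)" for q
    by (rule integrable_N_if_poly[of _ "[:0, 1:] * q"]) simp
  have "(\<integral>x. x * poly (\<Sum>i\<in>S. monom (c i) i) x \<partial>N) = (\<integral>x. poly (pderiv (\<Sum>i\<in>S. monom (c i) i)) x \<partial>N)"
    if "finite S" for S :: "nat set" and c
    using that
  proof (induction S rule: finite_induct)
    case (insert i S)
    let ?p = "monom (c i) i" and ?q = "\<Sum>i\<in>S. monom (c i) i"
    have "(\<integral>x. x * poly (?p + ?q) x \<partial>N) = (\<integral>x. x * poly ?p x \<partial>N) + (\<integral>x. x * poly ?q x \<partial>N)"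
      unfolding poly_add distrib_left using int by (rule Bochner_Integration.integral_add) (rule int)
    also have "\<dots> = (\<integral>x. poly (pderiv ?p) x \<partial>N) + (\<integral>x. poly (pderiv ?q) x \<partial>N)"
      using insert mono[of "c i" i] by simp
    also have "\<dots> = (\<integral>x. poly (pderiv (?p + ?q)) x \<partial>N)"
      unfolding pderiv_add poly_add by (rule Bochner_Integration.integral_add[symmetric]) (rule integrable_poly_N)+
    finally show ?case using insert by simp
  qed simp
  from this[of "{..degree p}" "coeff p"] show ?thesis by (simp add: poly_as_sum_of_monoms)
qed

text \<open>Hermite polynomials are eigenfunctions of the Ornstein-Uhlenbeck semigroup. The recursion of the polynomials
turns into the same recursion for the left-hand side: integration by parts in \<open>y\<close> contributes
\<open>s\<^sup>2 k\<close>, and \<open>1 - s\<^sup>2 = \<rho>\<^sup>2\<close>.\<close>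

lemma hermite_mehler:
  assumes "\<rho>\<^sup>2 + s\<^sup>2 = 1"
  shows "(\<integral>y. poly (hermite k) (\<rho> * x + s * y) \<partial>N) = \<rho> ^ k * poly (hermite k) x"
proof (induction k rule: hermite.induct)
  case 1
  show ?case using N.prob_space by simp
next
  case 2
  have "integrable N (\<lambda>y. y)" using integrable_N_power[of 1] by simp
  then show ?case using N.prob_space integral_std_normal_distribution_moment_odd[of 1] by simp
next
  case (3 k)
  define l where "l = [:\<rho> * x, s:]"
  have l: "\<rho> * x + s * y = poly l y" for y by (simp add: l_def)
  have int: "integrable N (\<lambda>y. poly p (poly l y))" for p
    by (rule integrable_N_if_poly[of _ "pcompose p l"]) (simp add: poly_pcompose)
  have int': "integrable N (\<lambda>y. y * poly p (poly l y))" for p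
    by (rule integrable_N_if_poly[of _ "[:0, 1:] * pcompose p l"]) (simp add: poly_pcompose)
  have stein: "(\<integral>y. y * poly (hermite (Suc k)) (poly l y) \<partial>N) = s * real (Suc k) * (\<integral>y. poly (hermite k) (poly l y) \<partial>N)"
  proof -
    have "(\<integral>y. y * poly (hermite (Suc k)) (poly l y) \<partial>N) = (\<integral>y. poly (pderiv (pcompose (hermite (Suc k)) l)) y \<partial>N)"
      using gaussian_stein[of "pcompose (hermite (Suc k)) l"] by (simp add: poly_pcompose)
    also have "\<dots> = (\<integral>y. s * real (Suc k) * poly (hermite k) (poly l y) \<partial>N)"
      unfolding pderiv_pcompose pderiv_hermite by (simp add: poly_pcompose l_def pderiv_pCons mult_ac)
    finally show ?thesis by simp
  qed
  have "(\<integral>y. poly (hermite (Suc (Suc k))) (poly l y) \<partial>N)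
      = (\<integral>y. \<rho> * x * poly (hermite (Suc k)) (poly l y) + s * (y * poly (hermite (Suc k)) (poly l y))
           - real (Suc k) * poly (hermite k) (poly l y) \<partial>N)"
    by (intro Bochner_Integration.integral_cong refl) (simp add: l[symmetric] algebra_simps)
  also have "\<dots> = \<rho> * x * (\<integral>y. poly (hermite (Suc k)) (poly l y) \<partial>N) + s * (\<integral>y. y * poly (hermite (Suc k)) (poly l y) \<partial>N)
           - real (Suc k) * (\<integral>y. poly (hermite k) (poly l y) \<partial>N)"
    using int int' by simp
  also have "\<dots> = \<rho> * x * (\<rho> ^ Suc k * poly (hermite (Suc k)) x) - (1 - s\<^sup>2) * real (Suc k) * (\<rho> ^ k * poly (hermite k) x)"
    unfolding stein using 3 unfolding l by (simp add: algebra_simps power2_eq_square)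
  also have "1 - s\<^sup>2 = \<rho>\<^sup>2" using assms by simp
  also have "\<rho> * x * (\<rho> ^ Suc k * poly (hermite (Suc k)) x) - \<rho>\<^sup>2 * real (Suc k) * (\<rho> ^ k * poly (hermite k) x)
     = \<rho> ^ Suc (Suc k) * poly (hermite (Suc (Suc k))) x"
    by (simp add: algebra_simps power2_eq_square)
  finally show ?case unfolding l .
qed

lemma hermite_integrate_by_parts:
  "(\<integral>x. poly (hermite (Suc k)) x * poly q x \<partial>N) = (\<integral>x. poly (hermite k) x * poly (pderiv q) x \<partial>N)"
proof -
  have int: "integrable N (\<lambda>x. poly p x * poly r x)" for p r
    by (rule integrable_N_if_poly[of _ "p * r"]) simp
  have 2: "pderiv (hermite k) = Polynomial.smult (real k) (hermite (k - 1))"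
    using pderiv_hermite[of "k - 1"] by (cases k) simp_all
  have "(\<integral>x. poly (hermite (Suc k)) x * poly q x \<partial>N)
     = (\<integral>x. x * poly (hermite k * q) x - real k * (poly (hermite (k - 1)) x * poly q x) \<partial>N)"
    by (intro Bochner_Integration.integral_cong refl) (simp add: hermite_Suc[of k] algebra_simps)
  also have "\<dots> = (\<integral>x. x * poly (hermite k * q) x \<partial>N) - real k * (\<integral>x. poly (hermite (k - 1)) x * poly q x \<partial>N)"
  proof -
    have "integrable N (\<lambda>x. x * poly (hermite k * q) x)"
      by (rule integrable_N_if_poly[of _ "[:0, 1:] * (hermite k * q)"]) simp
    then show ?thesis using int[of "hermite (k - 1)" q] by simp
  qed
  also have "(\<integral>x. x * poly (hermite k * q) x \<partial>N) = (\<integral>x. poly (hermite k) x * poly (pderiv q) x + real k * (poly (hermite (k - 1)) x * poly q x) \<partial>N)"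
    unfolding gaussian_stein pderiv_mult 2 by (intro Bochner_Integration.integral_cong refl) (simp add: algebra_simps)
  also have "\<dots> = (\<integral>x. poly (hermite k) x * poly (pderiv q) x \<partial>N) + real k * (\<integral>x. poly (hermite (k - 1)) x * poly q x \<partial>N)"
    using int by simp
  finally show ?thesis by simp
qed

lemma hermite_orthogonal:
  "(\<integral>x. poly (hermite j) x * poly (hermite k) x \<partial>N) = (if j = k then fact k else 0)"
proof (induction j arbitrary: k)
  case 0
  show ?case
  proof (cases k)
    case 0
    then show ?thesis using N.prob_space by simp
  next
    case (Suc i)
    then show ?thesis using hermite_integrate_by_parts[where q = 1] by simp
  qed
next
  case (Suc j)
  show ?case
  proof (cases k)
    case 0
    then show ?thesis using hermite_integrate_by_parts[where q = 1] by simp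
  next
    case (Suc i)
    have "(\<integral>x. poly (hermite (Suc j)) x * poly (hermite (Suc i)) x \<partial>N)
        = real (Suc i) * (\<integral>x. poly (hermite j) x * poly (hermite i) x \<partial>N)"
      unfolding hermite_integrate_by_parts pderiv_hermite by (simp add: mult.left_commute)
    then show ?thesis unfolding Suc Suc.IH by simp
  qed
qed

section \<open>A lower bound on the expected kernel matrix\<close>

text \<open>Writing \<open>\<langle>w, b\<rangle> = \<rho> \<langle>w, a\<rangle> + r \<eta>\<close> with an independent standard normal \<open>\<eta>\<close>, the integral over \<open>\<eta>\<close> is
evaluated by \<open>hermite_mehler\<close>.\<close>

lemma hermite_correlation:
  fixes a b :: "'i \<Rightarrow> real" and f :: "real \<Rightarrow> real"
  assumes J: "finite J" and a: "(\<Sum>i\<in>J. (a i)\<^sup>2) = 1" and b: "(\<Sum>i\<in>J. (b i)\<^sup>2) = 1"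
    and f[measurable]: "f \<in> borel_measurable borel" and f2: "integrable N (\<lambda>x. (f x)\<^sup>2)"
  shows "integrable (std_gaussian J) (\<lambda>w. f (ip J a w) * poly (hermite k) (ip J b w))"
    "(\<integral>w. f (ip J a w) * poly (hermite k) (ip J b w) \<partial>std_gaussian J)
      = (\<Sum>i\<in>J. a i * b i) ^ k * (\<integral>x. f x * poly (hermite k) x \<partial>N)"
proof -
  let ?h = "poly (hermite k)"
  have cont: "continuous_on UNIV ?h" by (intro continuous_intros)
  have h[measurable]: "?h \<in> borel_measurable borel" by (rule borel_measurable_continuous_onI[OF cont])
  have h2: "integrable N (\<lambda>x. (?h x)\<^sup>2)"
    by (rule integrable_N_if_poly[of _ "(hermite k)\<^sup>2"]) simp
  have 1: "integrable (std_gaussian J) (\<lambda>w. (f (ip J a w))\<^sup>2)"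
    unfolding ip_def using integrable_std_gaussian_linear[OF J, of "\<lambda>t. (f t)\<^sup>2" a] f2 a by simp
  have 2: "integrable (std_gaussian J) (\<lambda>w. (?h (ip J b w))\<^sup>2)"
    unfolding ip_def using integrable_std_gaussian_linear[OF J, of "\<lambda>t. (?h t)\<^sup>2" b] h2 b by simp
  show int: "integrable (std_gaussian J) (\<lambda>w. f (ip J a w) * ?h (ip J b w))"
    by (rule integrable_mult_of_squares[OF _ _ 1 2]) simp_all
  obtain p q r where p: "0 \<le> p" "p\<^sup>2 = (\<Sum>i\<in>J. (a i)\<^sup>2)" and pq: "p * q = (\<Sum>i\<in>J. a i * b i)"
    and qr: "q\<^sup>2 + r\<^sup>2 = (\<Sum>i\<in>J. (b i)\<^sup>2)" and
    D: "distr (std_gaussian J) (borel \<Otimes>\<^sub>M borel) (\<lambda>w. (\<Sum>i\<in>J. a i * w i, \<Sum>i\<in>J. b i * w i))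
     = distr (N \<Otimes>\<^sub>M N) (borel \<Otimes>\<^sub>M borel) (\<lambda>(x, y). (p * x, q * x + r * y))"
    by (rule std_gaussian_pair_distr[OF J])
  have "p = 1" using p a by (simp add: power2_eq_1_iff)
  then have q: "q = (\<Sum>i\<in>J. a i * b i)" using pq by simp
  have qr1: "q\<^sup>2 + r\<^sup>2 = 1" using qr b by simp
  let ?g = "\<lambda>z. f (fst z) * ?h (snd z)"
  have g[measurable]: "?g \<in> borel_measurable (borel \<Otimes>\<^sub>M borel)" by measurable
  have "integrable (distr (std_gaussian J) (borel \<Otimes>\<^sub>M borel) (\<lambda>w. (\<Sum>i\<in>J. a i * w i, \<Sum>i\<in>J. b i * w i))) ?g"
    using int by (subst integrable_distr_eq) (simp_all add: ip_def)
  then have int2: "integrable (N \<Otimes>\<^sub>M N) (\<lambda>z. f (fst z) * ?h (q * fst z + r * snd z))"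
    unfolding D \<open>p = 1\<close> by (subst (asm) integrable_distr_eq) (simp_all add: split_beta)
  have "(\<integral>w. f (ip J a w) * ?h (ip J b w) \<partial>std_gaussian J)
      = (\<integral>z. ?g z \<partial>distr (std_gaussian J) (borel \<Otimes>\<^sub>M borel) (\<lambda>w. (\<Sum>i\<in>J. a i * w i, \<Sum>i\<in>J. b i * w i)))"
    by (subst integral_distr) (simp_all add: ip_def)
  also have "\<dots> = (\<integral>z. f (fst z) * ?h (q * fst z + r * snd z) \<partial>(N \<Otimes>\<^sub>M N))"
    unfolding D \<open>p = 1\<close> by (subst integral_distr) (simp_all add: split_beta)
  also have "\<dots> = (\<integral>x. \<integral>y. f x * ?h (q * x + r * y) \<partial>N \<partial>N)"
    using NN.integral_fst'[OF int2] by simp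
  also have "\<dots> = (\<integral>x. f x * (q ^ k * ?h x) \<partial>N)"
    by (simp add: hermite_mehler[OF qr1])
  also have "\<dots> = (\<integral>x. q ^ k * (f x * ?h x) \<partial>N)"
    by (intro Bochner_Integration.integral_cong refl) (simp add: mult_ac)
  also have "\<dots> = q ^ k * (\<integral>x. f x * ?h x \<partial>N)" by simp
  finally show "(\<integral>w. f (ip J a w) * ?h (ip J b w) \<partial>std_gaussian J)
      = (\<Sum>i\<in>J. a i * b i) ^ k * (\<integral>x. f x * ?h x \<partial>N)" by (simp add: q)
qed

lemma lipschitz_dilation_L2:
  fixes \<sigma> :: "real \<Rightarrow> real"
  assumes L: "L-lipschitz_on UNIV \<sigma>"
  shows "(\<lambda>t. \<sigma> (r * t)) \<in> borel_measurable borel" "integrable N (\<lambda>t. (\<sigma> (r * t))\<^sup>2)"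
  using lipschitz_measurable[OF L] by (simp_all add: lipschitz_square_integrable_N[OF L])

lemma integrable_lipschitz_mult_poly:
  fixes \<sigma> :: "real \<Rightarrow> real"
  assumes L: "L-lipschitz_on UNIV \<sigma>"
  shows "integrable N (\<lambda>t. \<sigma> (r * t) * poly p t)"
proof (rule integrable_mult_of_squares)
  show "(\<lambda>t. \<sigma> (r * t)) \<in> borel_measurable N" "integrable N (\<lambda>t. (\<sigma> (r * t))\<^sup>2)"
    using lipschitz_dilation_L2[OF L] by simp_all
  have "continuous_on UNIV (poly p)" by (intro continuous_intros)
  then show "poly p \<in> borel_measurable N" using borel_measurable_continuous_onI by simp
  show "integrable N (\<lambda>x. (poly p x)\<^sup>2)" by (rule integrable_N_if_poly[of _ "p\<^sup>2"]) simp
qed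

lemma hermite_coefficient_dilation:
  fixes \<sigma> :: "real \<Rightarrow> real"
  assumes L: "L-lipschitz_on UNIV \<sigma>"
  shows "\<bar>(\<integral>t. \<sigma> (r * t) * poly p t \<partial>N) - (\<integral>t. \<sigma> t * poly p t \<partial>N)\<bar> \<le> L * \<bar>r - 1\<bar> * (\<integral>t. \<bar>t * poly p t\<bar> \<partial>N)"
proof -
  have int: "integrable N (\<lambda>t. \<sigma> (r * t) * poly p t)" "integrable N (\<lambda>t. \<sigma> t * poly p t)"
    using integrable_lipschitz_mult_poly[OF L, of r p] integrable_lipschitz_mult_poly[OF L, of 1 p] by simp_all
  have intp: "integrable N (\<lambda>t. \<bar>t * poly p t\<bar>)"
    by (intro integrable_abs integrable_N_if_poly[of _ "[:0, 1:] * p"]) simp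
  have diff: "(\<integral>t. \<sigma> (r * t) * poly p t \<partial>N) - (\<integral>t. \<sigma> t * poly p t \<partial>N) = (\<integral>t. \<sigma> (r * t) * poly p t - \<sigma> t * poly p t \<partial>N)"
    using int by simp
  have "(\<integral>t. \<bar>\<sigma> (r * t) * poly p t - \<sigma> t * poly p t\<bar> \<partial>N) \<le> (\<integral>t. L * \<bar>r - 1\<bar> * \<bar>t * poly p t\<bar> \<partial>N)"
  proof (rule integral_mono)
    show "integrable N (\<lambda>t. \<bar>\<sigma> (r * t) * poly p t - \<sigma> t * poly p t\<bar>)" using int by simp
    show "integrable N (\<lambda>t. L * \<bar>r - 1\<bar> * \<bar>t * poly p t\<bar>)" using intp by simp
    fix t
    have "\<bar>\<sigma> (r * t) * poly p t - \<sigma> t * poly p t\<bar> = \<bar>\<sigma> (r * t) - \<sigma> t\<bar> * \<bar>poly p t\<bar>"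
      by (simp add: abs_mult[symmetric] algebra_simps)
    also have "\<dots> \<le> (L * \<bar>r * t - t\<bar>) * \<bar>poly p t\<bar>"
      by (intro mult_right_mono lipschitz_abs_le[OF L]) simp
    also have "\<dots> = (L * (\<bar>r - 1\<bar> * \<bar>t\<bar>)) * \<bar>poly p t\<bar>"
      by (simp add: abs_mult[symmetric] algebra_simps)
    also have "\<dots> = L * \<bar>r - 1\<bar> * \<bar>t * poly p t\<bar>" by (simp add: abs_mult)
    finally show "\<bar>\<sigma> (r * t) * poly p t - \<sigma> t * poly p t\<bar> \<le> L * \<bar>r - 1\<bar> * \<bar>t * poly p t\<bar>" .
  qed
  from order_trans[OF integral_abs_bound this] show ?thesis unfolding diff by simp
qed

lemma bil_near_identity:
  assumes diag: "\<And>\<alpha>. \<alpha> < n \<Longrightarrow> P \<alpha> \<alpha> = 1"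
    and off: "\<And>\<alpha> \<beta>. \<alpha> < n \<Longrightarrow> \<beta> < n \<Longrightarrow> \<alpha> \<noteq> \<beta> \<Longrightarrow> \<bar>P \<alpha> \<beta>\<bar> \<le> \<delta>"
    and \<delta>: "0 \<le> \<delta>"
  shows "(1 - real n * \<delta>) * (\<Sum>\<alpha><n. (v \<alpha>)\<^sup>2) \<le> bil n P v v"
proof -
  let ?R = "\<lambda>\<alpha> \<beta>. if \<alpha> = \<beta> then 0 else P \<alpha> \<beta>"
  have "bil n P v v = (\<Sum>\<alpha><n. \<Sum>\<beta><n. (if \<alpha> = \<beta> then (v \<alpha>)\<^sup>2 else 0) + v \<alpha> * ?R \<alpha> \<beta> * v \<beta>)"
    unfolding bil_def by (intro sum.cong refl) (auto simp: diag power2_eq_square)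
  also have "\<dots> = (\<Sum>\<alpha><n. (v \<alpha>)\<^sup>2) + bil n ?R v v"
    unfolding bil_def sum.distrib by simp
  finally have split: "bil n P v v = (\<Sum>\<alpha><n. (v \<alpha>)\<^sup>2) + bil n ?R v v" .
  have "\<bar>bil n ?R v v\<bar> \<le> (\<Sum>\<alpha><n. \<Sum>\<beta><n. \<bar>v \<alpha> * ?R \<alpha> \<beta> * v \<beta>\<bar>)"
    unfolding bil_def by (rule order_trans[OF sum_abs]) (intro sum_mono sum_abs)
  also have "\<dots> \<le> (\<Sum>\<alpha><n. \<Sum>\<beta><n. \<delta> * (\<bar>v \<alpha>\<bar> * \<bar>v \<beta>\<bar>))"
  proof (intro sum_mono)
    fix \<alpha> \<beta> assume "\<alpha> \<in> {..<n}" "\<beta> \<in> {..<n}"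
    then have "\<bar>?R \<alpha> \<beta>\<bar> \<le> \<delta>" using off \<delta> by auto
    then have "\<bar>?R \<alpha> \<beta>\<bar> * (\<bar>v \<alpha>\<bar> * \<bar>v \<beta>\<bar>) \<le> \<delta> * (\<bar>v \<alpha>\<bar> * \<bar>v \<beta>\<bar>)" by (intro mult_right_mono) auto
    then show "\<bar>v \<alpha> * ?R \<alpha> \<beta> * v \<beta>\<bar> \<le> \<delta> * (\<bar>v \<alpha>\<bar> * \<bar>v \<beta>\<bar>)" by (simp only: abs_mult mult_ac)
  qed
  also have "\<dots> = \<delta> * (\<Sum>\<alpha><n. 1 * \<bar>v \<alpha>\<bar>)\<^sup>2"
    unfolding power2_eq_square sum_product by (simp add: sum_distrib_left)
  also have "\<dots> \<le> \<delta> * ((\<Sum>\<alpha><n. 1\<^sup>2) * (\<Sum>\<alpha><n. \<bar>v \<alpha>\<bar>\<^sup>2))"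
    by (intro mult_left_mono Cauchy_Schwarz_ineq_sum \<delta>)
  also have "\<dots> = real n * \<delta> * (\<Sum>\<alpha><n. (v \<alpha>)\<^sup>2)" by simp
  finally show ?thesis unfolding split by (simp add: left_diff_distrib)
qed

text \<open>Let \<open>z \<alpha>\<close> be the \<open>k\<close>-th Hermite coefficient of \<open>t \<mapsto> \<sigma> (r\<^sub>\<alpha> t)\<close>, where \<open>r\<^sub>\<alpha>\<close> is the norm of \<open>x \<alpha>\<close>, and let
\<open>v \<alpha> = u \<alpha> * z \<alpha>\<close>. Projecting the feature onto the span of \<open>H = (\<Sum>\<beta>. v \<beta> * h\<^sub>k \<langle>w, x\<^sub>\<beta> / r\<^sub>\<beta>\<rangle>)\<close> gives a lower bound, since the
mixed moment of the feature and \<open>H\<close> is \<open>P(v, v)\<close> and the second moment of \<open>H\<close> is \<open>fact k * P(v, v)\<close>, where \<open>P\<close> is the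
entrywise \<open>k\<close>-th power of the correlation matrix. The condition on \<open>\<zeta>\<close> ensures that \<open>\<bar>z \<alpha>\<bar>\<close> is at least half
of the coefficient of \<open>\<sigma>\<close> itself, and \<open>P\<close> is at least half of the identity by \<open>bil_near_identity\<close>.\<close>

lemma mean_kernel_lower_bound:
  fixes x :: "nat \<Rightarrow> 'j \<Rightarrow> real" and \<sigma> :: "real \<Rightarrow> real"
  assumes L: "L-lipschitz_on UNIV \<sigma>" and J: "finite J" and k: "4 \<le> k"
    and nrm: "\<And>\<alpha>. \<alpha> < n \<Longrightarrow> \<bar>sqrt (\<Sum>i\<in>J. (x \<alpha> i)\<^sup>2) - 1\<bar> \<le> \<epsilon>"
    and off: "\<And>\<alpha> \<beta>. \<alpha> < n \<Longrightarrow> \<beta> < n \<Longrightarrow> \<alpha> \<noteq> \<beta> \<Longrightarrow> \<bar>\<Sum>i\<in>J. x \<alpha> i * x \<beta> i\<bar> \<le> \<epsilon>"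
    and \<epsilon>: "0 \<le> \<epsilon>" "4 * \<epsilon> \<le> 1" "real n * (4 * \<epsilon>) ^ 4 \<le> 1/2"
    and \<zeta>: "L * \<epsilon> * (\<integral>t. \<bar>t * poly (hermite k) t\<bar> \<partial>N) \<le> \<bar>\<integral>t. \<sigma> t * poly (hermite k) t \<partial>N\<bar> / 2"
  shows "(\<integral>t. \<sigma> t * poly (hermite k) t \<partial>N)\<^sup>2 / (8 * fact k) * (\<Sum>\<alpha><n. (u \<alpha>)\<^sup>2) \<le> bil n (mean_kernel \<sigma> J x) u u"
proof -
  let ?G = "std_gaussian J" and ?h = "poly (hermite k)"
  interpret G: prob_space ?G by (rule prob_space_std_gaussian)
  note [measurable] = lipschitz_measurable[OF L]
  have L0: "0 \<le> L" using L by (rule lipschitz_on_nonneg)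
  have "continuous_on UNIV ?h" by (intro continuous_intros)
  then have [measurable]: "?h \<in> borel_measurable borel" by (rule borel_measurable_continuous_onI)
  define r where "r \<alpha> = sqrt (\<Sum>i\<in>J. (x \<alpha> i)\<^sup>2)" for \<alpha>
  define y where "y \<alpha> i = x \<alpha> i / r \<alpha>" for \<alpha> i
  define c where "c = (\<integral>t. \<sigma> t * ?h t \<partial>N)"
  define z where "z \<alpha> = (\<integral>t. \<sigma> (r \<alpha> * t) * ?h t \<partial>N)" for \<alpha>
  define P where "P \<alpha> \<beta> = (\<Sum>i\<in>J. y \<alpha> i * y \<beta> i) ^ k" for \<alpha> \<beta>
  define v where "v \<alpha> = u \<alpha> * z \<alpha>" for \<alpha>
  have r: "3/4 \<le> r \<alpha>" "\<bar>r \<alpha> - 1\<bar> \<le> \<epsilon>" if "\<alpha> < n" for \<alpha>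
    using nrm[OF that] \<epsilon>(2) unfolding r_def[symmetric] by linarith+
  have r2: "(r \<alpha>)\<^sup>2 = (\<Sum>i\<in>J. (x \<alpha> i)\<^sup>2)" for \<alpha> unfolding r_def by (simp add: sum_nonneg)
  have y1: "(\<Sum>i\<in>J. (y \<alpha> i)\<^sup>2) = 1" if "\<alpha> < n" for \<alpha>
    using r(1)[OF that] unfolding y_def power_divide sum_divide_distrib[symmetric] r2[symmetric] by simp
  have ip_x: "ip J (x \<alpha>) w = r \<alpha> * ip J (y \<alpha>) w" if "\<alpha> < n" for \<alpha> w
    using r(1)[OF that] by (simp add: ip_def y_def sum_distrib_left)
  have zc: "c\<^sup>2 / 4 \<le> (z \<alpha>)\<^sup>2" if "\<alpha> < n" for \<alpha>
  proof -
    have "\<bar>z \<alpha> - c\<bar> \<le> L * \<bar>r \<alpha> - 1\<bar> * (\<integral>t. \<bar>t * ?h t\<bar> \<partial>N)"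
      unfolding z_def c_def by (rule hermite_coefficient_dilation[OF L])
    also have "\<dots> \<le> L * \<epsilon> * (\<integral>t. \<bar>t * ?h t\<bar> \<partial>N)"
      using L0 r(2)[OF that] by (intro mult_right_mono mult_left_mono) simp_all
    also have "\<dots> \<le> \<bar>c\<bar> / 2" using \<zeta> by (simp add: c_def)
    finally have "\<bar>c\<bar> / 2 \<le> \<bar>z \<alpha>\<bar>" by linarith
    from power_mono[OF this, of 2] show ?thesis by (simp add: power_divide)
  qed
  have P1: "P \<alpha> \<alpha> = 1" if "\<alpha> < n" for \<alpha>
    using y1[OF that] by (simp add: P_def power2_eq_square)
  have Poff: "\<bar>P \<alpha> \<beta>\<bar> \<le> (4 * \<epsilon>) ^ 4" if "\<alpha> < n" "\<beta> < n" "\<alpha> \<noteq> \<beta>" for \<alpha> \<beta>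
  proof -
    have rr: "1/4 \<le> r \<alpha> * r \<beta>" using mult_mono[OF r(1)[OF that(1)] r(1)[OF that(2)]] r(1)[OF that(1)] by simp
    have "(\<Sum>i\<in>J. y \<alpha> i * y \<beta> i) = (\<Sum>i\<in>J. x \<alpha> i * x \<beta> i) / (r \<alpha> * r \<beta>)"
      by (simp add: y_def sum_divide_distrib)
    also have "\<bar>\<dots>\<bar> = \<bar>\<Sum>i\<in>J. x \<alpha> i * x \<beta> i\<bar> / (r \<alpha> * r \<beta>)" using rr by simp
    also have "\<dots> \<le> \<epsilon> / (1/4)" using off[OF that] rr \<epsilon>(1) by (intro frac_le) auto
    finally have "\<bar>\<Sum>i\<in>J. y \<alpha> i * y \<beta> i\<bar> \<le> 4 * \<epsilon>" by simp
    then have "\<bar>P \<alpha> \<beta>\<bar> \<le> (4 * \<epsilon>) ^ k" unfolding P_def power_abs by (intro power_mono) auto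
    also have "\<dots> \<le> (4 * \<epsilon>) ^ 4" using \<epsilon> k by (intro power_decreasing) auto
    finally show ?thesis .
  qed
  define F where "F = feature \<sigma> J {..<n} x u"
  define H where "H w = (\<Sum>\<beta><n. v \<beta> * ?h (ip J (y \<beta>) w))" for w
  have Fy: "F w = (\<Sum>\<alpha><n. u \<alpha> * \<sigma> (r \<alpha> * ip J (y \<alpha>) w))" for w
    unfolding F_def feature_def by (intro sum.cong refl) (simp add: ip_x)
  have [measurable]: "F \<in> borel_measurable ?G" "H \<in> borel_measurable ?G"
    unfolding F_def H_def by measurable
  have sh: "integrable ?G (\<lambda>w. \<sigma> (r \<alpha> * ip J (y \<alpha>) w) * ?h (ip J (y \<beta>) w))"
     "(\<integral>w. \<sigma> (r \<alpha> * ip J (y \<alpha>) w) * ?h (ip J (y \<beta>) w) \<partial>?G) = P \<alpha> \<beta> * z \<alpha>" if "\<alpha> < n" "\<beta> < n" for \<alpha> \<beta>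
    unfolding P_def z_def
    by (rule hermite_correlation[OF J y1[OF that(1)] y1[OF that(2)] lipschitz_dilation_L2[OF L]])+
  have h2: "integrable N (\<lambda>t. (?h t)\<^sup>2)"
    by (rule integrable_N_if_poly[of _ "(hermite k)\<^sup>2"]) simp
  have hh: "integrable ?G (\<lambda>w. ?h (ip J (y \<alpha>) w) * ?h (ip J (y \<beta>) w))"
     "(\<integral>w. ?h (ip J (y \<alpha>) w) * ?h (ip J (y \<beta>) w) \<partial>?G) = P \<alpha> \<beta> * fact k" if "\<alpha> < n" "\<beta> < n" for \<alpha> \<beta>
    using hermite_correlation[OF J y1[OF that(1)] y1[OF that(2)] _ h2, of k]
    by (simp_all add: P_def hermite_orthogonal)
  have FH: "F w * H w = (\<Sum>\<alpha><n. \<Sum>\<beta><n. u \<alpha> * v \<beta> * (\<sigma> (r \<alpha> * ip J (y \<alpha>) w) * ?h (ip J (y \<beta>) w)))" for w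
    unfolding Fy H_def sum_product by (intro sum.cong refl) (simp add: mult_ac)
  have HH: "(H w)\<^sup>2 = (\<Sum>\<alpha><n. \<Sum>\<beta><n. v \<alpha> * v \<beta> * (?h (ip J (y \<alpha>) w) * ?h (ip J (y \<beta>) w)))" for w
    unfolding H_def power2_eq_square sum_product by (intro sum.cong refl) (simp add: mult_ac)
  have iFH: "integrable ?G (\<lambda>w. F w * H w)"
    unfolding FH by (intro Bochner_Integration.integrable_sum integrable_mult_right) (simp add: sh)
  have iHH: "integrable ?G (\<lambda>w. (H w)\<^sup>2)"
    unfolding HH by (intro Bochner_Integration.integrable_sum integrable_mult_right) (simp add: hh)
  have iFF: "integrable ?G (\<lambda>w. (F w)\<^sup>2)"
    unfolding F_def feature_square bil_def
    by (intro Bochner_Integration.integrable_sum integrable_mult_right integrable_mult_left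
         integrable_mult_of_squares feature_integrable(1)[OF L J]) simp_all
  have EFH: "(\<integral>w. F w * H w \<partial>?G) = bil n P v v"
  proof -
    have "(\<integral>w. F w * H w \<partial>?G) = (\<Sum>\<alpha><n. \<Sum>\<beta><n. u \<alpha> * v \<beta> * (P \<alpha> \<beta> * z \<alpha>))"
      unfolding FH
      by (subst Bochner_Integration.integral_sum, intro Bochner_Integration.integrable_sum integrable_mult_right, simp add: sh,
          intro sum.cong refl, subst Bochner_Integration.integral_sum, intro integrable_mult_right, simp add: sh,
          intro sum.cong refl, simp add: sh)
    then show ?thesis unfolding bil_def v_def by (simp add: mult_ac)
  qed
  have EHH: "(\<integral>w. (H w)\<^sup>2 \<partial>?G) = fact k * bil n P v v"
  proof -
    have "(\<integral>w. (H w)\<^sup>2 \<partial>?G) = (\<Sum>\<alpha><n. \<Sum>\<beta><n. v \<alpha> * v \<beta> * (P \<alpha> \<beta> * fact k))"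
      unfolding HH
      by (subst Bochner_Integration.integral_sum, intro Bochner_Integration.integrable_sum integrable_mult_right, simp add: hh,
          intro sum.cong refl, subst Bochner_Integration.integral_sum, intro integrable_mult_right, simp add: hh,
          intro sum.cong refl, simp add: hh)
    then show ?thesis unfolding bil_def by (simp add: mult_ac sum_distrib_left)
  qed
  let ?b = "1 / fact k :: real"
  have "0 \<le> (\<integral>w. (F w - ?b * H w)\<^sup>2 \<partial>?G)" by (intro Bochner_Integration.integral_nonneg) simp
  also have "\<dots> = (\<integral>w. (F w)\<^sup>2 - 2 * ?b * (F w * H w) + ?b\<^sup>2 * (H w)\<^sup>2 \<partial>?G)"
    by (intro Bochner_Integration.integral_cong refl) (simp add: power2_eq_square algebra_simps)
  also have "\<dots> = (\<integral>w. (F w)\<^sup>2 \<partial>?G) - 2 * ?b * bil n P v v + ?b\<^sup>2 * (fact k * bil n P v v)"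
    using iFF iFH iHH by (simp add: EFH EHH)
  also have "\<dots> = (\<integral>w. (F w)\<^sup>2 \<partial>?G) - ?b * bil n P v v"
    by (simp add: power2_eq_square)
  finally have main: "?b * bil n P v v \<le> bil n (mean_kernel \<sigma> J x) u u"
    unfolding mean_kernel_bil[OF L J] F_def by simp
  have "c\<^sup>2 / (8 * fact k) * (\<Sum>\<alpha><n. (u \<alpha>)\<^sup>2) = ?b * (1/2 * (\<Sum>\<alpha><n. (u \<alpha>)\<^sup>2 * (c\<^sup>2 / 4)))"
    unfolding sum_distrib_right[symmetric] by (simp add: mult_ac)
  also have "\<dots> \<le> ?b * (1/2 * (\<Sum>\<alpha><n. (v \<alpha>)\<^sup>2))"
    unfolding v_def power_mult_distrib by (intro mult_left_mono sum_mono zc) auto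
  also have "\<dots> \<le> ?b * ((1 - real n * (4 * \<epsilon>) ^ 4) * (\<Sum>\<alpha><n. (v \<alpha>)\<^sup>2))"
    using \<epsilon>(3) by (intro mult_left_mono mult_right_mono sum_nonneg) auto
  also have "\<dots> \<le> ?b * bil n P v v"
    using \<epsilon>(1) by (intro mult_left_mono bil_near_identity P1 Poff) auto
  finally show ?thesis using main by (simp add: c_def)
qed

section \<open>Hermite coefficients of nonlinear activations\<close>

lemma orthogonal_hermite_imp_orthogonal_poly:
  fixes f :: "real \<Rightarrow> real"
  assumes int: "\<And>p. integrable N (\<lambda>x. f x * poly p x)"
    and h: "\<And>k. (\<integral>x. f x * poly (hermite k) x \<partial>N) = 0"
  shows "(\<integral>x. f x * poly p x \<partial>N) = 0"
proof -
  have "(\<forall>i\<ge>n. coeff p i = 0) \<Longrightarrow> (\<integral>x. f x * poly p x \<partial>N) = 0" for n p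
  proof (induction n arbitrary: p)
    case 0
    then have "p = 0" by (intro poly_eqI) simp
    then show ?case by simp
  next
    case (Suc n)
    define q where "q = p - Polynomial.smult (coeff p n) (hermite n)"
    have dh: "degree (hermite n) = n" "coeff (hermite n) n = 1" using degree_hermite[of n] by metis+
    have "coeff q i = 0" if "i \<ge> n" for i
    proof (cases "i = n")
      case True
      then show ?thesis by (simp add: q_def dh)
    next
      case False
      then have "coeff p i = 0" "coeff (hermite n) i = 0" using Suc.prems that dh by (auto intro!: coeff_eq_0)
      then show ?thesis by (simp add: q_def)
    qed
    then have "(\<integral>x. f x * poly q x \<partial>N) = 0" by (intro Suc.IH) auto
    moreover have "(\<integral>x. f x * poly p x \<partial>N) = (\<integral>x. f x * poly q x + coeff p n * (f x * poly (hermite n) x) \<partial>N)"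
      by (intro Bochner_Integration.integral_cong refl) (simp add: q_def algebra_simps)
    ultimately show ?case using int h by simp
  qed
  from this[of "Suc (degree p)" p] show ?thesis by (simp add: coeff_eq_0)
qed

lemma exp_partial_sum_le:
  fixes z :: complex
  shows "norm (\<Sum>k<m. z ^ k /\<^sub>R fact k) \<le> exp (norm z)"
proof -
  have "norm (\<Sum>k<m. z ^ k /\<^sub>R fact k) \<le> (\<Sum>k<m. norm z ^ k /\<^sub>R fact k)"
    by (rule order_trans[OF norm_sum]) (simp add: norm_power)
  also have "\<dots> \<le> (\<Sum>k. norm z ^ k /\<^sub>R fact k)"
    using summable_exp[of "norm z"] by (intro sum_le_suminf) simp_all
  also have "\<dots> = exp (norm z)" by (simp add: exp_def)
  finally show ?thesis .
qed

lemma integrable_exp_abs_N: "integrable N (\<lambda>x. (exp (\<bar>t * x\<bar>))\<^sup>2)"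
proof (rule Bochner_Integration.integrable_bound)
  have "(\<integral>\<^sup>+x. ennreal (exp (1/4 * x\<^sup>2)) \<partial>N) < \<infinity>"
    by (rule le_less_trans[OF gaussian_exp_square]) simp_all
  then have "integrable N (\<lambda>x. exp (1/4 * x\<^sup>2))" by (intro integrableI_nonneg) simp_all
  then show "integrable N (\<lambda>x. exp (4 * t\<^sup>2) * exp (1/4 * x\<^sup>2))" by (rule integrable_mult_right)
  show "AE x in N. norm ((exp \<bar>t * x\<bar>)\<^sup>2) \<le> norm (exp (4 * t\<^sup>2) * exp (1/4 * x\<^sup>2))"
  proof (intro always_eventually allI)
    fix x
    have "0 \<le> (2 * \<bar>t\<bar> - 1/2 * \<bar>x\<bar>)\<^sup>2" by simp
    then have "2 * \<bar>t * x\<bar> \<le> 4 * t\<^sup>2 + 1/4 * x\<^sup>2" by (simp add: power2_eq_square algebra_simps abs_mult)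
    then have "exp (2 * \<bar>t * x\<bar>) \<le> exp (4 * t\<^sup>2 + 1/4 * x\<^sup>2)" by simp
    then show "norm ((exp \<bar>t * x\<bar>)\<^sup>2) \<le> norm (exp (4 * t\<^sup>2) * exp (1/4 * x\<^sup>2))"
      by (simp add: exp_add exp_double)
  qed
qed simp

text \<open>The exponential series may be integrated term by term: its partial sums are dominated by \<open>exp \<bar>t x\<bar>\<close>, which is
square integrable with respect to the Gaussian measure.\<close>

lemma fourier_zero_of_orthogonal_poly:
  fixes f :: "real \<Rightarrow> real"
  assumes f[measurable]: "f \<in> borel_measurable borel" and f2: "integrable N (\<lambda>x. (f x)\<^sup>2)"
    and p: "\<And>p. (\<integral>x. f x * poly p x \<partial>N) = 0"
  shows "integrable N (\<lambda>x. f x *\<^sub>R iexp (t * x))" "(\<integral>x. f x *\<^sub>R iexp (t * x) \<partial>N) = 0"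
proof -
  let ?s = "\<lambda>m x. f x *\<^sub>R (\<Sum>k<m. (\<i> * complex_of_real (t * x)) ^ k /\<^sub>R fact k)"
  let ?w = "\<lambda>x. \<bar>f x\<bar> * exp \<bar>t * x\<bar>"
  have int: "integrable N (\<lambda>x. f x * x ^ k)" for k
  proof (rule integrable_mult_of_squares)
    have "integrable N (\<lambda>x. x ^ (2 * k))" by (rule integrable_N_power)
    then show "integrable N (\<lambda>x. (x ^ k)\<^sup>2)" by (simp add: power_even_eq power_mult[symmetric] mult.commute)
  qed (use f2 in simp_all)
  have w: "integrable N ?w"
    by (rule integrable_mult_of_squares[OF _ _ _ integrable_exp_abs_N]) (use f2 in simp_all)
  have lim: "(\<lambda>m. ?s m x) \<longlonglongrightarrow> f x *\<^sub>R iexp (t * x)" for x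
    using exp_converges[of "\<i> * complex_of_real (t * x)"] by (intro tendsto_intros) (simp add: sums_def)
  have dom: "norm (?s m x) \<le> ?w x" for m x
  proof -
    have "norm (\<Sum>k<m. (\<i> * complex_of_real (t * x)) ^ k /\<^sub>R fact k) \<le> exp \<bar>t * x\<bar>"
      using exp_partial_sum_le[of "\<i> * complex_of_real (t * x)" m] by (simp add: norm_mult abs_mult)
    then show ?thesis by (simp add: mult_left_mono)
  qed
  have meas: "(\<lambda>x. f x *\<^sub>R iexp (t * x)) \<in> borel_measurable N" "\<And>m. ?s m \<in> borel_measurable N"
    by measurable
  show "integrable N (\<lambda>x. f x *\<^sub>R iexp (t * x))"
    by (rule integrable_dominated_convergence[where s = ?s, OF meas w]) (use lim dom in auto)
  have coef: "f x *\<^sub>R ((\<i> * complex_of_real (t * x)) ^ k /\<^sub>R fact k) = ((\<i> * complex_of_real t) ^ k /\<^sub>R fact k) * complex_of_real (f x * x ^ k)" for x k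
    by (simp add: scaleR_conv_of_real power_mult_distrib mult_ac)
  have zero: "(\<integral>x. ?s m x \<partial>N) = 0" for m
  proof -
    have "(\<integral>x. f x * x ^ k \<partial>N) = 0" for k using p[of "monom 1 k"] by (simp add: poly_monom)
    then have "(\<integral>x. complex_of_real (f x * x ^ k) \<partial>N) = 0" for k by (simp only: integral_complex_of_real of_real_0)
    then show ?thesis
      unfolding scaleR_sum_right coef
      by (subst Bochner_Integration.integral_sum) (auto intro!: integrable_mult_right integrable_of_real int simp del: of_real_mult)
  qed
  have "(\<lambda>m. (\<integral>x. ?s m x \<partial>N)) \<longlonglongrightarrow> (\<integral>x. f x *\<^sub>R iexp (t * x) \<partial>N)"
    by (rule integral_dominated_convergence[OF meas w]) (use lim dom in auto)
  then show "(\<integral>x. f x *\<^sub>R iexp (t * x) \<partial>N) = 0"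
    unfolding zero by (simp add: LIMSEQ_const_iff)
qed

lemma density_N_real_distribution:
  fixes g :: "real \<Rightarrow> real"
  assumes [measurable]: "g \<in> borel_measurable borel" and g0: "\<And>x. 0 \<le> g x"
    and g: "integrable N g" "(\<integral>x. g x \<partial>N) = 1"
  shows "real_distribution (density N (\<lambda>x. ennreal (g x)))"
proof -
  have "(\<integral>\<^sup>+x. ennreal (g x) \<partial>N) = ennreal (\<integral>x. g x \<partial>N)"
    by (rule nn_integral_eq_integral[OF g(1)]) (simp add: g0)
  then have "emeasure (density N (\<lambda>x. ennreal (g x))) UNIV = 1"
    using g(2) by (subst emeasure_density) simp_all
  then have "prob_space (density N (\<lambda>x. ennreal (g x)))" by (intro prob_spaceI) simp
  then show ?thesis unfolding real_distribution_def real_distribution_axioms_def by simp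
qed

lemma char_density_N:
  fixes g :: "real \<Rightarrow> real"
  assumes [measurable]: "g \<in> borel_measurable borel" and g0: "\<And>x. 0 \<le> g x"
  shows "char (density N (\<lambda>x. ennreal (g x))) t = (\<integral>x. g x *\<^sub>R iexp (t * x) \<partial>N)"
  unfolding char_def by (rule integral_density) (simp_all add: g0)

text \<open>Levy's uniqueness theorem for the probability measures with densities \<open>g\<close> and \<open>h\<close>.\<close>

lemma AE_eq_of_fourier_eq:
  fixes g h :: "real \<Rightarrow> real"
  assumes gm[measurable]: "g \<in> borel_measurable borel" and g: "\<And>x. 0 \<le> g x" "integrable N g" "(\<integral>x. g x \<partial>N) = 1"
    and hm[measurable]: "h \<in> borel_measurable borel" and h: "\<And>x. 0 \<le> h x" "integrable N h" "(\<integral>x. h x \<partial>N) = 1"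
    and eq: "\<And>t. (\<integral>x. g x *\<^sub>R iexp (t * x) \<partial>N) = (\<integral>x. h x *\<^sub>R iexp (t * x) \<partial>N)"
  shows "AE x in N. g x = h x"
proof -
  have "char (density N (\<lambda>x. ennreal (g x))) = char (density N (\<lambda>x. ennreal (h x)))"
  proof
    fix t
    show "char (density N (\<lambda>x. ennreal (g x))) t = char (density N (\<lambda>x. ennreal (h x))) t"
      unfolding char_density_N[OF gm g(1)] char_density_N[OF hm h(1)] by (rule eq)
  qed
  with density_N_real_distribution[OF gm g] density_N_real_distribution[OF hm h]
  have "density N (\<lambda>x. ennreal (g x)) = density N (\<lambda>x. ennreal (h x))" by (rule Levy_uniqueness)
  then have "AE x in N. ennreal (g x) = ennreal (h x)"
    by (subst (asm) N.density_unique_iff) simp_all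
  then show ?thesis by (rule AE_mp) (simp add: g h)
qed

text \<open>Polynomials are complete in the square integrable functions. The positive and negative parts of \<open>f\<close> have equal mass
\<open>c\<close>; unless \<open>c = 0\<close>, division by \<open>c\<close> turns them into probability densities with the same
characteristic function.\<close>

lemma AE_zero_of_orthogonal_poly:
  fixes f :: "real \<Rightarrow> real"
  assumes f[measurable]: "f \<in> borel_measurable borel" and f2: "integrable N (\<lambda>x. (f x)\<^sup>2)"
    and p: "\<And>p. (\<integral>x. f x * poly p x \<partial>N) = 0"
  shows "AE x in N. f x = 0"
proof -
  have int: "integrable N f" by (rule N.integrable_of_square[OF _ f2]) simp
  have zero: "(\<integral>x. f x \<partial>N) = 0" using p[of 1] by simp
  define g where "g x = max 0 (f x)" for x
  define h where "h x = max 0 (- f x)" for x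
  have gm[measurable]: "g \<in> borel_measurable borel" and hm[measurable]: "h \<in> borel_measurable borel"
    unfolding g_def[abs_def] h_def[abs_def] by measurable
  have gh0: "0 \<le> g x" "0 \<le> h x" for x by (simp_all add: g_def h_def)
  have gi: "integrable N g" and hi: "integrable N h"
    unfolding g_def[abs_def] h_def[abs_def] using int by simp_all
  have f_gh: "f x = g x - h x" for x by (simp add: g_def h_def max_def)
  define c where "c = (\<integral>x. g x \<partial>N)"
  have hc: "(\<integral>x. h x \<partial>N) = c"
    using zero gi hi unfolding f_gh by (simp add: c_def)
  have c0: "0 \<le> c" unfolding c_def by (rule Bochner_Integration.integral_nonneg) (rule gh0)
  have gh: "AE x in N. g x = h x"
  proof (cases "c = 0")
    case True
    have "AE x in N. g x = 0" "AE x in N. h x = 0"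
      using True hc integral_nonneg_eq_0_iff_AE[OF gi] integral_nonneg_eq_0_iff_AE[OF hi] gh0 by (simp_all add: c_def)
    then show ?thesis by eventually_elim simp
  next
    case False
    then have cpos: "0 < c" using c0 by simp
    have "AE x in N. g x / c = h x / c"
    proof (rule AE_eq_of_fourier_eq)
      fix t
      have bound: "integrable N (\<lambda>x. (k x / c) *\<^sub>R iexp (t * x))"
        if k: "integrable N k" and [measurable]: "k \<in> borel_measurable borel" for k :: "real \<Rightarrow> real"
      proof (rule Bochner_Integration.integrable_bound)
        show "integrable N (\<lambda>x. k x / c)" using k by simp
      qed simp_all
      have "(\<integral>x. (g x / c) *\<^sub>R iexp (t * x) \<partial>N) - (\<integral>x. (h x / c) *\<^sub>R iexp (t * x) \<partial>N)
          = (\<integral>x. (g x / c) *\<^sub>R iexp (t * x) - (h x / c) *\<^sub>R iexp (t * x) \<partial>N)"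
        by (rule Bochner_Integration.integral_diff[symmetric]) (rule bound, rule gi hi, rule gm hm)+
      moreover have "(g x / c) *\<^sub>R z - (h x / c) *\<^sub>R z = (1 / c) *\<^sub>R (f x *\<^sub>R z)" for x and z :: complex
        by (simp add: f_gh scaleR_left_diff_distrib[symmetric] diff_divide_distrib)
      moreover have "(\<integral>x. (1 / c) *\<^sub>R (f x *\<^sub>R iexp (t * x)) \<partial>N) = (1 / c) *\<^sub>R (\<integral>x. f x *\<^sub>R iexp (t * x) \<partial>N)"
        by (rule integral_scaleR_right)
      ultimately show "(\<integral>x. (g x / c) *\<^sub>R iexp (t * x) \<partial>N) = (\<integral>x. (h x / c) *\<^sub>R iexp (t * x) \<partial>N)"
        using fourier_zero_of_orthogonal_poly(2)[OF f f2 p, of t] by (simp only: scaleR_zero_right right_minus_eq)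
    qed (use cpos gi hi hc gh0 in \<open>simp_all add: c_def[symmetric]\<close>)
    then show ?thesis using cpos by simp
  qed
  then show ?thesis unfolding f_gh by eventually_elim simp
qed

lemma continuous_AE_N_zero:
  fixes f :: "real \<Rightarrow> real"
  assumes cont: "continuous_on UNIV f" and ae: "AE x in N. f x = 0"
  shows "f x = 0"
proof (rule ccontr)
  assume "f x \<noteq> 0"
  have "AE x in lborel. 0 < ennreal (std_normal_density x) \<longrightarrow> f x = 0"
    using ae by (subst (asm) AE_density) auto
  then have "AE x in lborel. f x = 0"
    by eventually_elim (simp add: normal_density_pos)
  moreover have S: "open {x. f x \<noteq> 0}" using open_Collect_neq[OF cont continuous_on_const] by simp
  moreover have "{x. f x \<noteq> 0} \<in> sets lborel" using S by simp
  ultimately have "{x. f x \<noteq> 0} \<in> null_sets lborel"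
    by (subst AE_iff_null_sets) simp_all
  then have "negligible {x. f x \<noteq> 0}"
    by (simp add: negligible_iff_null_sets null_sets_completionI)
  moreover have "{x. f x \<noteq> 0} \<noteq> {}" using \<open>f x \<noteq> 0\<close> by auto
  ultimately show False using open_not_negligible[OF S] by blast
qed

text \<open>The even and the odd part of the polynomial satisfy the same growth bound, which can then be tested at a large
\<open>t\<close>.\<close>

lemma cubic_with_linear_growth:
  fixes a b c d L :: real
  assumes bound: "\<And>t. \<bar>b * t + c * t\<^sup>2 + d * t ^ 3\<bar> \<le> L * \<bar>t\<bar>"
  shows "c = 0" "d = 0"
proof -
  have even: "\<bar>c\<bar> * t \<le> L" if "0 < t" for t
  proof -
    have "\<bar>2 * (c * t\<^sup>2)\<bar> \<le> 2 * (L * t)"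
      using bound[of t] bound[of "- t"] that by (simp add: power3_eq_cube)
    then have "t * (\<bar>c\<bar> * t) \<le> t * L" using that by (simp add: abs_mult power2_eq_square mult_ac)
    then show ?thesis using that by simp
  qed
  have odd: "\<bar>b + d * t\<^sup>2\<bar> \<le> L" if "0 < t" for t
  proof -
    have "\<bar>2 * (b * t + d * t ^ 3)\<bar> \<le> 2 * (L * t)"
      using bound[of t] bound[of "- t"] that by simp
    moreover have "b * t + d * t ^ 3 = t * (b + d * t\<^sup>2)" by (simp add: power2_eq_square power3_eq_cube algebra_simps)
    ultimately have "t * \<bar>b + d * t\<^sup>2\<bar> \<le> t * L" using that by (simp add: abs_mult mult_ac)
    then show ?thesis using that by simp
  qed
  have L0: "0 \<le> L" using odd[of 1] by simp
  show "c = 0"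
  proof (rule ccontr)
    assume c: "c \<noteq> 0"
    have "\<bar>c\<bar> * ((L + 1) / \<bar>c\<bar>) \<le> L" using c L0 by (intro even) simp
    then show False using c by simp
  qed
  show "d = 0"
  proof (rule ccontr)
    assume d: "d \<noteq> 0"
    define s where "s = (L + \<bar>b\<bar> + 1) / \<bar>d\<bar>"
    have s: "0 < s" using d L0 by (simp add: s_def)
    have "\<bar>b + d * (sqrt s)\<^sup>2\<bar> \<le> L" using s by (intro odd) simp
    then have "\<bar>d * s\<bar> \<le> L + \<bar>b\<bar>" using s by simp
    moreover have "\<bar>d * s\<bar> = L + \<bar>b\<bar> + 1" using d s L0 unfolding abs_mult by (simp add: s_def)
    ultimately show False by simp
  qed
qed

text \<open>If all coefficients of degree at least four vanish, then \<open>\<sigma>\<close> minus the projection \<open>p\<close> onto the degrees below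
four is orthogonal to every Hermite polynomial, hence zero by continuity, and \<open>\<sigma> = p\<close> is cubic. The growth bound
leaves an affine function, and mean zero removes the constant.\<close>

lemma nonlinear_hermite_coefficient:
  fixes \<sigma> :: "real \<Rightarrow> real"
  assumes L: "L-lipschitz_on UNIV \<sigma>" and mean: "(\<integral>t. \<sigma> t \<partial>N) = 0" and nl: "\<not> linear \<sigma>"
  shows "\<exists>k\<ge>4. (\<integral>t. \<sigma> t * poly (hermite k) t \<partial>N) \<noteq> 0"
proof (rule ccontr)
  assume "\<not> ?thesis"
  then have z: "(\<integral>t. \<sigma> t * poly (hermite k) t \<partial>N) = 0" if "4 \<le> k" for k using that by auto
  note [measurable] = lipschitz_measurable[OF L]
  define \<zeta> where "\<zeta> k = (\<integral>t. \<sigma> t * poly (hermite k) t \<partial>N)" for k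
  define p where "p = (\<Sum>j<4. Polynomial.smult (\<zeta> j / fact j) (hermite j))"
  define f where "f t = \<sigma> t - poly p t" for t
  have isp: "integrable N (\<lambda>t. \<sigma> t * poly q t)" for q
    using integrable_lipschitz_mult_poly[OF L, of 1 q] by simp
  have ip: "integrable N (\<lambda>t. poly r t * poly q t)" for r q
    by (rule integrable_N_if_poly[of _ "r * q"]) simp
  have int: "integrable N (\<lambda>t. f t * poly q t)" for q
    unfolding f_def left_diff_distrib using isp ip by (rule Bochner_Integration.integrable_diff)
  have contp: "continuous_on UNIV (poly q)" for q :: "real poly" by (intro continuous_intros)
  then have [measurable]: "poly q \<in> borel_measurable borel" for q :: "real poly" by (rule borel_measurable_continuous_onI)
  have contf: "continuous_on UNIV f"
    unfolding f_def by (intro continuous_on_diff contp lipschitz_on_continuous_on[OF L])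
  then have fm[measurable]: "f \<in> borel_measurable borel" by (rule borel_measurable_continuous_onI)
  have f2: "integrable N (\<lambda>t. (f t)\<^sup>2)"
  proof -
    have "integrable N (\<lambda>t. (\<sigma> t)\<^sup>2 - 2 * (\<sigma> t * poly p t) + poly p t * poly p t)"
      using lipschitz_square_integrable_N[OF L, of 1] isp[of p] ip[of p p] by simp
    moreover have "(f t)\<^sup>2 = (\<sigma> t)\<^sup>2 - 2 * (\<sigma> t * poly p t) + poly p t * poly p t" for t
      by (simp add: f_def power2_eq_square algebra_simps)
    ultimately show ?thesis by simp
  qed
  have ph: "(\<integral>t. poly p t * poly (hermite k) t \<partial>N) = \<zeta> k" for k
  proof -
    have "(\<integral>t. poly p t * poly (hermite k) t \<partial>N) = (\<integral>t. (\<Sum>j<4. (\<zeta> j / fact j) * (poly (hermite j) t * poly (hermite k) t)) \<partial>N)"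
      by (simp add: p_def poly_sum sum_distrib_left sum_distrib_right mult_ac)
    also have "\<dots> = (\<Sum>j<4. (\<zeta> j / fact j) * (if j = k then fact k else 0))"
      by (subst Bochner_Integration.integral_sum) (auto intro!: integrable_mult_right ip simp: hermite_orthogonal simp del: hermite.simps)
    also have "\<dots> = (\<Sum>j<4. if j = k then \<zeta> k else 0)" by (intro sum.cong) auto
    also have "\<dots> = \<zeta> k" using z[of k] by (simp add: \<zeta>_def not_less)
    finally show ?thesis .
  qed
  have fh: "(\<integral>t. f t * poly (hermite k) t \<partial>N) = 0" for k
    unfolding f_def left_diff_distrib using isp[of "hermite k"] ip[of p "hermite k"] ph[of k] by (simp add: \<zeta>_def)
  have "AE t in N. f t = 0"
    by (rule AE_zero_of_orthogonal_poly[OF fm f2 orthogonal_hermite_imp_orthogonal_poly[OF int fh]])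
  then have "f t = 0" for t by (rule continuous_AE_N_zero[OF contf])
  then have \<sigma>: "\<sigma> t = poly p t" for t by (simp add: f_def)
  have "\<exists>a b c d. \<forall>t. poly p t = a + b * t + c * t\<^sup>2 + d * t ^ 3"
  proof -
    have "poly p t = \<zeta> 0 + \<zeta> 1 * t + \<zeta> 2 / 2 * (t\<^sup>2 - 1) + \<zeta> 3 / 6 * (t ^ 3 - 3 * t)" for t
      by (simp add: p_def poly_sum eval_nat_numeral lessThan_Suc field_simps)
    then have "\<forall>t. poly p t = (\<zeta> 0 - \<zeta> 2 / 2) + (\<zeta> 1 - \<zeta> 3 / 2) * t + \<zeta> 2 / 2 * t\<^sup>2 + \<zeta> 3 / 6 * t ^ 3"
      by (simp add: field_simps)
    then show ?thesis by blast
  qed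
  then obtain a b c d where p: "\<And>t. \<sigma> t = a + b * t + c * t\<^sup>2 + d * t ^ 3" using \<sigma> by auto
  have "\<bar>b * t + c * t\<^sup>2 + d * t ^ 3\<bar> \<le> L * \<bar>t\<bar>" for t
    using lipschitz_abs_le[OF L, of t 0] by (simp add: p)
  from cubic_with_linear_growth[OF this] have "c = 0" "d = 0" by blast+
  then have lin: "\<sigma> t = a + b * t" for t using p by simp
  have "(\<integral>t. \<sigma> t \<partial>N) = a"
    using integral_std_normal_distribution_moment_odd[of 1] integrable_N_power[of 1] N.prob_space by (simp add: lin)
  then have "\<sigma> = (\<lambda>t. b * t)" using lin mean by auto
  then have "linear \<sigma>" by (auto intro!: linearI simp: algebra_simps)
  then show False using nl by simp
qed

section \<open>Ridge regression\<close>

lemma L2_set_square: "(L2_set f A)\<^sup>2 = (\<Sum>i\<in>A. (f i)\<^sup>2)"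
  by (simp add: L2_set_def sum_nonneg)

lemma sum_mult_le_L2_set: "\<bar>\<Sum>i\<in>A. f i * g i\<bar> \<le> L2_set f A * L2_set g A"
proof -
  have "\<bar>\<Sum>i\<in>A. f i * g i\<bar> \<le> (\<Sum>i\<in>A. \<bar>f i\<bar> * \<bar>g i\<bar>)"
    by (rule order_trans[OF sum_abs]) (simp add: abs_mult)
  also have "\<dots> \<le> L2_set f A * L2_set g A" by (rule L2_set_mult_ineq)
  finally show ?thesis .
qed

text \<open>The equations for \<open>p1\<close> and \<open>p2\<close> are stated in weak form, tested against every \<open>u\<close>. With \<open>d = p2 - p1\<close> they give
\<open>K1(d, d) + lam |d|\<^sup>2 = - (K2 - K1)(d, p2)\<close>, so \<open>lam |d| \<le> q |p2|\<close>, while testing each equation against its own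
solution gives \<open>lam |p1| \<le> |y|\<close> and \<open>lam |p2| \<le> |y|\<close>.\<close>

lemma ridge_solution_perturbation:
  fixes K1 K2 :: "nat \<Rightarrow> nat \<Rightarrow> real"
  assumes lam: "0 < lam" and q: "0 \<le> q"
    and psd: "\<And>u. 0 \<le> bil n K1 u u" "\<And>u. 0 \<le> bil n K2 u u"
    and close: "\<And>u v. \<bar>bil n (\<lambda>\<alpha> \<beta>. K2 \<alpha> \<beta> - K1 \<alpha> \<beta>) u v\<bar> \<le> q * (L2_set u {..<n} * L2_set v {..<n})"
    and eq: "\<And>u. bil n K1 u p1 + lam * (\<Sum>\<alpha><n. u \<alpha> * p1 \<alpha>) = (\<Sum>\<alpha><n. u \<alpha> * y \<alpha>)"
       "\<And>u. bil n K2 u p2 + lam * (\<Sum>\<alpha><n. u \<alpha> * p2 \<alpha>) = (\<Sum>\<alpha><n. u \<alpha> * y \<alpha>)"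
  shows "\<bar>(\<Sum>\<alpha><n. (p2 \<alpha>)\<^sup>2) - (\<Sum>\<alpha><n. (p1 \<alpha>)\<^sup>2)\<bar> \<le> 2 * q / lam ^ 3 * (\<Sum>\<alpha><n. (y \<alpha>)\<^sup>2)"
proof -
  let ?n = "\<lambda>u. L2_set u {..<n}"
  have norm_le: "?n p \<le> ?n y / lam"
    if psd: "0 \<le> bil n K p p" and eq: "bil n K p p + lam * (\<Sum>\<alpha><n. p \<alpha> * p \<alpha>) = (\<Sum>\<alpha><n. p \<alpha> * y \<alpha>)" for K p
  proof (cases "?n p = 0")
    case True then show ?thesis using lam by simp
  next
    case False
    then have pos: "0 < ?n p" using L2_set_nonneg[of p "{..<n}"] by linarith
    have "lam * (?n p)\<^sup>2 = lam * (\<Sum>\<alpha><n. p \<alpha> * p \<alpha>)" by (simp only: L2_set_square) (simp only: power2_eq_square)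
    also have "\<dots> \<le> (\<Sum>\<alpha><n. p \<alpha> * y \<alpha>)" using psd eq by linarith
    also have "\<dots> \<le> ?n p * ?n y" using sum_mult_le_L2_set[of p y "{..<n}"] by linarith
    finally have "?n p * (lam * ?n p) \<le> ?n p * ?n y" by (simp add: power2_eq_square mult_ac)
    then have "lam * ?n p \<le> ?n y" using pos by simp
    then show ?thesis using lam by (simp add: pos_le_divide_eq mult.commute)
  qed
  have P: "?n p1 \<le> ?n y / lam" "?n p2 \<le> ?n y / lam"
    by (rule norm_le[OF psd(1) eq(1)], rule norm_le[OF psd(2) eq(2)])
  define d where "d \<alpha> = p2 \<alpha> - p1 \<alpha>" for \<alpha>
  have "bil n K1 d d + lam * (\<Sum>\<alpha><n. d \<alpha> * d \<alpha>) = - bil n (\<lambda>\<alpha> \<beta>. K2 \<alpha> \<beta> - K1 \<alpha> \<beta>) d p2"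
  proof -
    have "bil n K1 d d = bil n K1 d p2 - bil n K1 d p1" unfolding d_def[of "_"] by (simp add: bil_diff d_def[abs_def])
    moreover have "(\<Sum>\<alpha><n. d \<alpha> * d \<alpha>) = (\<Sum>\<alpha><n. d \<alpha> * p2 \<alpha>) - (\<Sum>\<alpha><n. d \<alpha> * p1 \<alpha>)"
      by (simp add: d_def right_diff_distrib sum_subtractf)
    moreover have "bil n (\<lambda>\<alpha> \<beta>. K2 \<alpha> \<beta> - K1 \<alpha> \<beta>) d p2 = bil n K2 d p2 - bil n K1 d p2"
      by (simp add: bil_def left_diff_distrib right_diff_distrib sum_subtractf)
    ultimately show ?thesis using eq(1)[of d] eq(2)[of d] by (simp add: right_diff_distrib)
  qed
  moreover have "lam * (?n d)\<^sup>2 = lam * (\<Sum>\<alpha><n. d \<alpha> * d \<alpha>)" by (simp only: L2_set_square) (simp only: power2_eq_square)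
  ultimately have "lam * (?n d)\<^sup>2 \<le> q * (?n d * ?n p2)"
    using psd(1)[of d] close[of d p2] by linarith
  then have "?n d * (lam * ?n d) \<le> ?n d * (q * ?n p2)" by (simp add: power2_eq_square mult_ac)
  then have "lam * ?n d \<le> q * ?n p2"
  proof (cases "?n d = 0")
    case True then show ?thesis using q by (simp add: L2_set_nonneg)
  next
    case False
    then have "0 < ?n d" using L2_set_nonneg[of d "{..<n}"] by linarith
    then show ?thesis using \<open>?n d * (lam * ?n d) \<le> ?n d * (q * ?n p2)\<close> by simp
  qed
  also have "\<dots> \<le> q * (?n y / lam)" by (intro mult_left_mono P q)
  finally have D: "?n d \<le> q * ?n y / lam\<^sup>2" using lam by (simp add: field_simps power2_eq_square)
  have "(\<Sum>\<alpha><n. (p2 \<alpha>)\<^sup>2) - (\<Sum>\<alpha><n. (p1 \<alpha>)\<^sup>2) = (\<Sum>\<alpha><n. d \<alpha> * (p2 \<alpha> + p1 \<alpha>))"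
    unfolding d_def sum_subtractf[symmetric] by (intro sum.cong refl) (simp add: power2_eq_square algebra_simps)
  then have "\<bar>(\<Sum>\<alpha><n. (p2 \<alpha>)\<^sup>2) - (\<Sum>\<alpha><n. (p1 \<alpha>)\<^sup>2)\<bar> \<le> ?n d * ?n (\<lambda>\<alpha>. p2 \<alpha> + p1 \<alpha>)"
    using sum_mult_le_L2_set[of d "\<lambda>\<alpha>. p2 \<alpha> + p1 \<alpha>" "{..<n}"] by simp
  also have "\<dots> \<le> (q * ?n y / lam\<^sup>2) * (2 * ?n y / lam)"
  proof (rule mult_mono[OF D])
    show "?n (\<lambda>\<alpha>. p2 \<alpha> + p1 \<alpha>) \<le> 2 * ?n y / lam"
      using L2_set_triangle_ineq[of p2 p1 "{..<n}"] P by simp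
  qed (use q lam in \<open>simp_all add: L2_set_nonneg\<close>)
  also have "\<dots> = 2 * q / lam ^ 3 * (?n y)\<^sup>2" by (simp add: power2_eq_square power3_eq_cube)
  finally show ?thesis unfolding L2_set_square .
qed

lemma vec_nrm_square: "v \<in> carrier_vec n \<Longrightarrow> (vec_nrm v)\<^sup>2 = (\<Sum>i<n. (v $ i)\<^sup>2)"
  unfolding vec_nrm_def scalar_prod_def by (simp add: sum_nonneg power2_eq_square atLeast0LessThan)

lemma vec_nrm_L2: "v \<in> carrier_vec n \<Longrightarrow> vec_nrm v = L2_set (\<lambda>i. v $ i) {..<n}"
  unfolding vec_nrm_def scalar_prod_def L2_set_def by (simp add: power2_eq_square atLeast0LessThan)

lemma vec_nrm_nonneg: "0 \<le> vec_nrm v"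
proof -
  have "vec_nrm v = L2_set (\<lambda>i. v $ i) {..<dim_vec v}" by (rule vec_nrm_L2) simp
  then show ?thesis by (simp only: L2_set_nonneg)
qed

lemma mult_mat_vec_nth:
  assumes "A \<in> carrier_mat m n" "v \<in> carrier_vec n" "i < m"
  shows "(A *\<^sub>v v) $ i = (\<Sum>j<n. A $$ (i, j) * v $ j)"
proof -
  have "(A *\<^sub>v v) $ i = (\<Sum>j\<in>{0..<n}. Matrix.row A i $ j * v $ j)" using assms by (simp add: scalar_prod_def)
  also have "\<dots> = (\<Sum>j\<in>{0..<n}. A $$ (i, j) * v $ j)" using assms by (intro sum.cong refl) simp
  finally show ?thesis by (simp add: atLeast0LessThan)
qed

text \<open>The supremum that defines the spectral norm is bounded by the Frobenius norm, so it dominates the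
value at every normalized vector.\<close>

lemma op_bound_spectral_norm:
  assumes X: "X \<in> carrier_mat d n" and B: "spectral_norm X \<le> B"
  shows "0 \<le> B" "op_bound {..<d} {..<n} (\<lambda>\<alpha> j. X $$ (j, \<alpha>)) B"
proof -
  let ?U = "{v \<in> carrier_vec (dim_col X). vec_nrm v \<le> 1}"
  have bdd: "bdd_above ((\<lambda>v. vec_nrm (X *\<^sub>v v)) ` ?U)"
  proof (rule bdd_aboveI2)
    fix v assume "v \<in> ?U"
    then have v: "v \<in> carrier_vec n" "vec_nrm v \<le> 1" using X by auto
    have v1: "(\<Sum>j<n. (v $ j)\<^sup>2) \<le> 1"
      unfolding vec_nrm_square[OF v(1), symmetric] using v(2) by (simp add: power_le_one vec_nrm_nonneg)
    have Xv: "X *\<^sub>v v \<in> carrier_vec d" using X v by simp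
    have "(vec_nrm (X *\<^sub>v v))\<^sup>2 = (\<Sum>i<d. (\<Sum>j<n. X $$ (i, j) * v $ j)\<^sup>2)"
      unfolding vec_nrm_square[OF Xv] by (intro sum.cong refl) (simp add: mult_mat_vec_nth[OF X v(1)])
    also have "\<dots> \<le> (\<Sum>i<d. (\<Sum>j<n. (X $$ (i, j))\<^sup>2) * 1)"
    proof (intro sum_mono order_trans[OF Cauchy_Schwarz_ineq_sum] mult_left_mono v1)
    qed (simp add: sum_nonneg)
    finally show "vec_nrm (X *\<^sub>v v) \<le> sqrt (\<Sum>i<d. (\<Sum>j<n. (X $$ (i, j))\<^sup>2) * 1)"
      by (rule real_le_rsqrt)
  qed
  have le: "vec_nrm (X *\<^sub>v v) \<le> B" if "v \<in> ?U" for v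
    using cSUP_upper[OF that bdd] B unfolding spectral_norm_def by linarith
  have z: "0\<^sub>v n \<in> ?U" using X by (simp add: vec_nrm_def)
  show "0 \<le> B" using le[OF z] vec_nrm_nonneg[of "X *\<^sub>v 0\<^sub>v n"] by linarith
  show "op_bound {..<d} {..<n} (\<lambda>\<alpha> j. X $$ (j, \<alpha>)) B"
    unfolding op_bound_def
  proof
    fix v :: "nat \<Rightarrow> real"
    show "(\<Sum>i<d. (\<Sum>\<alpha><n. v \<alpha> * X $$ (i, \<alpha>))\<^sup>2) \<le> B\<^sup>2 * (\<Sum>\<alpha><n. (v \<alpha>)\<^sup>2)"
    proof (cases "(\<Sum>\<alpha><n. (v \<alpha>)\<^sup>2) = 0")
      case True
      then have "v \<alpha> = 0" if "\<alpha> < n" for \<alpha> using that by (simp add: sum_nonneg_eq_0_iff)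
      then show ?thesis using True by simp
    next
      case False
      define c where "c = L2_set v {..<n}"
      have c2: "c\<^sup>2 = (\<Sum>\<alpha><n. (v \<alpha>)\<^sup>2)" unfolding c_def by (rule L2_set_square)
      have c: "0 < c" using False c2 L2_set_nonneg[of v "{..<n}"] unfolding c_def by (metis power_zero_numeral order_le_less)
      define w where "w = vec n (\<lambda>\<alpha>. v \<alpha> / c)"
      have w: "w \<in> carrier_vec n" by (simp add: w_def)
      have "(vec_nrm w)\<^sup>2 = 1" unfolding vec_nrm_square[OF w] using c by (simp add: w_def power_divide sum_divide_distrib[symmetric] c2[symmetric])
      then have "vec_nrm w \<le> 1" by (simp add: power2_eq_1_iff) linarith
      then have "vec_nrm (X *\<^sub>v w) \<le> B" using w X by (intro le) simp
      then have "(vec_nrm (X *\<^sub>v w))\<^sup>2 \<le> B\<^sup>2" by (intro power_mono vec_nrm_nonneg)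
      moreover have "X *\<^sub>v w \<in> carrier_vec d" using X w by simp
      then have "(vec_nrm (X *\<^sub>v w))\<^sup>2 = (\<Sum>i<d. (\<Sum>j<n. X $$ (i, j) * w $ j)\<^sup>2)"
        unfolding vec_nrm_square[OF \<open>X *\<^sub>v w \<in> carrier_vec d\<close>] by (intro sum.cong refl) (simp add: mult_mat_vec_nth[OF X w])
      moreover have "\<dots> = (\<Sum>i<d. (\<Sum>\<alpha><n. v \<alpha> * X $$ (i, \<alpha>))\<^sup>2) / c\<^sup>2"
        by (simp add: w_def sum_divide_distrib[symmetric] power_divide mult.commute)
      ultimately have "(\<Sum>i<d. (\<Sum>\<alpha><n. v \<alpha> * X $$ (i, \<alpha>))\<^sup>2) / c\<^sup>2 \<le> B\<^sup>2" by simp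
      then show ?thesis unfolding c2[symmetric] using c by (simp add: pos_divide_le_eq)
    qed
  qed
qed

lemma ip_row:
  assumes X: "X \<in> carrier_mat d n" and "\<alpha> < n" "i < m"
  shows "Matrix.row (mat m d w) i \<bullet> col X \<alpha> = ip {..<d} (\<lambda>j. X $$ (j, \<alpha>)) (row_of {..<d} w i)"
  using assms by (auto simp: scalar_prod_def ip_def row_of_def atLeast0LessThan mult.commute intro!: sum.cong)

lemma rf_kernel_eq:
  assumes X: "X \<in> carrier_mat d n" and "\<alpha> < n" "\<beta> < n"
  shows "rf_kernel \<sigma> (mat m d w) (col X \<alpha>) (col X \<beta>) = sample_kernel \<sigma> {..<d} (\<lambda>\<alpha> j. X $$ (j, \<alpha>)) m w \<alpha> \<beta>"
  unfolding rf_kernel_def sample_kernel_def dim_row_mat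
  by (intro arg_cong2[of _ _ _ _ "(*)"] sum.cong refl) (simp_all only: lessThan_iff ip_row[OF X assms(2)] ip_row[OF X assms(3)])

lemma expected_kernel_eq:
  assumes X: "X \<in> carrier_mat d n" and "\<alpha> < n" "\<beta> < n"
  shows "expected_kernel \<sigma> (col X \<alpha>) (col X \<beta>) = mean_kernel \<sigma> {..<d} (\<lambda>\<alpha> j. X $$ (j, \<alpha>)) \<alpha> \<beta>"
proof -
  have "vec d w \<bullet> col X \<gamma> = ip {..<d} (\<lambda>j. X $$ (j, \<gamma>)) w" if "\<gamma> < n" for w \<gamma>
    using X that by (auto simp: scalar_prod_def ip_def atLeast0LessThan mult.commute intro!: sum.cong)
  moreover have "dim_vec (col X \<alpha>) = d" using X by simp
  ultimately show ?thesis unfolding expected_kernel_def mean_kernel_def using assms by simp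
qed

lemma ridge_mat_carrier: "X \<in> carrier_mat d n \<Longrightarrow> ridge_mat k lam X \<in> carrier_mat n n"
  unfolding ridge_mat_def kernel_mat_def by auto

lemma ridge_mat_bil:
  assumes X: "X \<in> carrier_mat d n" and v: "v \<in> carrier_vec n"
    and k: "\<And>\<alpha> \<beta>. \<alpha> < n \<Longrightarrow> \<beta> < n \<Longrightarrow> k (col X \<alpha>) (col X \<beta>) = A \<alpha> \<beta>"
  shows "(\<Sum>\<alpha><n. u \<alpha> * (ridge_mat k lam X *\<^sub>v v) $ \<alpha>) = bil n A u (\<lambda>\<beta>. v $ \<beta>) + lam * (\<Sum>\<alpha><n. u \<alpha> * v $ \<alpha>)"
proof -
  have "(ridge_mat k lam X *\<^sub>v v) $ \<alpha> = (\<Sum>\<beta><n. A \<alpha> \<beta> * v $ \<beta>) + lam * v $ \<alpha>" if "\<alpha> < n" for \<alpha>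
  proof -
    have "(ridge_mat k lam X *\<^sub>v v) $ \<alpha> = (\<Sum>\<beta><n. (A \<alpha> \<beta> + lam * (if \<alpha> = \<beta> then 1 else 0)) * v $ \<beta>)"
      unfolding mult_mat_vec_nth[OF ridge_mat_carrier[OF X] v that]
      using that X by (intro sum.cong refl) (auto simp: ridge_mat_def kernel_mat_def k)
    also have "\<dots> = (\<Sum>\<beta><n. A \<alpha> \<beta> * v $ \<beta> + (if \<alpha> = \<beta> then lam * v $ \<alpha> else 0))"
      by (intro sum.cong refl) (auto simp: distrib_right)
    also have "\<dots> = (\<Sum>\<beta><n. A \<alpha> \<beta> * v $ \<beta>) + lam * v $ \<alpha>" using that by (simp add: sum.distrib)
    finally show ?thesis .
  qed
  then show ?thesis
    unfolding bil_def by (simp add: distrib_left sum.distrib sum_distrib_left mult_ac)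
qed

lemma adj_mat_inverse:
  fixes A :: "real mat"
  assumes A: "A \<in> carrier_mat n n" and d: "det A \<noteq> 0"
  shows "A * ((1 / det A) \<cdot>\<^sub>m adj_mat A) = 1\<^sub>m n" "((1 / det A) \<cdot>\<^sub>m adj_mat A) * A = 1\<^sub>m n"
proof -
  note adj = adj_mat[OF A]
  have one: "(1 / det A) \<cdot>\<^sub>m (det A \<cdot>\<^sub>m 1\<^sub>m n) = 1\<^sub>m n" using d by (intro eq_matI) auto
  show "A * ((1 / det A) \<cdot>\<^sub>m adj_mat A) = 1\<^sub>m n"
    unfolding mult_smult_distrib[OF A adj(1)] adj(2) by (rule one)
  show "((1 / det A) \<cdot>\<^sub>m adj_mat A) * A = 1\<^sub>m n"
    unfolding mult_smult_assoc_mat[OF adj(1) A] adj(3) by (rule one)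
qed

lemma invertible_mat_iff_det:
  fixes A :: "real mat"
  assumes A: "A \<in> carrier_mat n n"
  shows "invertible_mat A \<longleftrightarrow> det A \<noteq> 0"
proof
  assume "invertible_mat A"
  then obtain B where B: "A * B = 1\<^sub>m n" "B * A = 1\<^sub>m (dim_row B)"
    using A unfolding invertible_mat_def inverts_mat_def by auto
  have "dim_col (A * B) = n" using B(1) by simp
  then have "dim_col B = n" by simp
  moreover have "dim_col (B * A) = dim_row B" using B(2) by simp
  then have "dim_row B = n" using A by simp
  ultimately have "B \<in> carrier_mat n n" by auto
  from det_mult[OF A this] have "det A * det B = 1" unfolding B(1) by simp
  then show "det A \<noteq> 0" by auto
next
  assume "det A \<noteq> 0"
  from adj_mat_inverse[OF A this] show "invertible_mat A"
    unfolding invertible_mat_def inverts_mat_def square_mat.simps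
    using A adj_mat(1)[OF A] by (auto intro!: exI[of _ "(1 / det A) \<cdot>\<^sub>m adj_mat A"])
qed

lemma mat_inverse_adj:
  fixes A :: "real mat"
  assumes A: "A \<in> carrier_mat n n" and d: "det A \<noteq> 0"
  shows "the (mat_inverse A) = (1 / det A) \<cdot>\<^sub>m adj_mat A" "A * the (mat_inverse A) = 1\<^sub>m n"
    "the (mat_inverse A) \<in> carrier_mat n n"
proof -
  let ?B = "(1 / det A) \<cdot>\<^sub>m adj_mat A"
  have B: "?B \<in> carrier_mat n n" using adj_mat(1)[OF A] by simp
  note inv = adj_mat_inverse[OF A d]
  have "A \<in> Units (ring_mat TYPE(real) n ())" unfolding Units_def ring_mat_def using A B inv by auto
  then obtain C where C: "mat_inverse A = Some C" using mat_inverse(1)[OF A, of "()"] by (cases "mat_inverse A") auto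
  then have C': "A * C = 1\<^sub>m n" "C \<in> carrier_mat n n" using mat_inverse(2)[OF A C] by auto
  have "C = ?B * A * C" using inv(2) C' by simp
  also have "\<dots> = ?B * (A * C)" by (rule assoc_mult_mat[OF B A C'(2)])
  also have "\<dots> = ?B" unfolding C'(1) by (rule right_mult_one_mat[OF B])
  finally show "the (mat_inverse A) = ?B" using C by simp
  show "A * the (mat_inverse A) = 1\<^sub>m n" "the (mat_inverse A) \<in> carrier_mat n n" using C C' by simp_all
qed

text \<open>The vector of predictions is \<open>k(X, X) p = y - lam p\<close>.\<close>

lemma train_error_eq:
  fixes k :: "real vec \<Rightarrow> real vec \<Rightarrow> real"
  assumes X: "X \<in> carrier_mat d n" and y: "y \<in> carrier_vec n" and inv: "invertible_mat (ridge_mat k lam X)"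
  defines "p \<equiv> the (mat_inverse (ridge_mat k lam X)) *\<^sub>v y"
  shows "p \<in> carrier_vec n" "ridge_mat k lam X *\<^sub>v p = y"
    "train_error k lam X y = lam\<^sup>2 / real n * (\<Sum>\<alpha><n. (p $ \<alpha>)\<^sup>2)"
proof -
  let ?M = "ridge_mat k lam X"
  have M: "?M \<in> carrier_mat n n" by (rule ridge_mat_carrier[OF X])
  have d: "det ?M \<noteq> 0" using inv invertible_mat_iff_det[OF M] by simp
  note inv = mat_inverse_adj(2,3)[OF M d]
  show p: "p \<in> carrier_vec n" using inv(2) y by (simp add: p_def)
  have "?M *\<^sub>v p = (?M * the (mat_inverse ?M)) *\<^sub>v y" unfolding p_def using assoc_mult_mat_vec[OF M inv(2) y] by simp
  also have "\<dots> = y" using inv(1) y by simp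
  finally show Mp: "?M *\<^sub>v p = y" .
  have n: "dim_col X = n" using X by simp
  define f where "f = vec n (\<lambda>i. ridge_predictor k lam X y (col X i)) - y"
  have f: "f \<in> carrier_vec n" using y by (auto simp: f_def)
  have "f $ \<alpha> = - lam * p $ \<alpha>" if a: "\<alpha> < n" for \<alpha>
  proof -
    have "y $ \<alpha> = (\<Sum>\<beta><n. ?M $$ (\<alpha>, \<beta>) * p $ \<beta>)" using mult_mat_vec_nth[OF M p a] Mp by simp
    also have "\<dots> = (\<Sum>\<beta><n. k (col X \<alpha>) (col X \<beta>) * p $ \<beta> + (if \<alpha> = \<beta> then lam * p $ \<alpha> else 0))"
      using a X by (intro sum.cong refl) (auto simp: ridge_mat_def kernel_mat_def distrib_right)
    also have "\<dots> = (\<Sum>\<beta><n. k (col X \<alpha>) (col X \<beta>) * p $ \<beta>) + lam * p $ \<alpha>" using a by (simp add: sum.distrib)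
    also have "(\<Sum>\<beta><n. k (col X \<alpha>) (col X \<beta>) * p $ \<beta>) = ridge_predictor k lam X y (col X \<alpha>)"
      unfolding ridge_predictor_def p_def[symmetric] kernel_vec_def n using p
      by (auto simp: scalar_prod_def atLeast0LessThan intro!: sum.cong)
    finally show ?thesis using a y by (simp add: f_def)
  qed
  then have "(vec_nrm f)\<^sup>2 = lam\<^sup>2 * (\<Sum>\<alpha><n. (p $ \<alpha>)\<^sup>2)"
    unfolding vec_nrm_square[OF f] by (simp add: power_mult_distrib sum_distrib_left)
  then show "train_error k lam X y = lam\<^sup>2 / real n * (\<Sum>\<alpha><n. (p $ \<alpha>)\<^sup>2)"
    unfolding train_error_def n f_def[symmetric] by simp
qed

lemma invertible_of_coercive:
  assumes X: "X \<in> carrier_mat d n"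
    and k: "\<And>\<alpha> \<beta>. \<alpha> < n \<Longrightarrow> \<beta> < n \<Longrightarrow> k (col X \<alpha>) (col X \<beta>) = A \<alpha> \<beta>"
    and lam: "0 \<le> lam" and c: "0 < c" and A: "\<And>u. c * (\<Sum>\<alpha><n. (u \<alpha>)\<^sup>2) \<le> bil n A u u"
  shows "invertible_mat (ridge_mat k lam X)"
proof (rule ccontr)
  let ?M = "ridge_mat k lam X"
  have M: "?M \<in> carrier_mat n n" by (rule ridge_mat_carrier[OF X])
  assume "\<not> invertible_mat ?M"
  then have "det ?M = 0" using invertible_mat_iff_det[OF M] by simp
  then obtain v where v: "v \<in> carrier_vec n" "v \<noteq> 0\<^sub>v n" "?M *\<^sub>v v = 0\<^sub>v n"
    using det_0_iff_vec_prod_zero_field[OF M] by blast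
  have "bil n A (\<lambda>\<beta>. v $ \<beta>) (\<lambda>\<beta>. v $ \<beta>) + lam * (\<Sum>\<alpha><n. v $ \<alpha> * v $ \<alpha>) = 0"
    using ridge_mat_bil[where k = k and A = A, OF X v(1) k, of "\<lambda>\<beta>. v $ \<beta>" lam] v(3) by simp
  moreover have "0 \<le> lam * (\<Sum>\<alpha><n. v $ \<alpha> * v $ \<alpha>)" using lam by (simp add: sum_nonneg)
  ultimately have "c * (\<Sum>\<alpha><n. (v $ \<alpha>)\<^sup>2) \<le> 0" using A[of "\<lambda>\<beta>. v $ \<beta>"] by linarith
  then have "(\<Sum>\<alpha><n. (v $ \<alpha>)\<^sup>2) \<le> 0" using c by (simp add: mult_le_0_iff)
  then have "(\<Sum>\<alpha><n. (v $ \<alpha>)\<^sup>2) = 0" by (simp add: order_antisym sum_nonneg)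
  then have "v $ \<alpha> = 0" if "\<alpha> < n" for \<alpha> using that by (simp add: sum_nonneg_eq_0_iff)
  then have "v = 0\<^sub>v n" using v(1) by (intro eq_vecI) auto
  then show False using v(2) by simp
qed

section \<open>Comparison of the training errors\<close>

lemma borel_measurable_det:
  fixes A :: "'a \<Rightarrow> real mat"
  assumes A: "\<And>w. A w \<in> carrier_mat n n"
    and m: "\<And>i j. i < n \<Longrightarrow> j < n \<Longrightarrow> (\<lambda>w. A w $$ (i, j)) \<in> borel_measurable M"
  shows "(\<lambda>w. det (A w)) \<in> borel_measurable M"
proof -
  have "det (A w) = (\<Sum>p\<in>{p. p permutes {0..<n}}. signof p * (\<Prod>i = 0..<n. A w $$ (i, p i)))" for w
    by (rule det_def'[OF A])
  moreover have "(\<lambda>w. \<Sum>p\<in>{p. p permutes {0..<n}}. signof p * (\<Prod>i = 0..<n. A w $$ (i, p i))) \<in> borel_measurable M"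
  proof (intro borel_measurable_sum borel_measurable_times borel_measurable_const borel_measurable_prod)
    fix p i assume "p \<in> {p. p permutes {0..<n}}" "i \<in> {0..<n}"
    then have "i < n" "p i < n" using permutes_in_image[of p "{0..<n}" i] by auto
    then show "(\<lambda>w. A w $$ (i, p i)) \<in> borel_measurable M" by (rule m)
  qed
  ultimately show ?thesis by simp
qed

lemma borel_measurable_adj:
  fixes A :: "'a \<Rightarrow> real mat"
  assumes A: "\<And>w. A w \<in> carrier_mat n n"
    and m: "\<And>i j. i < n \<Longrightarrow> j < n \<Longrightarrow> (\<lambda>w. A w $$ (i, j)) \<in> borel_measurable M"
    and ij: "i < n" "j < n"
  shows "(\<lambda>w. adj_mat (A w) $$ (i, j)) \<in> borel_measurable M"
proof -
  have "adj_mat (A w) $$ (i, j) = (-1) ^ (j + i) * det (mat_delete (A w) j i)" for w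
    using A[of w] ij by (simp add: adj_mat_def cofactor_def)
  moreover have "(\<lambda>w. (-1) ^ (j + i) * det (mat_delete (A w) j i)) \<in> borel_measurable M"
  proof (intro borel_measurable_times borel_measurable_const borel_measurable_det)
    show "mat_delete (A w) j i \<in> carrier_mat (n - 1) (n - 1)" for w
      using A[of w] by (intro mat_delete_carrier) auto
    fix a b assume "a < n - 1" "b < n - 1"
    then have "mat_delete (A w) j i $$ (a, b) = A w $$ (if a < j then a else Suc a, if b < i then b else Suc b)" for w
      using A[of w] by (simp add: mat_delete_def)
    moreover have "(if a < j then a else Suc a) < n" "(if b < i then b else Suc b) < n"
      using \<open>a < n - 1\<close> \<open>b < n - 1\<close> by auto
    ultimately show "(\<lambda>w. mat_delete (A w) j i $$ (a, b)) \<in> borel_measurable M" using m by simp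
  qed
  ultimately show ?thesis by simp
qed

text \<open>The event of the theorem is defined through Gauss-Jordan elimination. Where the determinant does not vanish, Cramer's
rule expresses the training error as a rational function of the entries of the kernel matrix.\<close>

lemma training_event_measurable:
  fixes m :: nat
  assumes X: "X \<in> carrier_mat d n" and y: "y \<in> carrier_vec n" and s[measurable]: "\<sigma> \<in> borel_measurable borel"
  defines "W \<equiv> std_gaussian ({..<m} \<times> {..<d})"
  shows "{w \<in> space W. let W = mat m d w in invertible_mat (ridge_mat (rf_kernel \<sigma> W) lam X)
     \<and> \<bar>train_error (rf_kernel \<sigma> W) lam X y - c\<bar> \<le> b} \<in> sets W"
proof -
  define A where "A w = ridge_mat (rf_kernel \<sigma> (mat m d w)) lam X" for w
  have A: "A w \<in> carrier_mat n n" for w unfolding A_def by (rule ridge_mat_carrier[OF X])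
  let ?x = "\<lambda>\<alpha> j. X $$ (j, \<alpha>)"
  have Am: "(\<lambda>w. A w $$ (i, j)) \<in> borel_measurable W" if ij: "i < n" "j < n" for i j
  proof -
    have "A w $$ (i, j) = sample_kernel \<sigma> {..<d} ?x m w i j + lam * (if i = j then 1 else 0)" for w
      using ij X by (simp add: A_def ridge_mat_def kernel_mat_def rf_kernel_eq[OF X])
    moreover have "(\<lambda>w. sample_kernel \<sigma> {..<d} ?x m w i j) \<in> borel_measurable W"
      unfolding sample_kernel_def W_def
    proof (intro borel_measurable_times borel_measurable_const borel_measurable_sum)
      fix k assume "k \<in> {..<m}"
      then have k: "k < m" by simp
      have "(\<lambda>w. \<sigma> (ip {..<d} a (row_of {..<d} w k))) \<in> borel_measurable (std_gaussian ({..<m} \<times> {..<d}))" for a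
        by (rule measurable_compose[OF measurable_compose[OF measurable_row_of[OF k] measurable_ip] s])
      then show "(\<lambda>w. \<sigma> (ip {..<d} (?x i) (row_of {..<d} w k))) \<in> borel_measurable (std_gaussian ({..<m} \<times> {..<d}))"
        "(\<lambda>w. \<sigma> (ip {..<d} (?x j) (row_of {..<d} w k))) \<in> borel_measurable (std_gaussian ({..<m} \<times> {..<d}))"
        by blast+
    qed
    ultimately show ?thesis by simp
  qed
  define g where "g w = lam\<^sup>2 / real n * (\<Sum>\<alpha><n. ((1 / det (A w)) * (\<Sum>\<beta><n. adj_mat (A w) $$ (\<alpha>, \<beta>) * y $ \<beta>))\<^sup>2)" for w
  have [measurable]: "(\<lambda>w. det (A w)) \<in> borel_measurable W" by (rule borel_measurable_det[OF A Am])
  have [measurable]: "g \<in> borel_measurable W"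
    unfolding g_def[abs_def]
    by (intro borel_measurable_times borel_measurable_const borel_measurable_sum borel_measurable_power
        borel_measurable_divide borel_measurable_adj[OF A Am] borel_measurable_det[OF A Am]) auto
  have te: "train_error (rf_kernel \<sigma> (mat m d w)) lam X y = g w" if "det (A w) \<noteq> 0" for w
  proof -
    have inv: "invertible_mat (A w)" using that invertible_mat_iff_det[OF A] by simp
    have "(the (mat_inverse (A w)) *\<^sub>v y) $ \<alpha> = (1 / det (A w)) * (\<Sum>\<beta><n. adj_mat (A w) $$ (\<alpha>, \<beta>) * y $ \<beta>)" if "\<alpha> < n" for \<alpha>
    proof -
      note adj = adj_mat(1)[OF A[of w]]
      have "((1 / det (A w)) \<cdot>\<^sub>m adj_mat (A w) *\<^sub>v y) $ \<alpha> = (\<Sum>\<beta><n. ((1 / det (A w)) \<cdot>\<^sub>m adj_mat (A w)) $$ (\<alpha>, \<beta>) * y $ \<beta>)"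
        using adj y that by (intro mult_mat_vec_nth) auto
      also have "\<dots> = (\<Sum>\<beta><n. (1 / det (A w)) * (adj_mat (A w) $$ (\<alpha>, \<beta>) * y $ \<beta>))"
        using adj that by (intro sum.cong refl) simp
      finally show ?thesis unfolding mat_inverse_adj(1)[OF A \<open>det (A w) \<noteq> 0\<close>] sum_distrib_left .
    qed
    then show ?thesis
      using train_error_eq(3)[OF X y inv[unfolded A_def]] by (simp add: g_def A_def[symmetric])
  qed
  have "{w \<in> space W. let W = mat m d w in invertible_mat (ridge_mat (rf_kernel \<sigma> W) lam X)
     \<and> \<bar>train_error (rf_kernel \<sigma> W) lam X y - c\<bar> \<le> b} = {w \<in> space W. det (A w) \<noteq> 0 \<and> \<bar>g w - c\<bar> \<le> b}"
    unfolding Let_def A_def[symmetric] invertible_mat_iff_det[OF A] using te by auto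
  also have "\<dots> \<in> sets W" by measurable
  finally show ?thesis .
qed

text \<open>On the event of \<open>kernel_concentration\<close> both kernel matrices are coercive, with constants \<open>c\<close> and \<open>c / 2\<close>, so both
predictors are defined for every \<open>lam \<ge> 0\<close>. For \<open>lam = 0\<close> both training errors are zero, in accordance with the
convention \<open>C1 = x / 0 = 0\<close>; for \<open>lam > 0\<close> they are compared by \<open>ridge_solution_perturbation\<close>.\<close>

lemma training_error_comparison:
  fixes lam V c :: real
  assumes L: "L-lipschitz_on UNIV \<sigma>" "0 < L" and V: "0 < V" and mean: "(\<integral>t. \<sigma> t \<partial>N) = 0"
    and X: "X \<in> carrier_mat d n" and y: "y \<in> carrier_vec n" and lam: "0 \<le> lam"
    and op: "op_bound {..<d} {..<n} (\<lambda>\<alpha> j. X $$ (j, \<alpha>)) V"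
    and nrm: "(\<Sum>\<alpha><n. (sqrt (\<Sum>i<d. (X $$ (i, \<alpha>))\<^sup>2) - 1)\<^sup>2) \<le> V\<^sup>2"
    and n: "0 < n" and m: "0 < m" "real n / real m \<le> 3/10"
    and c: "0 < c" "\<And>u. c * (\<Sum>\<alpha><n. (u \<alpha>)\<^sup>2) \<le> bil n (mean_kernel \<sigma> {..<d} (\<lambda>\<alpha> j. X $$ (j, \<alpha>))) u u"
    and small: "2 * (sqrt 1920 / moment_rate L V) * sqrt (real n / real m) \<le> c / 2"
  defines "W \<equiv> std_gaussian ({..<m} \<times> {..<d})"
  defines "C1 \<equiv> 4 * (sqrt 1920 / moment_rate L V) / lam"
  shows "invertible_mat (ridge_mat (expected_kernel \<sigma>) lam X)"
    "measure W {w \<in> space W. let W = mat m d w in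
         invertible_mat (ridge_mat (rf_kernel \<sigma> W) lam X) \<and>
         \<bar>train_error (rf_kernel \<sigma> W) lam X y - train_error (expected_kernel \<sigma>) lam X y\<bar>
           \<le> C1 / sqrt (real n * real m) * (sqrt (real n / real m) + 1) * (vec_nrm y)\<^sup>2}
       \<ge> 1 - 4 * exp (- 2 * real n)"
proof -
  let ?x = "\<lambda>\<alpha> j. X $$ (j, \<alpha>)"
  let ?K = "mean_kernel \<sigma> {..<d} ?x" and ?Kw = "\<lambda>w. sample_kernel \<sigma> {..<d} ?x m w"
  interpret W: prob_space W unfolding W_def by (rule prob_space_std_gaussian)
  note K_eq = expected_kernel_eq[OF X] and Kw_eq = rf_kernel_eq[OF X]
  show invK: "invertible_mat (ridge_mat (expected_kernel \<sigma>) lam X)"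
    by (rule invertible_of_coercive[where A = ?K, OF X K_eq lam c]) simp_all
  define a where "a = sqrt 1920 / moment_rate L V"
  have a: "0 \<le> a" using L V by (simp add: a_def moment_rate_def)
  define q where "q = 2 * (a * sqrt (real n / real m))"
  have q: "0 \<le> q" using a by (simp add: q_def)
  have qc: "q \<le> c / 2" using small by (simp add: q_def a_def)
  obtain G where G: "G \<in> sets W" "measure W G \<ge> 1 - 2 * exp (- 2 * real n)"
    and Gq: "\<And>w u v. w \<in> G \<Longrightarrow> \<bar>bil n (\<lambda>\<alpha> \<beta>. ?Kw w \<alpha> \<beta> - ?K \<alpha> \<beta>) u v\<bar>
       \<le> q * (sqrt (\<Sum>\<alpha><n. (u \<alpha>)\<^sup>2) * sqrt (\<Sum>\<alpha><n. (v \<alpha>)\<^sup>2))"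
    using kernel_concentration[OF L V mean _ op nrm n m] unfolding W_def q_def a_def by blast
  let ?E = "{w \<in> space W. let W = mat m d w in
         invertible_mat (ridge_mat (rf_kernel \<sigma> W) lam X) \<and>
         \<bar>train_error (rf_kernel \<sigma> W) lam X y - train_error (expected_kernel \<sigma>) lam X y\<bar>
           \<le> C1 / sqrt (real n * real m) * (sqrt (real n / real m) + 1) * (vec_nrm y)\<^sup>2}"
  have E: "?E \<in> sets W"
    unfolding W_def by (rule training_event_measurable[OF X y lipschitz_measurable[OF L(1)]])
  have "G \<subseteq> ?E"
  proof
    fix w assume w: "w \<in> G"
    let ?W = "mat m d w"
    have diff: "bil n (\<lambda>\<alpha> \<beta>. ?Kw w \<alpha> \<beta> - ?K \<alpha> \<beta>) u v = bil n (?Kw w) u v - bil n ?K u v" for u v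
      by (simp add: bil_def left_diff_distrib right_diff_distrib sum_subtractf)
    have low: "c / 2 * (\<Sum>\<alpha><n. (u \<alpha>)\<^sup>2) \<le> bil n (?Kw w) u u" for u
    proof -
      have "\<bar>bil n (?Kw w) u u - bil n ?K u u\<bar> \<le> q * (\<Sum>\<alpha><n. (u \<alpha>)\<^sup>2)"
        using Gq[OF w, of u u] unfolding diff by (simp add: sum_nonneg)
      also have "\<dots> \<le> c / 2 * (\<Sum>\<alpha><n. (u \<alpha>)\<^sup>2)" by (intro mult_right_mono qc sum_nonneg) simp
      finally show ?thesis using c(2)[of u] by linarith
    qed
    have invW: "invertible_mat (ridge_mat (rf_kernel \<sigma> ?W) lam X)"
      by (rule invertible_of_coercive[where A = "?Kw w" and c = "c / 2", OF X Kw_eq lam _ low]) (use c in simp_all)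
    let ?p1 = "the (mat_inverse (ridge_mat (expected_kernel \<sigma>) lam X)) *\<^sub>v y"
    let ?p2 = "the (mat_inverse (ridge_mat (rf_kernel \<sigma> ?W) lam X)) *\<^sub>v y"
    note T1 = train_error_eq[OF X y invK] and T2 = train_error_eq[OF X y invW]
    have "\<bar>train_error (rf_kernel \<sigma> ?W) lam X y - train_error (expected_kernel \<sigma>) lam X y\<bar>
       \<le> C1 / sqrt (real n * real m) * (sqrt (real n / real m) + 1) * (vec_nrm y)\<^sup>2"
    proof (cases "lam = 0")
      case True
      then show ?thesis using T1(3) T2(3) by (simp add: C1_def)
    next
      case False
      then have lam: "0 < lam" using lam by simp
      have "\<bar>(\<Sum>\<alpha><n. (?p2 $ \<alpha>)\<^sup>2) - (\<Sum>\<alpha><n. (?p1 $ \<alpha>)\<^sup>2)\<bar> \<le> 2 * q / lam ^ 3 * (\<Sum>\<alpha><n. (y $ \<alpha>)\<^sup>2)"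
      proof (rule ridge_solution_perturbation[OF lam q, where ?K1.0 = ?K and ?K2.0 = "?Kw w"])
        show "0 \<le> bil n ?K u u" for u
          using c(2)[of u] c(1) by (meson mult_nonneg_nonneg less_imp_le order_trans sum_nonneg zero_le_power2)
        show "0 \<le> bil n (?Kw w) u u" for u
          using low[of u] c(1) by (meson half_gt_zero mult_nonneg_nonneg less_imp_le order_trans sum_nonneg zero_le_power2)
        show "\<bar>bil n (\<lambda>\<alpha> \<beta>. ?Kw w \<alpha> \<beta> - ?K \<alpha> \<beta>) u v\<bar> \<le> q * (L2_set u {..<n} * L2_set v {..<n})" for u v
          using Gq[OF w] by (simp add: L2_set_def)
        show "bil n ?K u (($) ?p1) + lam * (\<Sum>\<alpha><n. u \<alpha> * ?p1 $ \<alpha>) = (\<Sum>\<alpha><n. u \<alpha> * y $ \<alpha>)" for u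
          using ridge_mat_bil[where A = ?K and k = "expected_kernel \<sigma>" and lam = lam and u = u, OF X T1(1) K_eq] unfolding T1(2) by simp
        show "bil n (?Kw w) u (($) ?p2) + lam * (\<Sum>\<alpha><n. u \<alpha> * ?p2 $ \<alpha>) = (\<Sum>\<alpha><n. u \<alpha> * y $ \<alpha>)" for u
          using ridge_mat_bil[where A = "?Kw w" and k = "rf_kernel \<sigma> ?W" and lam = lam and u = u, OF X T2(1) Kw_eq] unfolding T2(2) by simp
      qed
      then have "lam\<^sup>2 / real n * \<bar>(\<Sum>\<alpha><n. (?p2 $ \<alpha>)\<^sup>2) - (\<Sum>\<alpha><n. (?p1 $ \<alpha>)\<^sup>2)\<bar> \<le> lam\<^sup>2 / real n * (2 * q / lam ^ 3 * (vec_nrm y)\<^sup>2)"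
        unfolding vec_nrm_square[OF y] by (intro mult_left_mono) simp_all
      moreover have "\<bar>train_error (rf_kernel \<sigma> ?W) lam X y - train_error (expected_kernel \<sigma>) lam X y\<bar>
          = lam\<^sup>2 / real n * \<bar>(\<Sum>\<alpha><n. (?p2 $ \<alpha>)\<^sup>2) - (\<Sum>\<alpha><n. (?p1 $ \<alpha>)\<^sup>2)\<bar>"
        unfolding T1(3) T2(3) right_diff_distrib[symmetric] abs_mult by simp
      moreover have "lam\<^sup>2 / real n * (2 * q / lam ^ 3 * (vec_nrm y)\<^sup>2) = C1 / sqrt (real n * real m) * 1 * (vec_nrm y)\<^sup>2"
      proof -
        have "sqrt (real n / real m) / real n = 1 / sqrt (real n * real m)"
        proof -
          have "sqrt (real n) * sqrt (real n) = real n" by simp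
          then show ?thesis using n m by (simp add: real_sqrt_divide real_sqrt_mult field_simps)
        qed
        moreover have "lam\<^sup>2 / real n * (2 * q / lam ^ 3 * z) = 4 * a * (sqrt (real n / real m) / real n) / lam * z" for z
          using lam by (simp add: q_def power2_eq_square power3_eq_cube)
        ultimately show ?thesis by (simp add: C1_def a_def)
      qed
      moreover have "C1 / sqrt (real n * real m) * 1 * (vec_nrm y)\<^sup>2 \<le> C1 / sqrt (real n * real m) * (sqrt (real n / real m) + 1) * (vec_nrm y)\<^sup>2"
        using a lam by (intro mult_right_mono mult_left_mono) (simp_all add: C1_def a_def[symmetric])
      ultimately show ?thesis by linarith
    qed
    moreover have "w \<in> space W" using w G(1) sets.sets_into_space by blast
    ultimately show "w \<in> ?E" using invW by (simp add: Let_def)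
  qed
  then have "measure W G \<le> measure W ?E" using E by (intro W.finite_measure_mono)
  moreover have "0 \<le> exp (- 2 * real n)" by simp
  ultimately show "measure W ?E \<ge> 1 - 4 * exp (- 2 * real n)" using G(2) by linarith
qed

theorem theorem2p12:
  fixes \<sigma> :: "real \<Rightarrow> real" and lam B :: real
  assumes "activation \<sigma>" and "\<not> linear \<sigma>" and "0 \<le> lam"
  shows "\<exists>C1 C2 :: real. \<forall>(n :: nat \<Rightarrow> nat) (d0 :: nat \<Rightarrow> nat) (d1 :: nat \<Rightarrow> nat)
            (X :: nat \<Rightarrow> real mat) (y :: nat \<Rightarrow> real vec).
      asymptotic_regime B n d0 d1 X \<longrightarrow> (\<forall>k. y k \<in> carrier_vec (n k)) \<longrightarrow>
      (\<forall>\<^sub>F k in sequentially.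
         invertible_mat (ridge_mat (expected_kernel \<sigma>) lam (X k)) \<and>
         measure (std_gaussian ({..<d1 k} \<times> {..<d0 k}))
           {w \<in> space (std_gaussian ({..<d1 k} \<times> {..<d0 k})).
              let W = mat (d1 k) (d0 k) w in
              invertible_mat (ridge_mat (rf_kernel \<sigma> W) lam (X k)) \<and>
              \<bar>train_error (rf_kernel \<sigma> W) lam (X k) (y k)
                 - train_error (expected_kernel \<sigma>) lam (X k) (y k)\<bar>
              \<le> C1 / sqrt (real (n k) * real (d1 k))
                  * (sqrt (real (n k) / real (d1 k)) + C2) * (vec_nrm (y k))\<^sup>2}
         \<ge> 1 - 4 * exp (- 2 * real (n k)))"
proof -
  from assms(1) obtain L where L: "L-lipschitz_on UNIV \<sigma>" "0 < L" and mean: "(\<integral>t. \<sigma> t \<partial>N) = 0"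
    unfolding activation_def by blast
  obtain h where h: "4 \<le> h" "(\<integral>t. \<sigma> t * poly (hermite h) t \<partial>N) \<noteq> 0"
    using nonlinear_hermite_coefficient[OF L(1) mean assms(2)] by blast
  define \<zeta> where "\<zeta> = (\<integral>t. \<sigma> t * poly (hermite h) t \<partial>N)"
  define c where "c = \<zeta>\<^sup>2 / (8 * fact h)"
  have c: "0 < c" using h by (simp add: c_def \<zeta>_def)
  \<comment> \<open>The constant \<open>moment_rate L V\<close> needs a positive \<open>V\<close>, whereas \<open>B = 0\<close> is possible.\<close>
  define V where "V = max B 1"
  have V: "0 < V" by (simp add: V_def)
  define a where "a = sqrt 1920 / moment_rate L V"
  show ?thesis
  proof (rule exI[of _ "4 * a / lam"], rule exI[of _ 1], intro allI impI)
    fix n d0 d1 :: "nat \<Rightarrow> nat" and X :: "nat \<Rightarrow> real mat" and y :: "nat \<Rightarrow> real vec"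
    assume reg: "asymptotic_regime B n d0 d1 X" and y: "\<forall>k. y k \<in> carrier_vec (n k)"
    from reg have n_lim: "filterlim n at_top sequentially" and d1_lim: "filterlim d1 at_top sequentially"
      and X: "\<And>k. X k \<in> carrier_mat (d0 k) (n k)" and ratio: "(\<lambda>k. real (n k) / real (d1 k)) \<longlonglongrightarrow> 0"
      unfolding asymptotic_regime_def by auto
    from reg obtain \<epsilon> where orth: "\<And>k. orthonormal_up_to (\<epsilon> k) B (X k)"
      and \<epsilon>_lim: "(\<lambda>k. real (n k) * \<epsilon> k ^ 4) \<longlonglongrightarrow> 0"
      unfolding asymptotic_regime_def by auto
    define M where "M = (\<integral>t. \<bar>t * poly (hermite h) t\<bar> \<partial>N)"
    have M0: "0 \<le> M" unfolding M_def by (intro Bochner_Integration.integral_nonneg) simp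
    \<comment> \<open>Columns this close to unit norm keep at least half of the Hermite coefficient \<open>\<zeta>\<close>.\<close>
    define e0 where "e0 = min (1/4) (\<bar>\<zeta>\<bar> / (2 * (L * (M + 1))))"
    have e0: "0 < e0" "e0 \<le> 1/4" "L * e0 * M \<le> \<bar>\<zeta>\<bar> / 2"
    proof -
      show "0 < e0" using h L(2) M0 by (simp add: e0_def \<zeta>_def)
      show "e0 \<le> 1/4" unfolding e0_def by (rule min.cobounded1)
      have "L * e0 * M \<le> L * (M + 1) * e0" using L(2) \<open>0 < e0\<close> by (simp add: algebra_simps)
      also have "\<dots> \<le> L * (M + 1) * (\<bar>\<zeta>\<bar> / (2 * (L * (M + 1))))"
        using L(2) M0 by (intro mult_left_mono) (simp_all add: e0_def)
      also have "\<dots> = \<bar>\<zeta>\<bar> / 2"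
      proof -
        have "L * (M + 1) \<noteq> 0" using L(2) M0 by simp
        then show ?thesis by (simp add: field_simps)
      qed
      finally show "L * e0 * M \<le> \<bar>\<zeta>\<bar> / 2" .
    qed
    have ev_n: "\<forall>\<^sub>F k in sequentially. 2 \<le> n k" using n_lim by (simp add: filterlim_at_top)
    have ev_d1: "\<forall>\<^sub>F k in sequentially. 1 \<le> d1 k" using d1_lim by (simp add: filterlim_at_top)
    have ev_r: "\<forall>\<^sub>F k in sequentially. real (n k) / real (d1 k) < 3/10"
      by (rule order_tendstoD(2)[OF ratio]) simp
    have "(\<lambda>k. 2 * a * sqrt (real (n k) / real (d1 k))) \<longlonglongrightarrow> 2 * a * sqrt 0"
      by (intro tendsto_intros ratio)
    then have ev_s: "\<forall>\<^sub>F k in sequentially. 2 * a * sqrt (real (n k) / real (d1 k)) < c / 2"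
      by (rule order_tendstoD(2)) (use c in simp)
    have ev_e: "\<forall>\<^sub>F k in sequentially. real (n k) * \<epsilon> k ^ 4 < e0 ^ 4"
      by (rule order_tendstoD(2)[OF \<epsilon>_lim]) (use e0 in simp)
    \<comment> \<open>The threshold \<open>1/512\<close> is \<open>1/2\<close> divided by \<open>4 ^ 4\<close>, as \<open>mean_kernel_lower_bound\<close> asks for \<open>n (4 \<epsilon>)\<^sup>4 \<le> 1/2\<close>.\<close>
    have ev_e': "\<forall>\<^sub>F k in sequentially. real (n k) * \<epsilon> k ^ 4 < 1/512"
      by (rule order_tendstoD(2)[OF \<epsilon>_lim]) simp
    show "\<forall>\<^sub>F k in sequentially.
         invertible_mat (ridge_mat (expected_kernel \<sigma>) lam (X k)) \<and>
         measure (std_gaussian ({..<d1 k} \<times> {..<d0 k}))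
           {w \<in> space (std_gaussian ({..<d1 k} \<times> {..<d0 k})).
              let W = mat (d1 k) (d0 k) w in
              invertible_mat (ridge_mat (rf_kernel \<sigma> W) lam (X k)) \<and>
              \<bar>train_error (rf_kernel \<sigma> W) lam (X k) (y k)
                 - train_error (expected_kernel \<sigma>) lam (X k) (y k)\<bar>
              \<le> (4 * a / lam) / sqrt (real (n k) * real (d1 k))
                  * (sqrt (real (n k) / real (d1 k)) + 1) * (vec_nrm (y k))\<^sup>2}
         \<ge> 1 - 4 * exp (- 2 * real (n k))"
      using ev_n ev_d1 ev_r ev_s ev_e ev_e'
    proof eventually_elim
      case (elim k)
      have yk: "y k \<in> carrier_vec (n k)" using y by blast
      have dimX: "dim_col (X k) = n k" using X[of k] by simp
      have colX: "col (X k) \<alpha> \<in> carrier_vec (d0 k)" if "\<alpha> < n k" for \<alpha> using X[of k] that by simp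
      have nrm_col: "vec_nrm (col (X k) \<alpha>) = sqrt (\<Sum>i<d0 k. (X k $$ (i, \<alpha>))\<^sup>2)" if "\<alpha> < n k" for \<alpha>
        unfolding vec_nrm_L2[OF colX[OF that]] L2_set_def using X[of k] that by simp
      have ip_col: "col (X k) \<alpha> \<bullet> col (X k) \<beta> = (\<Sum>i<d0 k. X k $$ (i, \<alpha>) * X k $$ (i, \<beta>))" if "\<alpha> < n k" "\<beta> < n k" for \<alpha> \<beta>
        using X[of k] that by (auto simp: scalar_prod_def atLeast0LessThan intro!: sum.cong)
      from orth[of k] have near: "\<And>\<alpha> \<beta>. \<alpha> < n k \<Longrightarrow> \<beta> < n k \<Longrightarrow> \<alpha> \<noteq> \<beta> \<Longrightarrow>
           \<bar>vec_nrm (col (X k) \<alpha>) - 1\<bar> \<le> \<epsilon> k \<and> \<bar>col (X k) \<alpha> \<bullet> col (X k) \<beta>\<bar> \<le> \<epsilon> k"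
        and sumB: "(\<Sum>\<alpha><n k. (vec_nrm (col (X k) \<alpha>) - 1)\<^sup>2) \<le> B\<^sup>2" and spec: "spectral_norm (X k) \<le> B"
        unfolding orthonormal_up_to_def dimX by auto
      note opB = op_bound_spectral_norm[OF X spec]
      have BV: "B\<^sup>2 \<le> V\<^sup>2" using opB(1) by (intro power_mono) (simp_all add: V_def)
      have op: "op_bound {..<d0 k} {..<n k} (\<lambda>\<alpha> j. X k $$ (j, \<alpha>)) V"
        unfolding op_bound_def
      proof
        fix v :: "nat \<Rightarrow> real"
        have "(\<Sum>i<d0 k. (\<Sum>\<alpha><n k. v \<alpha> * X k $$ (i, \<alpha>))\<^sup>2) \<le> B\<^sup>2 * (\<Sum>\<alpha><n k. (v \<alpha>)\<^sup>2)"
          using opB(2) unfolding op_bound_def by blast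
        also have "\<dots> \<le> V\<^sup>2 * (\<Sum>\<alpha><n k. (v \<alpha>)\<^sup>2)" by (intro mult_right_mono BV sum_nonneg) simp
        finally show "(\<Sum>i<d0 k. (\<Sum>\<alpha><n k. v \<alpha> * X k $$ (i, \<alpha>))\<^sup>2) \<le> V\<^sup>2 * (\<Sum>\<alpha><n k. (v \<alpha>)\<^sup>2)" .
      qed
      have nrm: "(\<Sum>\<alpha><n k. (sqrt (\<Sum>i<d0 k. (X k $$ (i, \<alpha>))\<^sup>2) - 1)\<^sup>2) \<le> V\<^sup>2"
        using sumB BV by (simp add: nrm_col)
      have "0 < n k" "1 < n k" using elim(1) by simp_all
      then have \<epsilon>0: "0 \<le> \<epsilon> k" using near[of 0 1] by linarith
      have \<epsilon>e0: "\<epsilon> k \<le> e0"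
      proof (rule ccontr)
        assume "\<not> \<epsilon> k \<le> e0"
        then have "e0 ^ 4 \<le> \<epsilon> k ^ 4" using e0 by (intro power_mono) simp_all
        moreover have "1 * \<epsilon> k ^ 4 \<le> real (n k) * \<epsilon> k ^ 4" using elim(1) by (intro mult_right_mono) simp_all
        ultimately show False using elim(5) by simp
      qed
      have low: "c * (\<Sum>\<alpha><n k. (u \<alpha>)\<^sup>2) \<le> bil (n k) (mean_kernel \<sigma> {..<d0 k} (\<lambda>\<alpha> j. X k $$ (j, \<alpha>))) u u" for u
        unfolding c_def \<zeta>_def
      proof (rule mean_kernel_lower_bound[OF L(1) _ h(1), where \<epsilon> = "\<epsilon> k"])
        fix \<alpha> assume \<alpha>: "\<alpha> < n k"
        \<comment> \<open>Near-orthonormality only speaks of pairs of distinct columns, hence \<open>2 \<le> n k\<close>.\<close>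
        obtain \<beta> where "\<beta> < n k" "\<alpha> \<noteq> \<beta>" using \<open>0 < n k\<close> \<open>1 < n k\<close> by (metis zero_neq_one)
        then show "\<bar>sqrt (\<Sum>i<d0 k. (X k $$ (i, \<alpha>))\<^sup>2) - 1\<bar> \<le> \<epsilon> k" using near[OF \<alpha>] nrm_col[OF \<alpha>] by auto
      next
        fix \<alpha> \<beta> assume "\<alpha> < n k" "\<beta> < n k" "\<alpha> \<noteq> \<beta>"
        then show "\<bar>\<Sum>i<d0 k. X k $$ (i, \<alpha>) * X k $$ (i, \<beta>)\<bar> \<le> \<epsilon> k" using near[of \<alpha> \<beta>] ip_col[of \<alpha> \<beta>] by simp
      next
        have "real (n k) * (4 * \<epsilon> k) ^ 4 = 256 * (real (n k) * \<epsilon> k ^ 4)" by (simp add: power_mult_distrib)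
        then show "real (n k) * (4 * \<epsilon> k) ^ 4 \<le> 1/2" using elim(6) by linarith
        have "L * \<epsilon> k * M \<le> L * e0 * M" using \<epsilon>e0 L(2) M0 by (intro mult_right_mono mult_left_mono) simp_all
        then show "L * \<epsilon> k * (\<integral>t. \<bar>t * poly (hermite h) t\<bar> \<partial>N) \<le> \<bar>\<integral>t. \<sigma> t * poly (hermite h) t \<partial>N\<bar> / 2"
          using e0(3) unfolding M_def \<zeta>_def by linarith
      qed (use \<epsilon>0 \<epsilon>e0 e0 in simp_all)
      have "0 < d1 k" "real (n k) / real (d1 k) \<le> 3/10" using elim by simp_all
      moreover have "2 * (sqrt 1920 / moment_rate L V) * sqrt (real (n k) / real (d1 k)) \<le> c / 2"
        using elim(4) by (simp add: a_def)
      ultimately show ?case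
        using training_error_comparison[OF L V mean X yk assms(3) op nrm \<open>0 < n k\<close> _ _ c low]
        unfolding a_def by blast
    qed
  qed
qed

end
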